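(* Let $s=s(n)$ satisfy $s=o(n)$ and $n^{2/3}=o(s)$, and let $M=n/2+s$. Then the circumference of $\mathcal G(n,M)$ is asymptotically almost surely at most $(6.958+o(1))s^2/n$.
   Context: $\mathcal G(n,M)$ denotes the uniform probability space of all graphs on the vertex set $\{1,\dots,n\}$ with exactly $M$ edges. A property holds asymptotically almost surely (a.a.s.) if its probability is $1-o(1)$ as $n\to\infty$. The circumference of a graph is the length of its longest cycle. *)

theory Defs
  imports "HOL-Analysis.Analysis" "HOL-Library.Landau_Symbols"
begin

text \<open>Simple graphs on the vertex set {1..n}, represented by their edge sets:
  an edge is a 2-element subset of {1..n}.\<close>

definition all_edges :: "nat \<Rightarrow> nat set set" where
  "all_edges n = {e. \<exists>u v. e = {u, v} \<and> u \<noteq> v \<and> u \<in> {1..n} \<and> v \<in> {1..n}}"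

definition graphs_nm :: "nat \<Rightarrow> nat \<Rightarrow> nat set set set" where
  "graphs_nm n m = {E. E \<subseteq> all_edges n \<and> card E = m}"

definition prob_Gnm :: "nat \<Rightarrow> nat \<Rightarrow> (nat set set \<Rightarrow> bool) \<Rightarrow> real" where
  "prob_Gnm n m P = real (card {E \<in> graphs_nm n m. P E}) / real (card (graphs_nm n m))"

definition is_cycle :: "nat set set \<Rightarrow> nat list \<Rightarrow> bool" where
  "is_cycle E vs \<longleftrightarrow> length vs \<ge> 3 \<and> distinct vs \<and>
     (\<forall>i < length vs. {vs ! i, vs ! ((i + 1) mod length vs)} \<in> E)"

definition circumference :: "nat set set \<Rightarrow> nat" where
  "circumference E = Sup ({length vs | vs. is_cycle E vs} \<union> {0})"

end

theory Submission
  imports Defs "HOL-Real_Asymp.Real_Asymp"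
begin

text \<open>
  By monotonicity it suffices to treat the binomial model with edge probability \<open>p = (1 + e) / n\<close>,
  where \<open>e\<close> is slightly larger than \<open>2 \<bar>s\<bar> / n\<close>; this also covers negative \<open>s\<close>. Put
  \<open>\<mu> = e\<^sup>3 n\<close>, which tends to infinity.

  A long cycle lies in the 2-core \<open>U\<close> of its component, and the component is \<open>U\<close> with a rooted
  forest attached. A first-moment count of components whose core has \<open>\<omega> e\<^sup>2 n\<close> vertices gives
  \<open>exp (\<mu> r(\<omega>))\<close> with \<open>r(\<omega>) < 0\<close> unless \<open>\<omega> = 2\<close>, so only cores with \<open>\<omega>\<close> at most slightly above 2
  matter. Counting pairs of such a core and a cycle of length \<open>\<Lambda> e\<^sup>2 n\<close> in it
  replaces \<open>r\<close> by \<open>2/3 - \<omega> + \<Lambda> z + z\<^sup>3 / 6\<close>, where \<open>z\<^sup>2 / 2 = \<omega> - \<Lambda>\<close>; at \<open>\<omega> = 2\<close> this is negative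
  exactly for \<open>\<Lambda> > \<surd>3\<close>. In the original scale this bounds the circumference by
  \<open>(4 \<surd>3 + o(1)) s\<^sup>2 / n\<close>, and \<open>4 \<surd>3 < 6.958\<close>.

  Since \<open>\<mu>\<close> may grow arbitrarily slowly, the counts must not lose powers of \<open>n\<close>. For the forests
  this is achieved by a generating-function bound that sums over all sizes at once, for the cores
  by counting half-edge matchings in which no set of degree-two vertices is closed.
\<close>

subsection \<open>Random subsets of a finite set\<close>

text \<open>Marking a cycle in the core multiplies the count by the number of long cycles per core.
  For \<open>\<Lambda>\<close> near \<surd>3 the resulting exponent stays negative only up to a core
  size slightly above 2, so pairs are counted for \<open>\<omega>\<close> \<le> 401/200 and cores
  alone beyond. Both counts treat the number \<open>m\<close> of edges left after suppressing
  degree-two vertices as at most a small fraction \<open>g\<close> of the core size. Cores violating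
  this are dense vertex sets, excluded by a crude first moment that works below \<open>c n\<close>
  vertices; components above \<open>c n\<close> are excluded by an exploration process, where a
  factor \<open>n\<close> is harmless.

  No power of the core scale \<open>N = e\<^sup>2 n\<close> survives: about \<open>N\<^sup>2\<close>
  pairs of cycle length and remaining core size are summed, and each pair gains \<open>1 / l\<close>
  from the rotations of the cycle and \<open>1 / (l + w)\<close> from the enumeration of cores.

  Constants: \<surd>3 = 1.7320... < 1739/1000 < 6.958 / 4 = 1.7395. The lower gap pays for 401/200
  in place of 2 and for \<open>g\<close>, the upper one for the passage from exactly
  \<open>M\<close> edges to independent edges.\<close>

definition rexp :: "real \<Rightarrow> 'a set \<Rightarrow> ('a set \<Rightarrow> real) \<Rightarrow> real" where
  "rexp p V f = (\<Sum>E\<in>Pow V. p ^ card E * (1 - p) ^ card (V - E) * f E)"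

abbreviation (input) rprob :: "real \<Rightarrow> 'a set \<Rightarrow> ('a set \<Rightarrow> bool) \<Rightarrow> real" where
  "rprob p V A \<equiv> rexp p V (\<lambda>E. of_bool (A E))"

lemma rexp_const [simp]:
  assumes "finite V"
  shows "rexp p V (\<lambda>_. c) = c"
proof -
  have "(\<Sum>X\<in>Pow V. p ^ card X * (1 - p) ^ card (V - X)) =
      (\<Sum>X\<in>Pow V. (\<Prod>x\<in>X. p) * (\<Prod>x\<in>V-X. 1 - p))"
    by simp
  also have "\<dots> = (\<Prod>x\<in>V. p + (1 - p))" by (rule prod_add[OF assms, symmetric])
  also have "\<dots> = 1" by simp
  finally have "(\<Sum>X\<in>Pow V. p ^ card X * (1 - p) ^ card (V - X)) = 1" .
  then show ?thesis
    unfolding rexp_def sum_distrib_right[symmetric] by simp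
qed

lemma rexp_mono:
  assumes "0 \<le> p" "p \<le> 1" "\<And>E. E \<subseteq> V \<Longrightarrow> f E \<le> g E"
  shows "rexp p V f \<le> rexp p V g"
  unfolding rexp_def using assms by (intro sum_mono mult_left_mono) auto

lemma rexp_nonneg:
  assumes "0 \<le> p" "p \<le> 1" "\<And>E. E \<subseteq> V \<Longrightarrow> 0 \<le> f E"
  shows "0 \<le> rexp p V f"
  unfolding rexp_def using assms by (intro sum_nonneg mult_nonneg_nonneg) auto

lemma rexp_sum: "rexp p V (\<lambda>E. \<Sum>i\<in>I. f i E) = (\<Sum>i\<in>I. rexp p V (f i))"
  unfolding rexp_def sum_distrib_left by (rule sum.swap)

lemma rexp_add: "rexp p V (\<lambda>E. f E + g E) = rexp p V f + rexp p V g"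
  unfolding rexp_def by (simp add: distrib_left sum.distrib)

lemma rexp_cmult: "rexp p V (\<lambda>E. c * f E) = c * rexp p V f"
  unfolding rexp_def sum_distrib_left by (rule sum.cong) auto

lemma rexp_cong: "(\<And>E. E \<subseteq> V \<Longrightarrow> f E = g E) \<Longrightarrow> rexp p V f = rexp p V g"
  unfolding rexp_def by (rule sum.cong) auto

text \<open>Independence as an iterated expectation: the elements of \<open>B\<close> are revealed
  before the others. Conditioning on a part of the graph is expressed by this split.\<close>

lemma rexp_split:
  assumes "finite V" "B \<subseteq> V"
  shows "rexp p V f = rexp p B (\<lambda>E1. rexp p (V - B) (\<lambda>E2. f (E1 \<union> E2)))"
proof -
  have fB: "finite B" using assms finite_subset by blast
  have bij: "bij_betw (\<lambda>(E1,E2). E1 \<union> E2) (Pow B \<times> Pow (V - B)) (Pow V)"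
    by (rule bij_betwI[where g = "\<lambda>E. (E \<inter> B, E - B)"]) (use assms in auto)
  have "rexp p V f = (\<Sum>(E1,E2)\<in>Pow B \<times> Pow (V - B).
      p ^ card (E1 \<union> E2) * (1 - p) ^ card (V - (E1 \<union> E2)) * f (E1 \<union> E2))"
    unfolding rexp_def by (subst sum.reindex_bij_betw[OF bij, symmetric]) (simp add: case_prod_unfold)
  also have "\<dots> = (\<Sum>(E1,E2)\<in>Pow B \<times> Pow (V - B).
      p ^ card E1 * (1 - p) ^ card (B - E1) * (p ^ card E2 * (1 - p) ^ card (V - B - E2) * f (E1 \<union> E2)))"
  proof (rule sum.cong[OF refl], clarify)
    fix E1 E2 assume E: "E1 \<subseteq> B" "E2 \<subseteq> V - B"
    have c1: "card (E1 \<union> E2) = card E1 + card E2"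
      by (rule card_Un_disjoint) (use E assms fB in \<open>auto intro: finite_subset\<close>)
    have "V - (E1 \<union> E2) = (B - E1) \<union> (V - B - E2)" using E assms by auto
    moreover have "card ((B - E1) \<union> (V - B - E2)) = card (B - E1) + card (V - B - E2)"
      by (rule card_Un_disjoint) (use E assms fB in \<open>auto intro: finite_subset\<close>)
    ultimately have c2: "card (V - (E1 \<union> E2)) = card (B - E1) + card (V - B - E2)" by simp
    show "p ^ card (E1 \<union> E2) * (1 - p) ^ card (V - (E1 \<union> E2)) * f (E1 \<union> E2) =
      p ^ card E1 * (1 - p) ^ card (B - E1) * (p ^ card E2 * (1 - p) ^ card (V - B - E2) * f (E1 \<union> E2))"
      unfolding c1 c2 power_add by simp
  qed
  also have "\<dots> = rexp p B (\<lambda>E1. rexp p (V - B) (\<lambda>E2. f (E1 \<union> E2)))"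
    unfolding rexp_def by (simp add: sum.cartesian_product[symmetric] sum_distrib_left)
  finally show ?thesis .
qed

text \<open>Applied with \<open>B\<close> the set of all potential edges meeting a vertex set, this
  is the exact probability of a prescribed component, absent edges included.\<close>

lemma rprob_cylinder:
  assumes "finite V" "B \<subseteq> V" "F \<subseteq> B"
  shows "rprob p V (\<lambda>E. E \<inter> B = F) = p ^ card F * (1 - p) ^ card (B - F)"
proof -
  have fB: "finite B" using assms finite_subset by blast
  have "rprob p V (\<lambda>E. E \<inter> B = F) =
      rexp p B (\<lambda>E1. rexp p (V - B) (\<lambda>E2. of_bool ((E1 \<union> E2) \<inter> B = F)))"
    by (rule rexp_split[OF assms(1,2)])
  also have "\<dots> = rexp p B (\<lambda>E1. rexp p (V - B) (\<lambda>E2. of_bool (E1 = F)))"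
    by (intro rexp_cong arg_cong[where f = of_bool]) auto
  also have "\<dots> = rexp p B (\<lambda>E1. of_bool (E1 = F))"
    using assms by simp
  also have "\<dots> = p ^ card F * (1 - p) ^ card (B - F)"
    unfolding rexp_def using fB assms(3)
    by (subst sum.mono_neutral_right[of _ "{F}"]) auto
  finally show ?thesis .
qed

lemma rprob_superset:
  assumes "finite V" "F \<subseteq> V"
  shows "rprob p V (\<lambda>E. F \<subseteq> E) = p ^ card F"
  using rprob_cylinder[OF assms(1,2) order_refl, of p] by (simp add: inf.absorb_iff2[symmetric])

lemma rprob_le_sum:
  assumes "0 \<le> p" "p \<le> 1" "finite I"
    and "\<And>E. E \<subseteq> V \<Longrightarrow> A E \<Longrightarrow> \<exists>i\<in>I. B i E"
  shows "rprob p V A \<le> (\<Sum>i\<in>I. rprob p V (B i))"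
proof -
  have "rprob p V A \<le> rexp p V (\<lambda>E. \<Sum>i\<in>I. of_bool (B i E))"
  proof (rule rexp_mono[OF assms(1,2)])
    fix E assume E: "E \<subseteq> V"
    show "of_bool (A E) \<le> (\<Sum>i\<in>I. of_bool (B i E) :: real)"
    proof (cases "A E")
      case True
      then obtain i where i: "i \<in> I" "B i E" using assms(4) E by blast
      have "(1::real) = of_bool (B i E)" using i by simp
      also have "\<dots> \<le> (\<Sum>i\<in>I. of_bool (B i E))"
        by (rule member_le_sum[OF i(1) _ assms(3)]) simp
      finally show ?thesis using True by simp
    qed (simp add: sum_nonneg)
  qed
  then show ?thesis by (simp add: rexp_sum)
qed

lemma rprob_le_disj:
  assumes "0 \<le> p" "p \<le> 1"
    and "\<And>E. E \<subseteq> V \<Longrightarrow> A E \<Longrightarrow> B E \<or> C E"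
  shows "rprob p V A \<le> rprob p V B + rprob p V C"
  unfolding rexp_add[symmetric]
  by (rule rexp_mono[OF assms(1,2)]) (use assms(3) in \<open>auto simp: of_bool_def\<close>)

subsection \<open>Transfer from independent to uniform random subsets\<close>

text \<open>Double counting: adding an element \<open>e\<close> outside \<open>E\<close> sends pairs
  \<open>(E, e)\<close> injectively to sets of size \<open>Suc m\<close> with a marked element. An
  upward closed family is preserved, and both sides count the same pairs when the family is
  everything, which gives the normalisation.\<close>

lemma uniform_subset_step:
  assumes fin: "finite V" and m: "m < card V"
    and up: "\<And>E E'. E \<subseteq> E' \<Longrightarrow> E' \<subseteq> V \<Longrightarrow> A E \<Longrightarrow> A E'"
  shows "real (card {E. E \<subseteq> V \<and> card E = m \<and> A E}) / real (card V choose m)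
     \<le> real (card {E. E \<subseteq> V \<and> card E = Suc m \<and> A E}) / real (card V choose Suc m)"
proof -
  let ?A = "\<lambda>m. {E. E \<subseteq> V \<and> card E = m \<and> A E}"
  have finA: "finite (?A k)" for k using fin by auto
  have "card (SIGMA E:?A m. V - E) \<le> card (SIGMA E:?A (Suc m). E)"
  proof (rule card_inj_on_le[where f = "\<lambda>(E,e). (insert e E, e)"])
    show "inj_on (\<lambda>(E,e). (insert e E, e)) (SIGMA E:?A m. V - E)"
      by (rule inj_on_inverseI[where g = "\<lambda>(E,e). (E - {e}, e)"]) auto
    show "(\<lambda>(E,e). (insert e E, e)) ` (SIGMA E:?A m. V - E) \<subseteq> (SIGMA E:?A (Suc m). E)"
    proof clarsimp
      fix E e assume *: "E \<subseteq> V" "m = card E" "A E" "e \<in> V" "e \<notin> E"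
      have "finite E" using *(1) fin finite_subset by blast
      then show "card (insert e E) = Suc (card E) \<and> A (insert e E)"
        using * up[of E "insert e E"] by auto
    qed
    show "finite (SIGMA E:?A (Suc m). E)"
      using finA fin by (intro finite_SigmaI) (auto intro: finite_subset)
  qed
  moreover have "card (SIGMA E:?A m. V - E) = card (?A m) * (card V - m)"
  proof -
    have "card (SIGMA E:?A m. V - E) = (\<Sum>E\<in>?A m. card (V - E))"
      using finA fin by (intro card_SigmaI) auto
    also have "\<dots> = (\<Sum>E\<in>?A m. card V - m)"
      using fin by (intro sum.cong) (auto simp: card_Diff_subset finite_subset)
    finally show ?thesis by simp
  qed
  moreover have "card (SIGMA E:?A (Suc m). E) = card (?A (Suc m)) * Suc m"
  proof -
    have "card (SIGMA E:?A (Suc m). E) = (\<Sum>E\<in>?A (Suc m). card E)"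
      using finA fin by (intro card_SigmaI) (auto intro: finite_subset)
    also have "\<dots> = (\<Sum>E\<in>?A (Suc m). Suc m)" by (intro sum.cong) auto
    finally show ?thesis by simp
  qed
  ultimately have le: "card (?A m) * (card V - m) \<le> card (?A (Suc m)) * Suc m" by simp
  have ch: "(card V choose m) * (card V - m) = (card V choose Suc m) * Suc m"
  proof -
    obtain k where k: "card V = Suc k" using m by (metis Suc_pred gr_implies_not0 neq0_conv)
    have "(Suc k choose m) * (Suc k - m) = Suc k * (k choose m)"
      unfolding mult.commute[of _ "Suc k - m"] using binomial_absorb_comp[of "Suc k" m] by simp
    also have "\<dots> = (Suc k choose Suc m) * Suc m" by (rule Suc_times_binomial_eq)
    finally show ?thesis unfolding k .
  qed
  let ?a = "real (card (?A m))" and ?b = "real (card (?A (Suc m)))"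
  let ?c = "real (card V choose m)" and ?d = "real (card V choose Suc m)"
  have pos: "?c > 0" "?d > 0" using m by (auto simp: zero_less_binomial_iff)
  have le': "?a * real (card V - m) \<le> ?b * real (Suc m)"
    unfolding of_nat_mult[symmetric] of_nat_le_iff by (rule le)
  have ch': "?c * real (card V - m) = ?d * real (Suc m)"
    unfolding of_nat_mult[symmetric] of_nat_eq_iff by (rule ch)
  have "(?a * ?d) * real (Suc m) = ?a * (?c * real (card V - m))"
    by (simp only: ch' mult.assoc)
  also have "\<dots> = (?a * real (card V - m)) * ?c" by (simp only: mult_ac)
  also have "\<dots> \<le> (?b * real (Suc m)) * ?c"
    using le' pos by (intro mult_right_mono) auto
  finally have "(?a * ?d) * real (Suc m) \<le> (?b * ?c) * real (Suc m)" by (simp only: mult_ac)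
  then have "?a * ?d \<le> ?b * ?c" by (rule mult_right_le_imp_le) simp
  note ineq = this
  have aux: "a / c \<le> b / d" if "c > 0" "d > 0" "a * d \<le> b * c" for a b c d :: real
    using that by (simp add: field_simps)
  show ?thesis by (rule aux[OF pos ineq])
qed

lemma uniform_subset_mono:
  assumes fin: "finite V" and m: "m \<le> m'" "m' \<le> card V"
    and up: "\<And>E E'. E \<subseteq> E' \<Longrightarrow> E' \<subseteq> V \<Longrightarrow> A E \<Longrightarrow> A E'"
  shows "real (card {E. E \<subseteq> V \<and> card E = m \<and> A E}) / real (card V choose m)
     \<le> real (card {E. E \<subseteq> V \<and> card E = m' \<and> A E}) / real (card V choose m')"
  using m
proof (induction m' rule: dec_induct)
  case (step k)
  have "real (card {E. E \<subseteq> V \<and> card E = k \<and> A E}) / real (card V choose k)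
     \<le> real (card {E. E \<subseteq> V \<and> card E = Suc k \<and> A E}) / real (card V choose Suc k)"
    by (rule uniform_subset_step[OF fin _ up]) (use step.prems in auto)
  with step show ?case by linarith
qed simp

text \<open>\<open>Bernstein n k x\<close> is the probability that a binomial variable with
  parameters \<open>n\<close> and \<open>x\<close> equals \<open>k\<close>, so this is Chebyshev's
  inequality for the lower tail.\<close>

lemma Bernstein_lower_tail:
  assumes x: "0 \<le> x" "x \<le> 1" and M: "real M < real n * x"
  shows "(\<Sum>k<M. Bernstein n k x) \<le> real n * x / (real n * x - real M)\<^sup>2"
proof -
  let ?d = "real n * x - real M"
  have d: "?d > 0" using M by simp
  have Mn: "M \<le> n"
    using M x mult_left_mono[OF x(2), of "real n"] by simp
  have eq: "(\<Sum>k\<le>n. (real k - n * x)\<^sup>2 * Bernstein n k x) = n * x * (1 - x)"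
  proof -
    \<comment> \<open>The square is written through factorial moments, whose Bernstein sums are
      known in closed form.\<close>
    have "(\<Sum>k\<le>n. (real k - n * x)\<^sup>2 * Bernstein n k x) =
        (\<Sum>k\<le>n. real k * (real k - 1) * Bernstein n k x + (1 - 2 * (n * x)) * (real k * Bernstein n k x)
          + (n * x)\<^sup>2 * Bernstein n k x)"
      by (intro sum.cong refl) (simp add: algebra_simps power2_eq_square)
    also have "\<dots> = n * x * (1 - x)"
      by (simp add: sum.distrib sum_distrib_left[symmetric]) (simp add: algebra_simps power2_eq_square)
    finally show ?thesis .
  qed
  have "?d\<^sup>2 * (\<Sum>k<M. Bernstein n k x) = (\<Sum>k<M. ?d\<^sup>2 * Bernstein n k x)"
    by (simp add: sum_distrib_left)
  also have "\<dots> \<le> (\<Sum>k<M. (real k - n * x)\<^sup>2 * Bernstein n k x)"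
  proof (intro sum_mono mult_right_mono Bernstein_nonneg x)
    fix k assume "k \<in> {..<M}"
    then have "?d \<le> n * x - real k" by simp
    then have "?d\<^sup>2 \<le> (n * x - real k)\<^sup>2" using d by (intro power_mono) auto
    then show "?d\<^sup>2 \<le> (real k - n * x)\<^sup>2" by (simp add: power2_commute)
  qed
  also have "\<dots> \<le> (\<Sum>k\<le>n. (real k - n * x)\<^sup>2 * Bernstein n k x)"
    using Mn x by (intro sum_mono2) (auto simp: Bernstein_nonneg)
  also have "\<dots> \<le> n * x" unfolding eq using x by (simp add: mult_left_le)
  finally show ?thesis using d by (simp add: field_simps)
qed

text \<open>Given its size, the binomial subset is uniform, and by Chebyshev its size is at least
  \<open>M\<close> with probability at least 1/2. Each such size makes the monotone property at
  least as likely as size \<open>M\<close>. The factor 2 costs nothing, since the bounds on the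
  right will tend to 0.\<close>

lemma uniform_le_twice_rprob:
  assumes fin: "finite V" and p: "0 \<le> p" "p \<le> 1"
    and up: "\<And>E E'. E \<subseteq> E' \<Longrightarrow> E' \<subseteq> V \<Longrightarrow> A E \<Longrightarrow> A E'"
    and M: "real M < real (card V) * p"
    and tail: "2 * (real (card V) * p) \<le> (real (card V) * p - real M)\<^sup>2"
  shows "real (card {E. E \<subseteq> V \<and> card E = M \<and> A E}) / real (card V choose M) \<le> 2 * rprob p V A"
proof -
  let ?N = "card V"
  define A' where "A' m = {E. E \<subseteq> V \<and> card E = m \<and> A E}" for m
  define r where "r m = real (card (A' m)) / real (?N choose m)" for m
  have MN: "M \<le> ?N" using M p mult_left_mono[OF p(2), of "real ?N"] by simp
  have finA: "finite (A' m)" for m unfolding A'_def using fin by auto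
  have "rprob p V A = (\<Sum>E | E \<subseteq> V \<and> A E. p ^ card E * (1 - p) ^ card (V - E))"
    unfolding rexp_def using fin by (intro sum.mono_neutral_cong_right) auto
  also have "{E. E \<subseteq> V \<and> A E} = (\<Union>m\<in>{..?N}. A' m)"
    unfolding A'_def using fin by (auto intro: card_mono)
  also have "(\<Sum>E\<in>(\<Union>m\<in>{..?N}. A' m). p ^ card E * (1 - p) ^ card (V - E)) =
     (\<Sum>m\<le>?N. \<Sum>E\<in>A' m. p ^ card E * (1 - p) ^ card (V - E))"
    using finA by (intro sum.UNION_disjoint) (auto simp: A'_def)
  also have "\<dots> = (\<Sum>m\<le>?N. \<Sum>E\<in>A' m. p ^ m * (1 - p) ^ (?N - m))"
    using fin by (intro sum.cong refl) (auto simp: A'_def card_Diff_subset finite_subset)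
  also have "\<dots> = (\<Sum>m\<le>?N. r m * Bernstein ?N m p)"
    by (intro sum.cong refl) (auto simp: r_def Bernstein_def)
  finally have eq: "rprob p V A = (\<Sum>m\<le>?N. r m * Bernstein ?N m p)" .
  have rm: "r M \<le> r m" if "M \<le> m" "m \<le> ?N" for m
    unfolding r_def A'_def by (rule uniform_subset_mono[OF fin that]) (use up in blast)
  have r0: "0 \<le> r m" for m unfolding r_def by simp
  have half: "(\<Sum>m\<in>{M..?N}. Bernstein ?N m p) \<ge> 1/2"
  proof -
    have "(\<Sum>k<M. Bernstein ?N k p) \<le> real ?N * p / (real ?N * p - real M)\<^sup>2"
      by (rule Bernstein_lower_tail[OF p M])
    also have "\<dots> \<le> 1/2" using tail M by (simp add: field_simps)
    finally have "(\<Sum>k<M. Bernstein ?N k p) \<le> 1/2" .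
    moreover have "(\<Sum>k<M. Bernstein ?N k p) + (\<Sum>m\<in>{M..?N}. Bernstein ?N m p) = (\<Sum>m\<le>?N. Bernstein ?N m p)"
    proof -
      have "{..?N} = {..<M} \<union> {M..?N}" using MN by auto
      moreover have "(\<Sum>m\<in>{..<M} \<union> {M..?N}. Bernstein ?N m p) =
        (\<Sum>k<M. Bernstein ?N k p) + (\<Sum>m\<in>{M..?N}. Bernstein ?N m p)"
        by (rule sum.union_disjoint) auto
      ultimately show ?thesis by metis
    qed
    ultimately show ?thesis by simp
  qed
  have "r M * (1/2) \<le> r M * (\<Sum>m\<in>{M..?N}. Bernstein ?N m p)"
    using half r0 by (intro mult_left_mono) auto
  also have "\<dots> = (\<Sum>m\<in>{M..?N}. r M * Bernstein ?N m p)" by (simp add: sum_distrib_left)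
  also have "\<dots> \<le> (\<Sum>m\<in>{M..?N}. r m * Bernstein ?N m p)"
    using p by (intro sum_mono mult_right_mono rm Bernstein_nonneg) auto
  also have "\<dots> \<le> (\<Sum>m\<le>?N. r m * Bernstein ?N m p)"
    using p r0 by (intro sum_mono2) (auto simp: Bernstein_nonneg)
  finally show ?thesis using eq unfolding r_def A'_def by simp
qed

subsection \<open>Component exploration\<close>

lemma finite_all_edges [simp]: "finite (all_edges n)"
proof -
  have "all_edges n \<subseteq> Pow {1..n}" unfolding all_edges_def by auto
  then show ?thesis by (rule finite_subset) simp
qed

lemma all_edges_eq: "all_edges n = {e. e \<subseteq> {1..n} \<and> card e = 2}"
  unfolding all_edges_def card_2_iff by blast

lemma card_all_edges: "card (all_edges n) = n choose 2"
  unfolding all_edges_eq by (subst n_subsets) auto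

lemma real_choose_two: "real (n choose 2) = real n * (real n - 1) / 2"
  by (induction n) (simp_all add: numeral_2_eq_2 field_simps)

lemma doubleton_in_all_edges [simp]:
  "{x, y} \<in> all_edges n \<longleftrightarrow> x \<noteq> y \<and> x \<in> {1..n} \<and> y \<in> {1..n}"
  unfolding all_edges_eq by (cases "x = y") auto

text \<open>\<open>A\<close> holds the active and \<open>M\<close> the unseen vertices; a step
  removes the smallest active vertex and activates its unseen neighbours. Started from one vertex
  with all others unseen, the process lasts \<open>t\<close> steps if and only if the component has
  at least \<open>t\<close> vertices.\<close>

fun survives :: "nat set set \<Rightarrow> nat set \<Rightarrow> nat set \<Rightarrow> nat \<Rightarrow> bool" where
  "survives E A M 0 = True"
| "survives E A M (Suc t) = (A \<noteq> {} \<and>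
     (let u = Min A; S = {x \<in> M. {u, x} \<in> E} in survives E (A - {u} \<union> S) (M - S) t))"

lemma survives_cong:
  assumes "\<And>x y. x \<in> A \<union> M \<Longrightarrow> y \<in> M \<Longrightarrow> {x, y} \<in> E \<longleftrightarrow> {x, y} \<in> E'" "finite A" "finite M"
  shows "survives E A M t \<longleftrightarrow> survives E' A M t"
  using assms
proof (induction t arbitrary: A M)
  case (Suc t)
  show ?case
  proof (cases "A = {}")
    case False
    let ?u = "Min A"
    have u: "?u \<in> A" using False Suc.prems by simp
    have S: "{x \<in> M. {?u, x} \<in> E} = {x \<in> M. {?u, x} \<in> E'}"
      using Suc.prems(1)[of ?u] u by auto
    have "survives E (A - {?u} \<union> {x \<in> M. {?u, x} \<in> E'}) (M - {x \<in> M. {?u, x} \<in> E'}) t =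
      survives E' (A - {?u} \<union> {x \<in> M. {?u, x} \<in> E'}) (M - {x \<in> M. {?u, x} \<in> E'}) t"
      by (rule Suc.IH) (use Suc.prems in auto)
    then show ?thesis using S by (simp add: Let_def)
  qed simp
qed simp

text \<open>The witness \<open>X\<close> is the set of processed vertices when the active set has
  run empty.\<close>

lemma survives_stops:
  assumes "\<not> survives E A M t" "finite A" "finite M"
  shows "\<exists>X. A \<subseteq> X \<and> X \<subseteq> A \<union> M \<and> card X < t \<and> (\<forall>x\<in>X. \<forall>y\<in>M. {x, y} \<in> E \<longrightarrow> y \<in> X)"
  using assms
proof (induction t arbitrary: A M)
  case (Suc t)
  show ?case
  proof (cases "A = {}")
    case False
    define u where "u = Min A"
    define S where "S = {x \<in> M. {u, x} \<in> E}"
    have u: "u \<in> A" using False Suc.prems unfolding u_def by simp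
    have "\<not> survives E (A - {u} \<union> S) (M - S) t"
      using Suc.prems(1) False unfolding u_def S_def by (simp add: Let_def)
    from Suc.IH[OF this] obtain X where X: "A - {u} \<union> S \<subseteq> X" "X \<subseteq> A - {u} \<union> S \<union> (M - S)"
      "card X < t" "\<forall>x\<in>X. \<forall>y\<in>M - S. {x, y} \<in> E \<longrightarrow> y \<in> X"
      using Suc.prems unfolding S_def by auto
    show ?thesis
    proof (intro exI[of _ "insert u X"] conjI ballI impI)
      have "finite X" using X(2) Suc.prems(2,3) by (rule_tac finite_subset[OF X(2)]) (auto simp: S_def)
      then show "card (insert u X) < Suc t" using X(3) by (simp add: card_insert_if)
      fix x y assume "x \<in> insert u X" "y \<in> M" "{x, y} \<in> E"
      then show "y \<in> insert u X" using X unfolding S_def by blast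
    qed (use X u in \<open>auto simp: S_def\<close>)
  qed (intro exI[of _ "{}"], auto)
qed simp

text \<open>Exponential moments: lasting \<open>t\<close> steps requires at least
  \<open>t - card A\<close> discoveries, each weighted by \<open>exp \<beta>\<close>. A step facing
  \<open>m\<close> unseen vertices contributes the factor
  \<open>(1 + p * (exp \<beta> - 1)) ^ m\<close>, and after \<open>i\<close> steps exactly
  \<open>i\<close> vertices have left the process.\<close>

lemma rprob_survives:
  assumes p: "0 \<le> p" "p \<le> 1" and \<beta>: "0 \<le> \<beta>"
    and "finite V" "finite A" "finite M" "A \<inter> M = {}"
    and "\<And>x y. x \<in> A \<union> M \<Longrightarrow> y \<in> M \<Longrightarrow> x \<noteq> y \<Longrightarrow> {x, y} \<in> V"
  shows "rprob p V (\<lambda>E. survives E A M t) \<le>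
     exp (\<beta> * (real (card A) - real t) + p * (exp \<beta> - 1) * (\<Sum>i=1..t. real (card A + card M) - real i))"
  using assms(4-)
proof (induction t arbitrary: A M V)
  case 0
  then show ?case using \<beta> by simp
next
  case (Suc t)
  let ?c = "p * (exp \<beta> - 1)"
  have c0: "?c \<ge> 0" using p \<beta> by simp
  show ?case
  proof (cases "A = {}")
    case True
    then show ?thesis by (simp add: Suc.prems(1))
  next
    case False
    define u where "u = Min A"
    have u: "u \<in> A" using False Suc.prems unfolding u_def by simp
    then have uM: "u \<notin> M" using Suc.prems by auto
    define a where "a = card A - 1"
    have ca: "card A = Suc a" using u Suc.prems(2) unfolding a_def by (metis card_Suc_Diff1 diff_Suc_1)
    define m where "m = card M"
    define Bu where "Bu = (\<lambda>x. {u, x}) ` M"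
    have inj: "inj_on (\<lambda>x. {u, x}) M" by (auto simp: inj_on_def doubleton_eq_iff)
    have BuV: "Bu \<subseteq> V" unfolding Bu_def using Suc.prems(5) u uM by auto
    define SS where "SS E = {x \<in> M. {u, x} \<in> E}" for E
    define G where "G k = exp (\<beta> * (real k - real t) + ?c * (\<Sum>i=1..t. real (a + m) - real i))" for k
    \<comment> \<open>Only the edges from \<open>u\<close> to unseen vertices are revealed. Later
      steps never test them, since \<open>u\<close> leaves both sets, so the induction hypothesis
      applies on the independent remainder \<open>V - Bu\<close>.\<close>
    have "rprob p V (\<lambda>E. survives E A M (Suc t)) =
      rexp p Bu (\<lambda>E1. rexp p (V - Bu) (\<lambda>E2. of_bool (survives (E1 \<union> E2) A M (Suc t))))"
      by (rule rexp_split[OF Suc.prems(1) BuV])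
    also have "\<dots> = rexp p Bu (\<lambda>E1. rprob p (V - Bu) (\<lambda>E2. survives E2 (A - {u} \<union> SS E1) (M - SS E1) t))"
    proof (intro rexp_cong arg_cong[where f = of_bool])
      fix E1 E2 assume E: "E1 \<subseteq> Bu" "E2 \<subseteq> V - Bu"
      have "SS (E1 \<union> E2) = SS E1" using E unfolding SS_def Bu_def by auto
      then have "survives (E1 \<union> E2) A M (Suc t) = survives (E1 \<union> E2) (A - {u} \<union> SS E1) (M - SS E1) t"
        using False unfolding u_def[symmetric] by (simp add: Let_def u_def[symmetric] SS_def)
      also have "\<dots> = survives E2 (A - {u} \<union> SS E1) (M - SS E1) t"
      proof (rule survives_cong)
        fix x y assume xy: "x \<in> A - {u} \<union> SS E1 \<union> (M - SS E1)" "y \<in> M - SS E1"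
        have "x \<noteq> u" "y \<noteq> u" using xy uM unfolding SS_def by auto
        then have "{x, y} \<notin> E1" using E(1) unfolding Bu_def by (auto simp: doubleton_eq_iff)
        then show "({x, y} \<in> E1 \<union> E2) = ({x, y} \<in> E2)" by simp
      qed (use Suc.prems in \<open>auto simp: SS_def\<close>)
      finally show "survives (E1 \<union> E2) A M (Suc t) = survives E2 (A - {u} \<union> SS E1) (M - SS E1) t" .
    qed
    also have "\<dots> \<le> rexp p Bu (\<lambda>E1. G (a + card (SS E1)))"
    proof (rule rexp_mono[OF p])
      fix E1 assume "E1 \<subseteq> Bu"
      have SM: "SS E1 \<subseteq> M" unfolding SS_def by auto
      have c1: "card (A - {u} \<union> SS E1) = a + card (SS E1)"
      proof -
        have "card (A - {u} \<union> SS E1) = card (A - {u}) + card (SS E1)"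
          by (rule card_Un_disjoint) (use SM Suc.prems in \<open>auto intro: finite_subset\<close>)
        then show ?thesis using u Suc.prems(2) unfolding a_def by simp
      qed
      have c2: "card (M - SS E1) + card (SS E1) = m"
        unfolding m_def using SM Suc.prems(3)
        by (metis add.commute card_Diff_subset card_mono finite_subset le_add_diff_inverse)
      have "rprob p (V - Bu) (\<lambda>E2. survives E2 (A - {u} \<union> SS E1) (M - SS E1) t) \<le>
        exp (\<beta> * (real (card (A - {u} \<union> SS E1)) - real t) + ?c * (\<Sum>i=1..t. real (card (A - {u} \<union> SS E1) + card (M - SS E1)) - real i))"
      proof (rule Suc.IH)
        fix x y assume xy: "x \<in> A - {u} \<union> SS E1 \<union> (M - SS E1)" "y \<in> M - SS E1" "x \<noteq> y"
        have "x \<noteq> u" "y \<noteq> u" using xy uM unfolding SS_def by auto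
        then have "{x, y} \<notin> Bu" unfolding Bu_def by (auto simp: doubleton_eq_iff)
        then show "{x, y} \<in> V - Bu" using Suc.prems(5)[of x y] xy SM by auto
      qed (use Suc.prems SM in \<open>auto intro: finite_subset\<close>)
      also have "\<dots> = G (a + card (SS E1))"
      proof -
        have "card (A - {u} \<union> SS E1) + card (M - SS E1) = a + m" using c1 c2 by simp
        then show ?thesis unfolding G_def c1 by (simp only:)
      qed
      finally show "rprob p (V - Bu) (\<lambda>E2. survives E2 (A - {u} \<union> SS E1) (M - SS E1) t) \<le> G (a + card (SS E1))" .
    qed
    also have "\<dots> = (\<Sum>S\<in>Pow M. p ^ card S * (1 - p) ^ card (M - S) * G (a + card S))"
    proof -
      have bij: "bij_betw (\<lambda>S. (\<lambda>x. {u, x}) ` S) (Pow M) (Pow Bu)"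
        unfolding Bu_def by (rule bij_betw_Pow[OF inj_on_imp_bij_betw[OF inj]])
      show ?thesis
        unfolding rexp_def
      proof (subst sum.reindex_bij_betw[OF bij, symmetric], rule sum.cong[OF refl])
        fix S assume S: "S \<in> Pow M"
        have i: "inj_on (\<lambda>x. {u, x}) S" using inj S by (auto intro: inj_on_subset)
        have "Bu - (\<lambda>x. {u, x}) ` S = (\<lambda>x. {u, x}) ` (M - S)"
          unfolding Bu_def using S inj by (auto simp: inj_on_def)
        then have c: "card (Bu - (\<lambda>x. {u, x}) ` S) = card (M - S)"
          by (simp add: card_image inj_on_subset[OF inj])
        have s: "SS ((\<lambda>x. {u, x}) ` S) = S"
          unfolding SS_def using S inj by (auto simp: inj_on_def)
        show "p ^ card ((\<lambda>x. {u, x}) ` S) * (1 - p) ^ card (Bu - (\<lambda>x. {u, x}) ` S) * G (a + card (SS ((\<lambda>x. {u, x}) ` S))) =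
          p ^ card S * (1 - p) ^ card (M - S) * G (a + card S)"
          unfolding c s by (simp add: card_image[OF i])
      qed
    qed
    \<comment> \<open>Each discovered vertex multiplies \<open>G\<close> by
      \<open>exp \<beta>\<close>, so the sum is the moment generating function of a binomial
      variable and factorises over \<open>M\<close>.\<close>
    also have "\<dots> = G a * (\<Sum>S\<in>Pow M. (\<Prod>x\<in>S. p * exp \<beta>) * (\<Prod>x\<in>M-S. 1 - p))"
      unfolding sum_distrib_left
    proof (rule sum.cong[OF refl])
      fix S assume "S \<in> Pow M"
      have "G (a + card S) = G a * exp \<beta> ^ card S"
        unfolding G_def exp_of_nat_mult[symmetric] mult_exp_exp by (simp add: algebra_simps)
      then show "p ^ card S * (1 - p) ^ card (M - S) * G (a + card S) =
          G a * ((\<Prod>x\<in>S. p * exp \<beta>) * (\<Prod>x\<in>M-S. 1 - p))"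
        by (simp add: power_mult_distrib)
    qed
    also have "\<dots> = G a * (\<Prod>x\<in>M. p * exp \<beta> + (1 - p))"
      by (simp only: prod_add[OF Suc.prems(3)])
    also have "\<dots> = G a * (1 + ?c) ^ m" unfolding m_def by (simp add: algebra_simps)
    also have "\<dots> \<le> G a * exp ?c ^ m"
      using c0 by (intro mult_left_mono power_mono) (auto simp: G_def)
    also have "\<dots> = exp (\<beta> * (real a - real t) + ?c * (\<Sum>i=1..t. real (a + m) - real i) + ?c * real m)"
      unfolding G_def by (simp add: exp_add exp_of_nat_mult[symmetric] mult.commute)
    \<comment> \<open>The random number \<open>m\<close> of unseen vertices is enlarged to the
      number \<open>a + m\<close> of all unprocessed ones, which is deterministic at every
      step.\<close>
    also have "\<dots> \<le> exp (\<beta> * (real (card A) - real (Suc t)) + ?c * (\<Sum>i=1..Suc t. real (card A + card M) - real i))"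
    proof -
      have "(\<Sum>i=1..Suc t. real (card A + card M) - real i) = (\<Sum>i=Suc 0..Suc t. real (Suc a + m) - real i)"
        unfolding ca m_def by simp
      also have "\<dots> = (real (Suc a + m) - 1) + (\<Sum>i=Suc (Suc 0)..Suc t. real (Suc a + m) - real i)"
        by (subst sum.atLeast_Suc_atMost) auto
      also have "(\<Sum>i=Suc (Suc 0)..Suc t. real (Suc a + m) - real i) = (\<Sum>i=1..t. real (a + m) - real i)"
        by (subst sum.shift_bounds_cl_Suc_ivl) simp
      finally have *: "(\<Sum>i=1..Suc t. real (card A + card M) - real i) = real (a + m) + (\<Sum>i=1..t. real (a + m) - real i)"
        by simp
      have "?c * real m \<le> ?c * real (a + m)" using c0 by (intro mult_left_mono) auto
      then show ?thesis by (subst *) (simp add: ca distrib_left)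
    qed
    finally show ?thesis .
  qed
qed

text \<open>Union bound over the starting vertex. The factor \<open>n\<close> is affordable because
  \<open>t\<close> will be linear in \<open>n\<close>, and then so is the exponent.\<close>

lemma rprob_large_component:
  assumes p: "0 \<le> p" "p \<le> 1" and \<beta>: "0 \<le> \<beta>"
  shows "rprob p (all_edges n) (\<lambda>E. \<exists>u\<in>{1..n}. survives E {u} ({1..n} - {u}) t)
    \<le> real n * exp (\<beta> * (1 - real t) + p * (exp \<beta> - 1) * (real n * real t - real t * (real t + 1) / 2))"
proof -
  have s: "(\<Sum>i=1..t. real k - real i) = real k * real t - real t * (real t + 1) / 2" for k
    by (induction t) (auto simp: field_simps)
  have "rprob p (all_edges n) (\<lambda>E. \<exists>u\<in>{1..n}. survives E {u} ({1..n} - {u}) t)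
    \<le> (\<Sum>u\<in>{1..n}. rprob p (all_edges n) (\<lambda>E. survives E {u} ({1..n} - {u}) t))"
    by (rule rprob_le_sum[OF p]) auto
  also have "\<dots> \<le> (\<Sum>u\<in>{1..n}. exp (\<beta> * (1 - real t) + p * (exp \<beta> - 1) * (real n * real t - real t * (real t + 1) / 2)))"
  proof (rule sum_mono)
    fix u assume u: "u \<in> {1..n}"
    have "rprob p (all_edges n) (\<lambda>E. survives E {u} ({1..n} - {u}) t) \<le>
       exp (\<beta> * (real (card {u}) - real t) + p * (exp \<beta> - 1) * (\<Sum>i=1..t. real (card {u} + card ({1..n} - {u})) - real i))"
      by (rule rprob_survives[OF p \<beta>]) (use u in auto)
    moreover have "card {u} + card ({1..n} - {u}) = n" using u by auto
    ultimately show "rprob p (all_edges n) (\<lambda>E. survives E {u} ({1..n} - {u}) t) \<le>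
      exp (\<beta> * (1 - real t) + p * (exp \<beta> - 1) * (real n * real t - real t * (real t + 1) / 2))"
      by (simp only: s) simp
  qed
  finally show ?thesis by simp
qed

subsection \<open>Dense vertex sets\<close>

text \<open>First moment over pairs of a vertex set and \<open>m\<close> chosen edges inside it. It
  serves to exclude cores having a constant factor more edges than vertices.\<close>

lemma rprob_dense:
  assumes p: "0 \<le> p" "p \<le> 1"
  shows "rprob p (all_edges n) (\<lambda>E. \<exists>U\<subseteq>{1..n}. card U = v \<and> m \<le> card {e\<in>E. e \<subseteq> U})
    \<le> real (n choose v) * real ((v choose 2) choose m) * p ^ m"
proof -
  define I where "I = {(U, F). U \<subseteq> {1..n} \<and> card U = v \<and> F \<subseteq> {e. e \<subseteq> U \<and> card e = 2} \<and> card F = m}"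
  have I: "I = (SIGMA U:{U. U \<subseteq> {1..n} \<and> card U = v}. {F. F \<subseteq> {e. e \<subseteq> U \<and> card e = 2} \<and> card F = m})"
    unfolding I_def by auto
  have finI: "finite I" unfolding I
  proof (rule finite_SigmaI)
    fix U assume "U \<in> {U. U \<subseteq> {1..n} \<and> card U = v}"
    then have "finite U" by (auto intro: finite_subset)
    then have "finite {e. e \<subseteq> U \<and> card e = 2}" by auto
    then show "finite {F. F \<subseteq> {e. e \<subseteq> U \<and> card e = 2} \<and> card F = m}" by auto
  qed auto
  have "card I = (\<Sum>U | U \<subseteq> {1..n} \<and> card U = v. (v choose 2) choose m)"
    unfolding I
  proof (subst card_SigmaI)
    show "\<forall>a\<in>{U. U \<subseteq> {1..n} \<and> card U = v}. finite {F. F \<subseteq> {e. e \<subseteq> a \<and> card e = 2} \<and> card F = m}"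
      using finite_subset[OF _ finite_atLeastAtMost[of 1 n]] by auto
    show "(\<Sum>a\<in>{U. U \<subseteq> {1..n} \<and> card U = v}. card {F. F \<subseteq> {e. e \<subseteq> a \<and> card e = 2} \<and> card F = m}) =
      (\<Sum>U | U \<subseteq> {1..n} \<and> card U = v. (v choose 2) choose m)"
    proof (rule sum.cong[OF refl])
      fix U assume U: "U \<in> {U. U \<subseteq> {1..n} \<and> card U = v}"
      then have f: "finite U" by (auto intro: finite_subset)
      then have "finite {e. e \<subseteq> U \<and> card e = 2}" by auto
      then show "card {F. F \<subseteq> {e. e \<subseteq> U \<and> card e = 2} \<and> card F = m} = (v choose 2) choose m"
        using n_subsets[OF f, of 2] U by (simp add: n_subsets)
    qed
  qed auto
  also have "\<dots> = (n choose v) * ((v choose 2) choose m)"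
    using n_subsets[of "{1..n}" v] by simp
  finally have cI: "card I = (n choose v) * ((v choose 2) choose m)" .
  have "rprob p (all_edges n) (\<lambda>E. \<exists>U\<subseteq>{1..n}. card U = v \<and> m \<le> card {e\<in>E. e \<subseteq> U})
    \<le> (\<Sum>i\<in>I. rprob p (all_edges n) (\<lambda>E. snd i \<subseteq> E))"
  proof (rule rprob_le_sum[OF p finI])
    fix E assume E: "E \<subseteq> all_edges n" and "\<exists>U\<subseteq>{1..n}. card U = v \<and> m \<le> card {e\<in>E. e \<subseteq> U}"
    then obtain U where U: "U \<subseteq> {1..n}" "card U = v" "m \<le> card {e\<in>E. e \<subseteq> U}" by blast
    obtain F where F: "F \<subseteq> {e\<in>E. e \<subseteq> U}" "card F = m" using obtain_subset_with_card_n[OF U(3)] by blast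
    have "(U, F) \<in> I" unfolding I_def using U F E by (auto simp: all_edges_eq)
    then show "\<exists>i\<in>I. snd i \<subseteq> E" using F by force
  qed
  also have "\<dots> = (\<Sum>i\<in>I. p ^ m)"
  proof (rule sum.cong[OF refl])
    fix i assume i: "i \<in> I"
    then have "snd i \<subseteq> all_edges n" "card (snd i) = m" unfolding I_def all_edges_eq
      by (clarsimp, blast, clarsimp)
    then show "rprob p (all_edges n) (\<lambda>E. snd i \<subseteq> E) = p ^ m" by (simp add: rprob_superset)
  qed
  finally show ?thesis by (simp add: cI)
qed

subsection \<open>Rooted forests\<close>

lemma exp_partial_sum_le:
  fixes x :: real
  assumes "0 \<le> x"
  shows "(\<Sum>i\<le>m. x ^ i / fact i) \<le> exp x"
proof -
  have "(\<Sum>i\<le>m. x ^ i / fact i) = (\<Sum>i\<in>{..m}. x ^ i /\<^sub>R fact i)"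
    by (simp add: divide_inverse mult.commute)
  also have "\<dots> \<le> (\<Sum>i. x ^ i /\<^sub>R fact i)"
    using assms by (intro sum_le_suminf summable_exp_generic) auto
  finally show ?thesis by (simp add: exp_def)
qed

text \<open>The number of forests on \<open>a\<close> given roots and \<open>j\<close> further vertices, divided by \<open>fact j\<close>;
  the recursion deletes one root and turns its children into roots.\<close>

function forest_coeff :: "nat \<Rightarrow> nat \<Rightarrow> real" where
  "forest_coeff 0 0 = 1"
| "forest_coeff 0 (Suc j) = 0"
| "forest_coeff (Suc a) j = (\<Sum>i\<le>j. forest_coeff (a + i) (j - i) / fact i)"
  by pat_completeness auto
termination by (relation "Wellfounded.measure (\<lambda>(a, j). a + j)") auto

lemma forest_coeff_nonneg: "0 \<le> forest_coeff a j"
  by (induction a j rule: forest_coeff.induct) (auto intro!: sum_nonneg)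

text \<open>The full series is the \<open>a\<close>-th power of the solution of
  \<open>f = exp (y * f)\<close>, and the hypothesis says that \<open>exp L\<close> is a
  supersolution of this equation. Truncation at \<open>m\<close> allows induction on
  \<open>a + m\<close>: deleting a root with \<open>i\<close> children turns \<open>(a, m)\<close>
  into \<open>(a - 1 + i, m - i)\<close>.\<close>

lemma forest_coeff_generating_function:
  assumes y: "0 \<le> y" "y * exp L \<le> L"
  shows "(\<Sum>j\<le>m. forest_coeff a j * y ^ j) \<le> exp (L * real a)"
proof (induction "a + m" arbitrary: a m rule: less_induct)
  case less
  show ?case
  proof (cases a)
    case 0
    have "(\<Sum>j\<le>m. forest_coeff 0 j * y ^ j) = (\<Sum>j\<in>{0}. forest_coeff 0 j * y ^ j)"
    proof (rule sum.mono_neutral_right)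
      show "\<forall>i\<in>{..m} - {0}. forest_coeff 0 i * y ^ i = 0"
      proof
        fix i assume "i \<in> {..m} - {0}"
        then obtain k where "i = Suc k" by (cases i) auto
        then show "forest_coeff 0 i * y ^ i = 0" by simp
      qed
    qed auto
    then show ?thesis using 0 by simp
  next
    case (Suc b)
    have "(\<Sum>j\<le>m. forest_coeff a j * y ^ j) =
        (\<Sum>j\<le>m. \<Sum>i\<le>j. (y ^ i / fact i) * (forest_coeff (b + i) (j - i) * y ^ (j - i)))"
    proof (rule sum.cong[OF refl])
      fix j
      have "forest_coeff a j * y ^ j = (\<Sum>i\<le>j. forest_coeff (b + i) (j - i) / fact i * y ^ j)"
        unfolding Suc by (simp add: sum_distrib_right)
      also have "\<dots> = (\<Sum>i\<le>j. (y ^ i / fact i) * (forest_coeff (b + i) (j - i) * y ^ (j - i)))"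
      proof (rule sum.cong[OF refl])
        fix i assume "i \<in> {..j}"
        then have "y ^ j = y ^ i * y ^ (j - i)" by (simp add: power_add[symmetric])
        then show "forest_coeff (b + i) (j - i) / fact i * y ^ j =
          (y ^ i / fact i) * (forest_coeff (b + i) (j - i) * y ^ (j - i))" by simp
      qed
      finally show "forest_coeff a j * y ^ j =
        (\<Sum>i\<le>j. (y ^ i / fact i) * (forest_coeff (b + i) (j - i) * y ^ (j - i)))" .
    qed
    also have "\<dots> = (\<Sum>(j,i)\<in>(SIGMA j:{..m}. {..j}). (y ^ i / fact i) * (forest_coeff (b + i) (j - i) * y ^ (j - i)))"
      by (rule sum.Sigma) auto
    also have "\<dots> = (\<Sum>(i,j)\<in>(SIGMA i:{..m}. {..m - i}). (y ^ i / fact i) * (forest_coeff (b + i) j * y ^ j))"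
      by (rule sum.reindex_bij_witness[where i = "\<lambda>(i,j). (i + j, i)" and j = "\<lambda>(j,i). (i, j - i)"]) auto
    also have "\<dots> = (\<Sum>i\<le>m. (y ^ i / fact i) * (\<Sum>j\<le>m - i. forest_coeff (b + i) j * y ^ j))"
      by (simp only: sum_distrib_left) (rule sum.Sigma[symmetric], auto)
    also have "\<dots> \<le> (\<Sum>i\<le>m. (y ^ i / fact i) * exp (L * real (b + i)))"
      using y by (intro sum_mono mult_left_mono less) (auto simp: Suc)
    also have "\<dots> = exp (L * real b) * (\<Sum>i\<le>m. (y * exp L) ^ i / fact i)"
      unfolding sum_distrib_left
      by (intro sum.cong refl) (simp add: power_mult_distrib exp_of_nat_mult[symmetric] distrib_left exp_add mult_ac)
    also have "\<dots> \<le> exp (L * real b) * exp (y * exp L)"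
      using y by (intro mult_left_mono exp_partial_sum_le) auto
    also have "\<dots> \<le> exp (L * real b) * exp L" using y by simp
    also have "\<dots> = exp (L * real a)" unfolding Suc by (simp add: distrib_left exp_add[symmetric] add.commute)
    finally show ?thesis .
  qed
qed

text \<open>Always expanding the root \<open>Min U\<close> mirrors the recursion of
  \<open>forest_coeff\<close>, so that counting forests reduces to counting the possible sets
  \<open>S\<close> of children at each step.\<close>

inductive rooted_forest :: "nat set \<Rightarrow> nat set \<Rightarrow> nat set set \<Rightarrow> bool" where
  empty: "rooted_forest {} {} {}"
| step: "finite U \<Longrightarrow> U \<noteq> {} \<Longrightarrow> u = Min U \<Longrightarrow> S \<subseteq> J \<Longrightarrow> U \<inter> J = {} \<Longrightarrow>
    rooted_forest (U - {u} \<union> S) (J - S) F \<Longrightarrow> rooted_forest U J ((\<lambda>x. {u, x}) ` S \<union> F)"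

lemma rooted_forest_edges: "rooted_forest U J F \<Longrightarrow> e \<in> F \<Longrightarrow> e \<subseteq> U \<union> J"
proof (induction arbitrary: e rule: rooted_forest.induct)
  case (step U u S J F)
  have "u \<in> U" using step by simp
  then show ?case using step.prems step.IH step.hyps by blast
qed simp

lemma rooted_forest_card: "rooted_forest U J F \<Longrightarrow> finite J \<Longrightarrow> finite F \<and> card F = card J"
proof (induction rule: rooted_forest.induct)
  case (step U u S J F)
  have fS: "finite S" using step finite_subset by blast
  have u: "u \<in> U" using step by simp
  have IH: "finite F" "card F = card (J - S)" using step by auto
  have disj: "(\<lambda>x. {u, x}) ` S \<inter> F = {}"
  proof -
    have "u \<notin> e" if "e \<in> F" for e
      using rooted_forest_edges[OF step.hyps(6) that] u step.hyps by blast
    then show ?thesis by blast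
  qed
  have "card ((\<lambda>x. {u, x}) ` S \<union> F) = card ((\<lambda>x. {u, x}) ` S) + card F"
    using fS IH disj by (intro card_Un_disjoint) auto
  also have "card ((\<lambda>x. {u, x}) ` S) = card S"
    by (intro card_image) (auto simp: inj_on_def doubleton_eq_iff)
  also have "card S + card F = card J"
    using IH fS step.hyps(4) step.prems by (simp add: card_Diff_subset card_mono)
  finally show ?case using fS IH by simp
qed simp

text \<open>\<open>X\<close> consists of the trees hanging at the roots in \<open>D\<close>. This
  turns a cut of the core into a cut of the whole component.\<close>

lemma rooted_forest_closed_extension:
  "rooted_forest U J F \<Longrightarrow> D \<subseteq> U \<Longrightarrow>
    \<exists>X. X \<inter> U = D \<and> X \<subseteq> U \<union> J \<and> (\<forall>e\<in>F. e \<subseteq> X \<or> e \<inter> X = {})"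
proof (induction arbitrary: D rule: rooted_forest.induct)
  case (step U u S J F)
  have u: "u \<in> U" using step by simp
  define D' where "D' = (D - {u}) \<union> (if u \<in> D then S else {})"
  have "D' \<subseteq> U - {u} \<union> S" using step.prems unfolding D'_def by auto
  from step.IH[OF this] obtain X where XX: "X \<inter> (U - {u} \<union> S) = D' \<and> X \<subseteq> U - {u} \<union> S \<union> (J - S)
    \<and> (\<forall>e\<in>F. e \<subseteq> X \<or> e \<inter> X = {})" ..
  note X = XX[THEN conjunct1] XX[THEN conjunct2, THEN conjunct1] XX[THEN conjunct2, THEN conjunct2]
  have SU: "S \<inter> U = {}" using step.hyps by auto
  have "u \<notin> S" "u \<notin> J" using u step.hyps(4,5) by auto
  then have uX: "u \<notin> X" using X(2) by blast
  show ?case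
  proof (cases "u \<in> D")
    case True
    have a: "insert u X \<inter> U = D" using X(1) True SU step.prems u unfolding D'_def by auto
    have b: "S \<subseteq> X" using X(1) True unfolding D'_def by auto
    have c: "\<forall>e\<in>F. e \<subseteq> insert u X \<or> e \<inter> insert u X = {}"
    proof
      fix e assume e: "e \<in> F"
      have "u \<notin> e" using rooted_forest_edges[OF step.hyps(6) e] u step.hyps by blast
      then show "e \<subseteq> insert u X \<or> e \<inter> insert u X = {}" using X(3) e by blast
    qed
    show ?thesis by (rule exI[of _ "insert u X"]) (use a b c X(2) u step.hyps in auto)
  next
    case False
    have a: "X \<inter> U = D" using X(1) False SU step.prems uX unfolding D'_def by auto
    have b: "S \<inter> X = {}"
    proof -
      have "S \<inter> X \<subseteq> D'" using X(1) by auto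
      moreover have "D' \<subseteq> U" using False step.prems unfolding D'_def by auto
      ultimately show ?thesis using SU by auto
    qed
    show ?thesis by (rule exI[of _ X]) (use a b X(2,3) uX step.hyps in auto)
  qed
qed simp

text \<open>A set of \<open>i\<close> children of the smallest root is chosen in
  \<open>card J choose i\<close> ways; relative to \<open>fact (card J)\<close> this is the division
  by \<open>fact i\<close> in the recursion.\<close>

lemma card_rooted_forests:
  assumes "finite U" "finite J" "U \<inter> J = {}"
  shows "finite {F. rooted_forest U J F} \<and>
    real (card {F. rooted_forest U J F}) \<le> fact (card J) * forest_coeff (card U) (card J)"
  using assms
proof (induction "card U + card J" arbitrary: U J rule: less_induct)
  case less
  show ?case
  proof (cases "U = {}")
    case True
    have no: "J = {} \<and> F = {}" if "rooted_forest U J F" for F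
      using that by cases (use True in auto)
    show ?thesis
    proof (cases "J = {}")
      case J: True
      have "{F. rooted_forest U J F} \<subseteq> {{}}" using no by auto
      then have "finite {F. rooted_forest U J F} \<and> card {F. rooted_forest U J F} \<le> card {{}::nat set set}"
        using finite_subset card_mono by (metis finite.emptyI finite.insertI)
      then show ?thesis using True J by simp
    next
      case False
      then have none: "{F. rooted_forest U J F} = {}" using no by auto
      show ?thesis unfolding none by (simp add: forest_coeff_nonneg)
    qed
  next
    case False
    define u where "u = Min U"
    have u: "u \<in> U" using False less.prems unfolding u_def by simp
    define a where "a = card U - 1"
    have ca: "card U = Suc a" using card_Suc_Diff1[OF less.prems(1) u] u less.prems unfolding a_def by simp
    define G where "G S = {F. rooted_forest (U - {u} \<union> S) (J - S) F}" for S
    have cS: "card (U - {u} \<union> S) = a + card S" "card (J - S) = card J - card S" if "S \<subseteq> J" for S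
    proof -
      have "card (U - {u} \<union> S) = card (U - {u}) + card S"
        using less.prems that by (intro card_Un_disjoint) (auto intro: finite_subset)
      then show "card (U - {u} \<union> S) = a + card S" using u less.prems unfolding a_def by simp
      show "card (J - S) = card J - card S" using that less.prems
        by (simp add: card_Diff_subset finite_subset)
    qed
    have IH: "finite (G S)" "real (card (G S)) \<le> fact (card J - card S) * forest_coeff (a + card S) (card J - card S)"
      if "S \<subseteq> J" for S
    proof -
      have cle: "card S \<le> card J" using that less.prems by (intro card_mono)
      have lt: "card (U - {u} \<union> S) + card (J - S) < card U + card J" using cS[OF that] ca cle by simp
      have d: "finite (U - {u} \<union> S)" "finite (J - S)" "(U - {u} \<union> S) \<inter> (J - S) = {}"
        using less.prems that by (auto intro: finite_subset)
      show "finite (G S)" "real (card (G S)) \<le> fact (card J - card S) * forest_coeff (a + card S) (card J - card S)"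
        using less.hyps[OF lt d] unfolding G_def cS[OF that] by auto
    qed
    let ?H = "\<lambda>S. (\<lambda>F. (\<lambda>x. {u, x}) ` S \<union> F) ` G S"
    have sub: "{F. rooted_forest U J F} \<subseteq> (\<Union>S\<in>Pow J. ?H S)"
    proof clarify
      fix F assume "rooted_forest U J F"
      then show "F \<in> (\<Union>S\<in>Pow J. ?H S)"
      proof cases
        case (step u' S F')
        have "F' \<in> G S" using step unfolding G_def u_def by simp
        then show ?thesis using step unfolding u_def by blast
      qed (use False in auto)
    qed
    have fin: "finite (\<Union>S\<in>Pow J. ?H S)" using IH(1) less.prems by auto
    have "real (card {F. rooted_forest U J F}) \<le> real (card (\<Union>S\<in>Pow J. ?H S))"
      using card_mono[OF fin sub] by simp
    also have "\<dots> \<le> real (\<Sum>S\<in>Pow J. card (?H S))"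
      unfolding of_nat_le_iff by (rule card_UN_le) (use less.prems in simp)
    also have "\<dots> \<le> (\<Sum>S\<in>Pow J. real (card (G S)))"
      unfolding of_nat_sum
    proof (rule sum_mono)
      fix S assume "S \<in> Pow J"
      then show "real (card (?H S)) \<le> real (card (G S))"
        unfolding of_nat_le_iff by (intro card_image_le IH(1)) auto
    qed
    also have "\<dots> \<le> (\<Sum>S\<in>Pow J. fact (card J - card S) * forest_coeff (a + card S) (card J - card S))"
      by (rule sum_mono, rule IH(2)) auto
    also have "\<dots> = (\<Sum>i\<le>card J. \<Sum>S\<in>{S\<in>Pow J. card S = i}. fact (card J - card S) * forest_coeff (a + card S) (card J - card S))"
      by (rule sum.group[symmetric]) (use less.prems in \<open>auto intro: card_mono\<close>)
    also have "\<dots> = (\<Sum>i\<le>card J. \<Sum>S\<in>{S\<in>Pow J. card S = i}. fact (card J - i) * forest_coeff (a + i) (card J - i))"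
      by (intro sum.cong refl) auto
    also have "\<dots> = (\<Sum>i\<le>card J. real (card J choose i) * (fact (card J - i) * forest_coeff (a + i) (card J - i)))"
    proof (intro sum.cong refl)
      fix i
      have "card {S\<in>Pow J. card S = i} = card J choose i"
        using n_subsets[OF less.prems(2), of i] by (simp add: Pow_def)
      then show "(\<Sum>S\<in>{S\<in>Pow J. card S = i}. fact (card J - i) * forest_coeff (a + i) (card J - i)) =
        real (card J choose i) * (fact (card J - i) * forest_coeff (a + i) (card J - i))" by simp
    qed
    also have "\<dots> = (\<Sum>i\<le>card J. fact (card J) * (forest_coeff (a + i) (card J - i) / fact i))"
      by (intro sum.cong refl) (simp add: binomial_fact)
    also have "\<dots> = fact (card J) * forest_coeff (card U) (card J)"
      unfolding ca by (simp add: sum_distrib_left)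
    finally show ?thesis using finite_subset[OF sub fin] by simp
  qed
qed

lemma two_le_card:
  assumes "x \<in> A" "y \<in> A" "x \<noteq> y" "finite A"
  shows "2 \<le> card A"
proof -
  have "card {x, y} \<le> card A" using assms by (intro card_mono) auto
  then show ?thesis using assms by simp
qed

text \<open>The fifth hypothesis is what maximality of a 2-core provides, the sixth what
  connectedness provides. Both survive when the smallest root is exchanged for its children, which
  is the induction step.\<close>

lemma rooted_forestI:
  assumes "finite U" "finite J" "U \<inter> J = {}"
    and "\<And>e. e \<in> F \<Longrightarrow> e \<subseteq> U \<union> J \<and> card e = 2 \<and> \<not> e \<subseteq> U"
    and "\<And>J'. J' \<subseteq> J \<Longrightarrow> J' \<noteq> {} \<Longrightarrow> \<exists>x\<in>J'. card {y \<in> U \<union> J'. {x, y} \<in> F} \<le> 1"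
    and "\<And>J'. J' \<subseteq> J \<Longrightarrow> J' \<noteq> {} \<Longrightarrow> \<exists>x\<in>J'. \<exists>y\<in>U \<union> J - J'. {x, y} \<in> F"
  shows "rooted_forest U J F"
  using assms
proof (induction "card U + card J" arbitrary: U J F rule: less_induct)
  case less
  note fin = less.prems(1,2) and disj = less.prems(3) and edges = less.prems(4)
    and peel = less.prems(5) and conn = less.prems(6)
  show ?case
  proof (cases "U = {}")
    case True
    then have "J = {}" using conn[of J] by auto
    moreover have "F = {}" using edges True \<open>J = {}\<close> by fastforce
    ultimately show ?thesis using True rooted_forest.empty by simp
  next
    case False
    define u where "u = Min U"
    have u: "u \<in> U" using False fin unfolding u_def by simp
    define S where "S = {x. {u, x} \<in> F}"
    have SJ: "S \<subseteq> J"
    proof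
      fix x assume "x \<in> S"
      then have "{u, x} \<subseteq> U \<union> J" "\<not> {u, x} \<subseteq> U" using edges unfolding S_def by blast+
      then show "x \<in> J" using u by auto
    qed
    have fS: "finite S" using SJ fin finite_subset by blast
    define F' where "F' = F - (\<lambda>x. {u, x}) ` S"
    have noU: "u \<notin> e" if eF: "e \<in> F'" for e
    proof
      assume "u \<in> e"
      obtain a b where ab: "e = {a, b}" using edges[of e] eF unfolding F'_def card_2_iff by blast
      obtain x where "e = {u, x}"
        using ab \<open>u \<in> e\<close> by (cases "a = u") (auto simp: insert_commute)
      then show False using eF unfolding F'_def S_def by auto
    qed
    have "rooted_forest (U - {u} \<union> S) (J - S) F'"
    proof (rule less.hyps)
      have "card (U - {u} \<union> S) = card (U - {u}) + card S"
        using fin fS SJ disj by (intro card_Un_disjoint) auto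
      moreover have "card (J - S) = card J - card S" using SJ fS by (simp add: card_Diff_subset)
      moreover have "card S \<le> card J" using SJ fin by (intro card_mono)
      moreover have "card U > 0" using u fin by (auto simp: card_gt_0_iff)
      ultimately show "card (U - {u} \<union> S) + card (J - S) < card U + card J" using u by simp
      show "finite (U - {u} \<union> S)" "finite (J - S)" using fin fS by auto
      show "(U - {u} \<union> S) \<inter> (J - S) = {}" using disj by auto
    next
      fix e assume e: "e \<in> F'"
      have e': "e \<in> F" "u \<notin> e" using e noU unfolding F'_def by auto
      have 1: "e \<subseteq> U \<union> J" "card e = 2" "\<not> e \<subseteq> U" using edges[OF e'(1)] by auto
      \<comment> \<open>An edge inside the new root set would close a cycle through \<open>u\<close>
        or link two old roots. Every child of \<open>u\<close> on it would have both
        \<open>u\<close> and the other end as neighbours, contradicting \<open>peel\<close> for the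
        children on the edge.\<close>
      have "\<not> e \<subseteq> U - {u} \<union> S"
      proof
        assume sub: "e \<subseteq> U - {u} \<union> S"
        obtain x y where xy: "e = {x, y}" "x \<noteq> y" using 1(2) by (auto simp: card_2_iff)
        obtain s t where st: "e = {s, t}" "s \<noteq> t" "s \<in> S" "t \<in> U - {u} \<union> S"
        proof (cases "x \<in> S")
          case True then show ?thesis using that[of x y] xy sub by auto
        next
          case False
          then have "y \<in> S" using xy sub 1(3) by auto
          then show ?thesis using that[of y x] xy sub by auto
        qed
        define J' where "J' = {s, t} \<inter> S"
        have J': "J' \<subseteq> J" "J' \<noteq> {}" "s \<in> J'" using SJ st unfolding J'_def by auto
        have eF: "{s, t} \<in> F" "{t, s} \<in> F" using st e' by (auto simp: insert_commute)
        obtain z where z: "z \<in> J'" "card {y \<in> U \<union> J'. {z, y} \<in> F} \<le> 1" using peel[OF J'(1,2)] by blast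
        have zS: "z \<in> S" "z = s \<or> z = t" using z unfolding J'_def by auto
        define z' where "z' = (if z = s then t else s)"
        have "z' \<in> {y \<in> U \<union> J'. {z, y} \<in> F}"
          using eF zS st unfolding z'_def J'_def by auto
        moreover have "u \<in> {y \<in> U \<union> J'. {z, y} \<in> F}"
          using zS(1) u unfolding S_def by (auto simp: insert_commute)
        moreover have "z' \<noteq> u" using e' st unfolding z'_def by auto
        moreover have "finite {y \<in> U \<union> J'. {z, y} \<in> F}"
          using fin unfolding J'_def by auto
        ultimately have "2 \<le> card {y \<in> U \<union> J'. {z, y} \<in> F}" by (intro two_le_card)
        then show False using z(2) by linarith
      qed
      then show "e \<subseteq> U - {u} \<union> S \<union> (J - S) \<and> card e = 2 \<and> \<not> e \<subseteq> U - {u} \<union> S"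
        using 1 e' by auto
    next
      fix J' assume J': "J' \<subseteq> J - S" "J' \<noteq> {}"
      \<comment> \<open>Children of \<open>u\<close> adjacent to \<open>J'\<close> act as roots in
        the new forest but not in the old one, so they are added before \<open>peel\<close> is
        applied. Such a child sees both \<open>u\<close> and a vertex of \<open>J'\<close>, hence
        the vertex found must lie in \<open>J'\<close>.\<close>
      define J3 where "J3 = J' \<union> {s \<in> S. \<exists>y\<in>J'. {s, y} \<in> F}"
      have J3: "J3 \<subseteq> J" "J3 \<noteq> {}" using J' SJ unfolding J3_def by auto
      obtain x where x: "x \<in> J3" "card {y \<in> U \<union> J3. {x, y} \<in> F} \<le> 1" using peel[OF J3] by blast
      have fin3: "finite {y \<in> U \<union> J3. {x, y} \<in> F}" using fin finite_subset[OF J3(1)] by simp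
      have "x \<in> J'"
      proof (rule ccontr)
        assume "x \<notin> J'"
        then obtain y where y: "x \<in> S" "y \<in> J'" "{x, y} \<in> F" using x(1) unfolding J3_def by auto
        have "u \<in> {y \<in> U \<union> J3. {x, y} \<in> F}" using y(1) u unfolding S_def by (auto simp: insert_commute)
        moreover have "y \<in> {y \<in> U \<union> J3. {x, y} \<in> F}" using y unfolding J3_def by auto
        moreover have "y \<noteq> u" using y J' u disj by auto
        ultimately have "2 \<le> card {y \<in> U \<union> J3. {x, y} \<in> F}" using fin3 by (intro two_le_card)
        then show False using x(2) by linarith
      qed
      moreover have "{y \<in> U - {u} \<union> S \<union> J'. {x, y} \<in> F'} \<subseteq> {y \<in> U \<union> J3. {x, y} \<in> F}"
        using \<open>x \<in> J'\<close> unfolding J3_def F'_def by (auto simp: insert_commute)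
      then have "card {y \<in> U - {u} \<union> S \<union> J'. {x, y} \<in> F'} \<le> 1"
        using card_mono[OF fin3, of "{y \<in> U - {u} \<union> S \<union> J'. {x, y} \<in> F'}"] x(2) by linarith
      ultimately show "\<exists>x\<in>J'. card {y \<in> U - {u} \<union> S \<union> J'. {x, y} \<in> F'} \<le> 1" by blast
    next
      fix J' assume J': "J' \<subseteq> J - S" "J' \<noteq> {}"
      have "J' \<subseteq> J" using J' by auto
      from conn[OF this J'(2)] obtain x y where xy: "x \<in> J'" "y \<in> U \<union> J - J'" "{x, y} \<in> F" by blast
      have "x \<noteq> u" using xy J' u disj by auto
      moreover have "y \<noteq> u"
      proof
        assume "y = u"
        then have "x \<in> S" using xy unfolding S_def by (simp add: insert_commute)
        then show False using xy J' by auto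
      qed
      ultimately have "{x, y} \<notin> (\<lambda>x. {u, x}) ` S" by (auto simp: doubleton_eq_iff)
      then have "{x, y} \<in> F'" using xy unfolding F'_def by blast
      then show "\<exists>x\<in>J'. \<exists>y\<in>U - {u} \<union> S \<union> (J - S) - J'. {x, y} \<in> F'" using xy \<open>y \<noteq> u\<close> by blast
    qed
    from rooted_forest.step[OF fin(1) False u_def SJ disj this]
    have "rooted_forest U J ((\<lambda>x. {u, x}) ` S \<union> F')" .
    moreover have "(\<lambda>x. {u, x}) ` S \<union> F' = F" unfolding F'_def S_def by auto
    ultimately show ?thesis by simp
  qed
qed

subsection \<open>Perfect matchings without closed families of blocks\<close>

definition pairings :: "'a set \<Rightarrow> ('a \<Rightarrow> 'a) set" where
  "pairings S = {\<sigma> \<in> S \<rightarrow>\<^sub>E S. \<forall>x\<in>S. \<sigma> x \<noteq> x \<and> \<sigma> (\<sigma> x) = x}"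

text \<open>The members of \<open>D\<close> will be the pairs of half-edges at degree-two vertices.
  A closed subfamily would be a union of cycles through such vertices only, detached from the rest
  of the core.\<close>

definition good_pairings :: "'a set \<Rightarrow> 'a set set \<Rightarrow> ('a \<Rightarrow> 'a) set" where
  "good_pairings S D = {\<sigma> \<in> pairings S. \<forall>D'\<subseteq>D. D' \<noteq> {} \<longrightarrow> \<not> \<sigma> ` \<Union>D' \<subseteq> \<Union>D'}"

lemma finite_pairings: "finite S \<Longrightarrow> finite (pairings S)"
  unfolding pairings_def by (rule finite_subset[OF _ finite_PiE[of S "\<lambda>_. S"]]) auto

lemma pairings_in: "\<sigma> \<in> pairings S \<Longrightarrow> x \<in> S \<Longrightarrow> \<sigma> x \<in> S"
  and pairings_neq: "\<sigma> \<in> pairings S \<Longrightarrow> x \<in> S \<Longrightarrow> \<sigma> x \<noteq> x"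
  and pairings_invol: "\<sigma> \<in> pairings S \<Longrightarrow> x \<in> S \<Longrightarrow> \<sigma> (\<sigma> x) = x"
  and pairings_outside: "\<sigma> \<in> pairings S \<Longrightarrow> x \<notin> S \<Longrightarrow> \<sigma> x = undefined"
  unfolding pairings_def by auto

lemma card_pairings:
  "finite S \<Longrightarrow> card S = 2 * m \<Longrightarrow> card (pairings S) \<le> (\<Prod>i<m. 2 * i + 1)"
proof (induction m arbitrary: S)
  case 0
  then have "pairings S \<subseteq> {\<lambda>x. undefined}" unfolding pairings_def by auto
  then have "card (pairings S) \<le> card {\<lambda>x::'a. undefined :: 'a}" by (intro card_mono) auto
  then show ?case by simp
next
  case (Suc m)
  then obtain a where a: "a \<in> S" by fastforce
  let ?T = "SIGMA b:S - {a}. pairings (S - {a, b})"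
  let ?f = "\<lambda>\<sigma>. (\<sigma> a, restrict \<sigma> (S - {a, \<sigma> a}))"
  have fT: "finite ?T" using Suc.prems by (intro finite_SigmaI finite_pairings) auto
  have "card (pairings S) \<le> card ?T"
  proof (rule card_inj_on_le[of ?f])
    show "inj_on ?f (pairings S)"
    proof (rule inj_onI)
      fix \<sigma> \<tau> assume *: "\<sigma> \<in> pairings S" "\<tau> \<in> pairings S" "?f \<sigma> = ?f \<tau>"
      then have 1: "\<sigma> a = \<tau> a" "restrict \<sigma> (S - {a, \<sigma> a}) = restrict \<tau> (S - {a, \<sigma> a})" by auto
      show "\<sigma> = \<tau>"
      proof
        fix x
        consider "x \<notin> S" | "x = a" | "x = \<sigma> a" | "x \<in> S - {a, \<sigma> a}" by blast
        then show "\<sigma> x = \<tau> x"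
        proof cases
          case 1 then show ?thesis using *(1,2) by (simp add: pairings_outside)
        next
          case 2 then show ?thesis using 1 by simp
        next
          case 3
          have "\<sigma> (\<sigma> a) = a" "\<tau> (\<tau> a) = a" using *(1,2) a by (auto intro: pairings_invol)
          then show ?thesis using 3 1(1) by simp
        next
          case 4 then show ?thesis using fun_cong[OF 1(2), of x] by simp
        qed
      qed
    qed
    show "?f ` pairings S \<subseteq> ?T"
    proof (rule image_subsetI)
      fix \<sigma> assume s: "\<sigma> \<in> pairings S"
      have "\<sigma> x \<in> S - {a, \<sigma> a}" if x: "x \<in> S - {a, \<sigma> a}" for x
      proof -
        have "\<sigma> (\<sigma> x) = x" using s x by (auto intro: pairings_invol)
        moreover have "\<sigma> (\<sigma> a) = a" using s a by (auto intro: pairings_invol)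
        ultimately show ?thesis using x pairings_in[OF s, of x] by auto
      qed
      then have "restrict \<sigma> (S - {a, \<sigma> a}) \<in> pairings (S - {a, \<sigma> a})"
        unfolding pairings_def using s pairings_neq[OF s] pairings_invol[OF s] by auto
      then show "(\<sigma> a, restrict \<sigma> (S - {a, \<sigma> a})) \<in> ?T"
        using a pairings_in[OF s a] pairings_neq[OF s a] by auto
    qed
  qed (rule fT)
  also have "card ?T = (\<Sum>b\<in>S - {a}. card (pairings (S - {a, b})))"
    using Suc.prems by (intro card_SigmaI) (auto intro: finite_pairings)
  also have "\<dots> \<le> (\<Sum>b\<in>S - {a}. \<Prod>i<m. 2 * i + 1)"
  proof (rule sum_mono)
    fix b assume b: "b \<in> S - {a}"
    have "card (S - {a, b}) = card S - card {a, b}" using a b Suc.prems by (intro card_Diff_subset) auto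
    moreover have "card {a, b} = 2" using b by auto
    ultimately have "card (S - {a, b}) = 2 * m" using Suc.prems by simp
    then show "card (pairings (S - {a, b})) \<le> (\<Prod>i<m. 2 * i + 1)" using Suc.prems by (intro Suc.IH) auto
  qed
  also have "\<dots> = (2 * m + 1) * (\<Prod>i<m. 2 * i + 1)" using a Suc.prems by simp
  finally show ?case by (simp add: mult.commute)
qed

text \<open>A block \<open>{a, b}\<close> is suppressed: it is deleted and the partners of
  \<open>a\<close> and \<open>b\<close> are joined. The result and the partner of \<open>a\<close>
  determine the pairing, so a block costs \<open>2 * (m + i)\<close>, whereas among arbitrary
  pairings it costs \<open>2 * (m + i) + 1\<close>. Over all blocks this saves a factor of order
  \<open>sqrt ((card D + m) / m)\<close>, and the bound is 0 if \<open>m = 0\<close> and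
  \<open>D\<close> is nonempty.\<close>

lemma card_good_pairings:
  assumes "finite D" "finite S" "\<Union>D \<subseteq> S" "\<And>d. d \<in> D \<Longrightarrow> card d = 2"
    "\<And>d d'. d \<in> D \<Longrightarrow> d' \<in> D \<Longrightarrow> d \<noteq> d' \<Longrightarrow> d \<inter> d' = {}" "card S = 2 * (card D + m)"
  shows "card (good_pairings S D) \<le> (\<Prod>i<card D. 2 * (m + i)) * (\<Prod>i<m. 2 * i + 1)"
  using assms
proof (induction D arbitrary: S rule: finite_induct)
  case empty
  have "card (good_pairings S {}) \<le> card (pairings S)"
    using empty by (intro card_mono finite_pairings) (auto simp: good_pairings_def)
  then show ?case using card_pairings[of S m] empty by simp
next
  case (insert d D)
  obtain a b where ab: "d = {a, b}" "a \<noteq> b" using insert.prems(3)[of d] by (auto simp: card_2_iff)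
  have abS: "a \<in> S" "b \<in> S" using insert.prems(2) ab by auto
  define S' where "S' = S - {a, b}"
  have cS: "card S = 2 * (card D + m) + 2" using insert by simp
  have cS': "card S' = 2 * (card D + m)"
    using card_Diff_subset[of "{a, b}" S] abS ab(2) cS insert.prems(1) unfolding S'_def by simp
  have dD: "d \<inter> d' = {}" if "d' \<in> D" for d' using insert.prems(4)[of d d'] that insert.hyps(2) by auto
  have DS': "\<Union>D \<subseteq> S'" using insert.prems(2) dD ab unfolding S'_def by blast
  have IH: "card (good_pairings S' D) \<le> (\<Prod>i<card D. 2 * (m + i)) * (\<Prod>i<m. 2 * i + 1)"
    using insert.prems DS' cS' by (intro insert.IH) (auto simp: S'_def)
  define ct where "ct \<sigma> = restrict (\<lambda>z. if \<sigma> z = a then \<sigma> b else if \<sigma> z = b then \<sigma> a else \<sigma> z) S'" for \<sigma>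
  let ?f = "\<lambda>\<sigma>. (\<sigma> a, ct \<sigma>)"
  have basics: "\<sigma> a \<in> S'" "\<sigma> b \<in> S'" "\<sigma> a \<noteq> \<sigma> b" "ct \<sigma> (\<sigma> a) = \<sigma> b" "ct \<sigma> (\<sigma> b) = \<sigma> a"
    "\<And>z. z \<in> S' \<Longrightarrow> z \<noteq> \<sigma> a \<Longrightarrow> z \<noteq> \<sigma> b \<Longrightarrow> ct \<sigma> z = \<sigma> z \<and> \<sigma> z \<in> S' \<and> \<sigma> z \<noteq> \<sigma> a \<and> \<sigma> z \<noteq> \<sigma> b"
    if s: "\<sigma> \<in> good_pairings S (insert d D)" for \<sigma>
  proof -
    have sp: "\<sigma> \<in> pairings S" using s unfolding good_pairings_def by auto
    have aa: "\<sigma> (\<sigma> a) = a" "\<sigma> (\<sigma> b) = b" using sp abS by (auto intro: pairings_invol)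
    have "\<forall>D'\<subseteq>insert d D. D' \<noteq> {} \<longrightarrow> \<not> \<sigma> ` \<Union>D' \<subseteq> \<Union>D'" using s unfolding good_pairings_def by simp
    then have "\<not> \<sigma> ` \<Union>{d} \<subseteq> \<Union>{d}" by (elim allE[of _ "{d}"]) simp
    \<comment> \<open>The single block \<open>d\<close> is not closed, so \<open>a\<close> and
      \<open>b\<close> are not partners and \<open>ct \<sigma>\<close> has two distinct ends to
      join.\<close>
    then have nab: "\<sigma> a \<noteq> b" using aa ab by auto
    then have nba: "\<sigma> b \<noteq> a" using aa by auto
    show 1: "\<sigma> a \<in> S'" "\<sigma> b \<in> S'"
      using nab nba pairings_in[OF sp] pairings_neq[OF sp] abS unfolding S'_def by auto
    show 2: "\<sigma> a \<noteq> \<sigma> b" using aa ab by auto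
    show "ct \<sigma> (\<sigma> a) = \<sigma> b" "ct \<sigma> (\<sigma> b) = \<sigma> a" using 1 aa ab unfolding ct_def by auto
    fix z assume z: "z \<in> S'" "z \<noteq> \<sigma> a" "z \<noteq> \<sigma> b"
    have zz: "\<sigma> (\<sigma> z) = z" using sp z by (auto intro: pairings_invol simp: S'_def)
    have zn: "\<sigma> z \<noteq> a" "\<sigma> z \<noteq> b" using zz z by auto
    moreover have "\<sigma> z \<noteq> \<sigma> a" "\<sigma> z \<noteq> \<sigma> b" using zz aa z(1) unfolding S'_def by auto
    moreover have "\<sigma> z \<in> S" using pairings_in[OF sp] z unfolding S'_def by auto
    ultimately show "ct \<sigma> z = \<sigma> z \<and> \<sigma> z \<in> S' \<and> \<sigma> z \<noteq> \<sigma> a \<and> \<sigma> z \<noteq> \<sigma> b"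
      using z unfolding ct_def S'_def by auto
  qed
  have fin: "finite (S' \<times> good_pairings S' D)"
    using insert.prems(1) finite_pairings[of S'] unfolding good_pairings_def S'_def by auto
  have "card (good_pairings S (insert d D)) \<le> card (S' \<times> good_pairings S' D)"
  proof (rule card_inj_on_le[of ?f])
    show "inj_on ?f (good_pairings S (insert d D))"
    proof (rule inj_onI)
      fix \<sigma> \<tau> assume *: "\<sigma> \<in> good_pairings S (insert d D)" "\<tau> \<in> good_pairings S (insert d D)" "?f \<sigma> = ?f \<tau>"
      have e: "\<sigma> a = \<tau> a" "ct \<sigma> = ct \<tau>" using *(3) by auto
      have sp: "\<sigma> \<in> pairings S" "\<tau> \<in> pairings S" using * unfolding good_pairings_def by auto
      note bs = basics[OF *(1)] and bt = basics[OF *(2)]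
      have e2: "\<sigma> b = \<tau> b" using bs(4) bt(4) e by metis
      show "\<sigma> = \<tau>"
      proof
        fix x
        consider "x \<notin> S" | "x = a" | "x = b" | "x = \<sigma> a" | "x = \<sigma> b" | "x \<in> S'" "x \<noteq> \<sigma> a" "x \<noteq> \<sigma> b"
          unfolding S'_def by blast
        then show "\<sigma> x = \<tau> x"
        proof cases
          case 1 then show ?thesis using sp by (simp add: pairings_outside)
        next
          case 4
          then have "\<sigma> x = a" "\<tau> x = a" using pairings_invol[OF sp(1) abS(1)] pairings_invol[OF sp(2) abS(1)] e by auto
          then show ?thesis by simp
        next
          case 5
          then have "\<sigma> x = b" "\<tau> x = b" using pairings_invol[OF sp(1) abS(2)] pairings_invol[OF sp(2) abS(2)] e2 by auto
          then show ?thesis by simp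
        next
          case 6
          then have "ct \<sigma> x = \<sigma> x" "ct \<tau> x = \<tau> x" using bs(6)[of x] bt(6)[of x] e e2 by auto
          then show ?thesis using e by simp
        qed (use e e2 in auto)
      qed
    qed
    show "?f ` good_pairings S (insert d D) \<subseteq> S' \<times> good_pairings S' D"
    proof (rule image_subsetI)
      fix \<sigma> assume s: "\<sigma> \<in> good_pairings S (insert d D)"
      note bs = basics[OF s]
      have sp: "\<sigma> \<in> pairings S" using s unfolding good_pairings_def by auto
      have sg: "\<not> \<sigma> ` \<Union>D' \<subseteq> \<Union>D'" if "D' \<subseteq> insert d D" "D' \<noteq> {}" for D'
        using s that unfolding good_pairings_def by simp
      have ct1: "ct \<sigma> z \<in> S' \<and> ct \<sigma> z \<noteq> z \<and> ct \<sigma> (ct \<sigma> z) = z" if z: "z \<in> S'" for z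
      proof -
        consider "z = \<sigma> a" | "z = \<sigma> b" | "z \<noteq> \<sigma> a" "z \<noteq> \<sigma> b" by blast
        then show ?thesis
        proof cases
          case 1 then show ?thesis using bs(1-5) by metis
        next
          case 2 then show ?thesis using bs(1-5) by metis
        next
          case 3
          have zS: "z \<in> S" using z unfolding S'_def by auto
          have 4: "ct \<sigma> z = \<sigma> z" "\<sigma> z \<in> S'" "\<sigma> z \<noteq> \<sigma> a" "\<sigma> z \<noteq> \<sigma> b" using bs(6)[OF z 3] by auto
          have "ct \<sigma> (\<sigma> z) = \<sigma> (\<sigma> z)" using bs(6)[OF 4(2-4)] by auto
          then show ?thesis using 4 pairings_invol[OF sp zS] pairings_neq[OF sp zS] by auto
        qed
      qed
      have cp: "ct \<sigma> \<in> pairings S'"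
      proof -
        have "ct \<sigma> \<in> S' \<rightarrow>\<^sub>E S'"
          by (rule PiE_I) (use ct1 in blast, simp add: ct_def)
        then show ?thesis unfolding pairings_def using ct1 by blast
      qed
      \<comment> \<open>A closed subfamily contains both ends of the new edge or neither. In the
        first case it was closed before the suppression together with \<open>d\<close>, in the
        second by itself.\<close>
      have "\<not> ct \<sigma> ` \<Union>D' \<subseteq> \<Union>D'" if D': "D' \<subseteq> D" "D' \<noteq> {}" for D'
      proof
        assume cl: "ct \<sigma> ` \<Union>D' \<subseteq> \<Union>D'"
        have D'S: "z \<in> S'" if "z \<in> \<Union>D'" for z using that D' DS' by blast
        show False
        proof (cases "\<sigma> a \<in> \<Union>D'")
          case True
          then have bD: "\<sigma> b \<in> \<Union>D'" using cl bs(4) by (metis image_subset_iff)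
          have "\<sigma> ` \<Union>(insert d D') \<subseteq> \<Union>(insert d D')"
          proof (rule image_subsetI)
            fix z assume "z \<in> \<Union>(insert d D')"
            then consider "z = a" | "z = b" | "z \<in> \<Union>D'" using ab by blast
            then show "\<sigma> z \<in> \<Union>(insert d D')"
            proof cases
              case 3
              consider "z = \<sigma> a" | "z = \<sigma> b" | "z \<noteq> \<sigma> a" "z \<noteq> \<sigma> b" by blast
              then show ?thesis
              proof cases
                case 1 then show ?thesis using pairings_invol[OF sp abS(1)] ab by simp
              next
                case 2 then show ?thesis using pairings_invol[OF sp abS(2)] ab by simp
              next
                case 33: 3
                then have "ct \<sigma> z = \<sigma> z" using bs(6) D'S[OF 3] by blast
                then show ?thesis using cl 3 by (metis UnCI Union_insert image_subset_iff)
              qed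
            qed (use True bD in auto)
          qed
          moreover have "insert d D' \<subseteq> insert d D" using D'(1) by (rule insert_mono)
          ultimately show False using sg[of "insert d D'"] by simp
        next
          case False
          then have nb: "\<sigma> b \<notin> \<Union>D'" using cl bs(5) by (metis image_subset_iff)
          have "\<sigma> ` \<Union>D' \<subseteq> \<Union>D'"
          proof
            fix w assume "w \<in> \<sigma> ` \<Union>D'"
            then obtain z where z: "z \<in> \<Union>D'" "w = \<sigma> z" by blast
            then have "ct \<sigma> z = \<sigma> z" using bs(6)[OF D'S[OF z(1)]] False nb by blast
            then show "w \<in> \<Union>D'" using cl z by (metis image_subset_iff)
          qed
          moreover have "D' \<subseteq> insert d D" using D'(1) by blast
          ultimately show False using sg[of D'] D'(2) by simp
        qed
      qed
      then have "ct \<sigma> \<in> good_pairings S' D" using cp unfolding good_pairings_def by simp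
      then show "(\<sigma> a, ct \<sigma>) \<in> S' \<times> good_pairings S' D" using bs(1) by blast
    qed
  qed (rule fin)
  also have "\<dots> = 2 * (card D + m) * card (good_pairings S' D)" by (simp add: card_cartesian_product cS')
  also have "\<dots> \<le> 2 * (card D + m) * ((\<Prod>i<card D. 2 * (m + i)) * (\<Prod>i<m. 2 * i + 1))"
    by (intro mult_le_mono2 IH)
  also have "\<dots> = (\<Prod>i<card (insert d D). 2 * (m + i)) * (\<Prod>i<m. 2 * i + 1)"
    using insert.hyps by (simp add: mult_ac add.commute)
  finally show ?case .
qed

subsection \<open>Counting graphs of minimum degree two outside a given set\<close>

definition nbrs :: "nat set set \<Rightarrow> nat \<Rightarrow> nat set" where
  "nbrs R x = {y. {x, y} \<in> R}"

definition half_edges :: "nat set set \<Rightarrow> (nat \<times> nat) set" where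
  "half_edges R = {(x, y). {x, y} \<in> R}"

lemma half_edges_eq_Sigma:
  assumes "\<And>e. e \<in> R \<Longrightarrow> e \<subseteq> U"
  shows "half_edges R = (SIGMA x:U. nbrs R x)"
  using assms unfolding half_edges_def nbrs_def by blast

lemma finite_nbrs: "finite U \<Longrightarrow> (\<And>e. e \<in> R \<Longrightarrow> e \<subseteq> U) \<Longrightarrow> finite (nbrs R x)"
  unfolding nbrs_def by (rule finite_subset[of _ U]) blast+

lemma card_half_edges:
  assumes "finite R" "\<And>e. e \<in> R \<Longrightarrow> card e = 2"
  shows "finite (half_edges R) \<and> card (half_edges R) = 2 * card R"
proof -
  have two: "finite {(x, y). {x, y} = e} \<and> card {(x, y). {x, y} = e} = 2" if eR: "e \<in> R" for e
  proof -
    obtain x y where xy: "e = {x, y}" "x \<noteq> y" using assms(2)[OF eR] by (auto simp: card_2_iff)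
    have "{(x, y). {x, y} = e} = {(x, y), (y, x)}" unfolding xy by (auto simp: doubleton_eq_iff)
    then show ?thesis using xy by simp
  qed
  have eq: "half_edges R = (\<Union>e\<in>R. {(x, y). {x, y} = e})" unfolding half_edges_def by auto
  have "card (half_edges R) = (\<Sum>e\<in>R. card {(x, y). {x, y} = e})"
    unfolding eq using assms two by (intro card_UN_disjoint) auto
  also have "\<dots> = 2 * card R" using two by simp
  finally show ?thesis unfolding eq using assms two by auto
qed

lemma edges_from_half_edges:
  assumes "\<And>e. e \<in> R \<Longrightarrow> card e = 2"
  shows "R = (\<lambda>(x, y). {x, y}) ` half_edges R"
proof
  show "R \<subseteq> (\<lambda>(x, y). {x, y}) ` half_edges R"
  proof
    fix e assume e: "e \<in> R"
    obtain x y where "e = {x, y}" using assms[OF e] by (auto simp: card_2_iff)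
    then show "e \<in> (\<lambda>(x, y). {x, y}) ` half_edges R" using e unfolding half_edges_def by force
  qed
qed (auto simp: half_edges_def)

text \<open>\<open>C\<close> is the vertex set of the cycle and \<open>R\<close> consists of the
  core edges off the cycle. The surplus \<open>a\<close> counts the half-edges of \<open>R\<close>
  at \<open>C\<close> and those beyond the third at vertices of \<open>B\<close>. If
  \<open>3 * card B + a = 2 * m\<close>, then \<open>m\<close> is the number of edges left after
  suppressing the degree-two vertices of \<open>W - B\<close>.\<close>

definition core_graphs :: "nat set \<Rightarrow> nat set \<Rightarrow> nat set \<Rightarrow> nat \<Rightarrow> nat set set set" where
  "core_graphs C W B a = {R. (\<forall>e\<in>R. e \<subseteq> C \<union> W \<and> card e = 2) \<and>
     (\<forall>x\<in>W - B. card (nbrs R x) = 2) \<and> (\<forall>x\<in>B. 3 \<le> card (nbrs R x)) \<and>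
     2 * card R = 2 * card (W - B) + 3 * card B + a \<and>
     (\<forall>X\<subseteq>W - B. X \<noteq> {} \<longrightarrow> (\<exists>x\<in>X. \<exists>y. y \<notin> X \<and> {x, y} \<in> R))}"

text \<open>Half-edges are labelled by points \<open>(Some x, i)\<close> that are forced to sit at the vertex \<open>x\<close>
  (two for degree-two vertices, three for the others), and by \<open>a\<close> points \<open>(None, i)\<close> that may
  sit at any vertex of \<open>C \<union> B\<close>.\<close>

definition pcount :: "nat set \<Rightarrow> nat \<Rightarrow> nat option \<Rightarrow> nat" where
  "pcount B a z = (case z of None \<Rightarrow> a | Some x \<Rightarrow> if x \<in> B then 3 else 2)"

definition pidx :: "nat set \<Rightarrow> nat option set" where
  "pidx W = insert None (Some ` W)"

definition points :: "nat set \<Rightarrow> nat set \<Rightarrow> nat \<Rightarrow> (nat option \<times> nat) set" where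
  "points W B a = (SIGMA z:pidx W. {..<pcount B a z})"

definition labelling :: "nat set \<Rightarrow> nat set \<Rightarrow> nat \<Rightarrow> nat set set \<Rightarrow> (nat option \<times> nat \<Rightarrow> nat \<times> nat) \<Rightarrow> bool" where
  "labelling W B a R h \<longleftrightarrow> bij_betw h (points W B a) (half_edges R) \<and>
     (\<forall>x\<in>W. \<forall>i<pcount B a (Some x). fst (h (Some x, i)) = x)"

lemma pidx_prod:
  assumes "finite W" "B \<subseteq> W"
  shows "(\<Prod>z\<in>pidx W. f (pcount B a z)) = (f a * f 2 ^ card (W - B) * f 3 ^ card B :: 'b :: comm_monoid_mult)"
proof -
  have "(\<Prod>z\<in>pidx W. f (pcount B a z)) = f a * (\<Prod>x\<in>W. f (pcount B a (Some x)))"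
    unfolding pidx_def using assms(1)
    by (subst prod.insert) (auto simp: pcount_def prod.reindex inj_on_def)
  also have "(\<Prod>x\<in>W. f (pcount B a (Some x))) =
      (\<Prod>x\<in>W - B. f (pcount B a (Some x))) * (\<Prod>x\<in>B. f (pcount B a (Some x)))"
    using prod.subset_diff[OF assms(2,1)] by blast
  also have "(\<Prod>x\<in>W - B. f (pcount B a (Some x))) = f 2 ^ card (W - B)"
    by (subst prod.cong[OF refl, of _ _ "\<lambda>_. f 2"]) (auto simp: pcount_def)
  also have "(\<Prod>x\<in>B. f (pcount B a (Some x))) = f 3 ^ card B"
    by (subst prod.cong[OF refl, of _ _ "\<lambda>_. f 3"]) (auto simp: pcount_def)
  finally show ?thesis by (simp add: mult.assoc)
qed

lemma finite_points: "finite W \<Longrightarrow> finite (points W B a)"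
  unfolding points_def pidx_def by auto

lemma card_points:
  assumes "finite W" "B \<subseteq> W"
  shows "card (points W B a) = 2 * card (W - B) + 3 * card B + a"
proof -
  have "card (points W B a) = (\<Sum>z\<in>pidx W. pcount B a z)"
    unfolding points_def using assms by (subst card_SigmaI) (auto simp: pidx_def)
  also have "\<dots> = a + (\<Sum>x\<in>W. pcount B a (Some x))"
    unfolding pidx_def using assms(1)
    by (subst sum.insert) (auto simp: pcount_def sum.reindex inj_on_def)
  also have "(\<Sum>x\<in>W. pcount B a (Some x)) =
      (\<Sum>x\<in>W - B. pcount B a (Some x)) + (\<Sum>x\<in>B. pcount B a (Some x))"
    using sum.subset_diff[OF assms(2,1)] by blast
  also have "(\<Sum>x\<in>W - B. pcount B a (Some x)) = 2 * card (W - B)"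
    by (subst sum.cong[OF refl, of _ _ "\<lambda>_. 2"]) (auto simp: pcount_def)
  also have "(\<Sum>x\<in>B. pcount B a (Some x)) = 3 * card B"
    by (subst sum.cong[OF refl, of _ _ "\<lambda>_. 3"]) (auto simp: pcount_def)
  finally show ?thesis by simp
qed

section \<open>Labelled half-edges of a core graph\<close>

context
  fixes C W B :: "nat set" and a :: nat
  assumes fin: "finite C" "finite W" and disj: "C \<inter> W = {}" and BW: "B \<subseteq> W"
begin

lemma core_edge: "R \<in> core_graphs C W B a \<Longrightarrow> e \<in> R \<Longrightarrow> e \<subseteq> C \<union> W"
  and core_edge2: "R \<in> core_graphs C W B a \<Longrightarrow> e \<in> R \<Longrightarrow> card e = 2"
  and core_deg2: "R \<in> core_graphs C W B a \<Longrightarrow> x \<in> W - B \<Longrightarrow> card (nbrs R x) = 2"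
  and core_deg3: "R \<in> core_graphs C W B a \<Longrightarrow> x \<in> B \<Longrightarrow> 3 \<le> card (nbrs R x)"
  and core_card: "R \<in> core_graphs C W B a \<Longrightarrow> 2 * card R = 2 * card (W - B) + 3 * card B + a"
  and core_open: "R \<in> core_graphs C W B a \<Longrightarrow> X \<subseteq> W - B \<Longrightarrow> X \<noteq> {} \<Longrightarrow> \<exists>x\<in>X. \<exists>y. y \<notin> X \<and> {x, y} \<in> R"
  unfolding core_graphs_def by auto

lemma finite_core_graphs: "finite (core_graphs C W B a)"
  by (rule finite_subset[of _ "Pow (Pow (C \<union> W))"]) (use core_edge fin in auto)

lemma core_finite: "R \<in> core_graphs C W B a \<Longrightarrow> finite R"
  by (rule finite_subset[of _ "Pow (C \<union> W)"]) (use core_edge fin in auto)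

lemma core_card_half_edges:
  assumes "R \<in> core_graphs C W B a"
  shows "finite (half_edges R)" "card (half_edges R) = card (points W B a)"
  using card_half_edges[OF core_finite[OF assms] core_edge2[OF assms]]
    core_card[OF assms] card_points[OF fin(2) BW] by auto

lemma core_finite_nbrs: "R \<in> core_graphs C W B a \<Longrightarrow> finite (nbrs R x)"
  using finite_nbrs[of "C \<union> W" R x] fin core_edge by auto

text \<open>Every vertex of \<open>W\<close> has enough half-edges for its own points, and by the
  edge count the remaining half-edges are exactly as many as the \<open>None\<close> points.\<close>

lemma labelling_exists:
  assumes R: "R \<in> core_graphs C W B a"
  shows "\<exists>h. labelling W B a R h"
proof -
  have "\<exists>g. inj_on g {..<pcount B a (Some x)} \<and> g ` {..<pcount B a (Some x)} \<subseteq> nbrs R x" if x: "x \<in> W" for x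
  proof -
    have "pcount B a (Some x) \<le> card (nbrs R x)"
      using core_deg2[OF R, of x] core_deg3[OF R, of x] x unfolding pcount_def by auto
    then show ?thesis
      using card_le_inj[of "{..<pcount B a (Some x)}" "nbrs R x"] core_finite_nbrs[OF R] by auto
  qed
  then obtain g where g: "\<And>x. x \<in> W \<Longrightarrow> inj_on (g x) {..<pcount B a (Some x)}"
    "\<And>x. x \<in> W \<Longrightarrow> g x ` {..<pcount B a (Some x)} \<subseteq> nbrs R x" by metis
  define S1 where "S1 = (SIGMA z:Some ` W. {..<pcount B a z})"
  define S2 where "S2 = {None :: nat option} \<times> {..<a}"
  have S: "points W B a = S1 \<union> S2" "S1 \<inter> S2 = {}"
    unfolding points_def pidx_def S1_def S2_def by (auto simp: pcount_def)
  have fS: "finite S1" "finite S2" using fin unfolding S1_def S2_def by auto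
  define h1 where "h1 s = (the (fst s), g (the (fst s)) (snd s))" for s
  have inj1: "inj_on h1 S1"
    unfolding h1_def S1_def inj_on_def using g(1) by (auto simp: inj_on_def)
  have im1: "h1 ` S1 \<subseteq> half_edges R"
    unfolding h1_def S1_def half_edges_def using g(2) by (fastforce simp: nbrs_def)
  have cS: "card (points W B a) = card S1 + card S2" unfolding S(1) using fS S(2) by (intro card_Un_disjoint)
  have "card (half_edges R - h1 ` S1) = card (half_edges R) - card S1"
    using card_Diff_subset[OF finite_imageI[OF fS(1)] im1] card_image[OF inj1] by simp
  then have "card (half_edges R - h1 ` S1) = card S2" using core_card_half_edges[OF R] cS by simp
  then obtain h2 where h2: "bij_betw h2 S2 (half_edges R - h1 ` S1)"
    using finite_same_card_bij[OF fS(2)] core_card_half_edges(1)[OF R] by (metis finite_Diff)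
  define h where "h s = (if s \<in> S1 then h1 s else h2 s)" for s
  have b1: "bij_betw h S1 (h1 ` S1)"
    using inj1 unfolding bij_betw_def h_def by (auto simp: inj_on_def)
  have b2: "bij_betw h S2 (half_edges R - h1 ` S1)"
  proof -
    have "h s = h2 s" if "s \<in> S2" for s using that S(2) unfolding h_def by auto
    then show ?thesis using h2 bij_betw_cong by blast
  qed
  have "bij_betw h (S1 \<union> S2) (h1 ` S1 \<union> (half_edges R - h1 ` S1))"
    by (rule bij_betw_combine[OF b1 b2]) auto
  moreover have "h1 ` S1 \<union> (half_edges R - h1 ` S1) = half_edges R" using im1 by auto
  ultimately have "bij_betw h (points W B a) (half_edges R)" using S by simp
  moreover have "fst (h (Some x, i)) = x" if "x \<in> W" "i < pcount B a (Some x)" for x i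
  proof -
    have "(Some x, i) \<in> S1" using that unfolding S1_def by auto
    then show ?thesis unfolding h_def h1_def by simp
  qed
  ultimately show ?thesis unfolding labelling_def by blast
qed

text \<open>One labelling of \<open>R\<close> is fixed and then composed with permutations inside
  the fibres. Distinct \<open>f\<close> yield distinct labellings, which supplies the symmetry
  factor in the enumeration.\<close>

definition lab :: "nat set set \<Rightarrow> (nat option \<Rightarrow> nat \<Rightarrow> nat) \<Rightarrow> nat option \<times> nat \<Rightarrow> nat \<times> nat" where
  "lab R f s = (SOME h. labelling W B a R h) (fst s, f (fst s) (snd s))"

definition lab_perms :: "(nat option \<Rightarrow> nat \<Rightarrow> nat) set" where
  "lab_perms = (\<Pi>\<^sub>E z\<in>pidx W. {\<pi>. \<pi> permutes {..<pcount B a z}})"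

lemma labelling_lab:
  assumes R: "R \<in> core_graphs C W B a" and f: "f \<in> lab_perms"
  shows "labelling W B a R (lab R f)"
proof -
  define h where "h = (SOME h. labelling W B a R h)"
  have h: "labelling W B a R h" unfolding h_def by (rule someI_ex[OF labelling_exists[OF R]])
  have fp: "f z permutes {..<pcount B a z}" if "z \<in> pidx W" for z using f that unfolding lab_perms_def by auto
  have "bij_betw (\<lambda>s. (fst s, f (fst s) (snd s))) (points W B a) (points W B a)"
  proof (rule bij_betw_byWitness[where f' = "\<lambda>s. (fst s, inv (f (fst s)) (snd s))"])
    show "\<forall>s\<in>points W B a. (fst (fst s, f (fst s) (snd s)), inv (f (fst (fst s, f (fst s) (snd s)))) (snd (fst s, f (fst s) (snd s)))) = s"
      using permutes_inverses(2)[OF fp] unfolding points_def by auto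
    show "\<forall>s\<in>points W B a. (fst (fst s, inv (f (fst s)) (snd s)), f (fst (fst s, inv (f (fst s)) (snd s))) (snd (fst s, inv (f (fst s)) (snd s)))) = s"
      using permutes_inverses(1)[OF fp] unfolding points_def by auto
    show "(\<lambda>s. (fst s, f (fst s) (snd s))) ` points W B a \<subseteq> points W B a"
      using permutes_in_image[OF fp] unfolding points_def by auto
    show "(\<lambda>s. (fst s, inv (f (fst s)) (snd s))) ` points W B a \<subseteq> points W B a"
      using permutes_in_image[OF permutes_inv[OF fp]] unfolding points_def by auto
  qed
  then have "bij_betw (h \<circ> (\<lambda>s. (fst s, f (fst s) (snd s)))) (points W B a) (half_edges R)"
    using h unfolding labelling_def by (intro bij_betw_trans) auto
  moreover have "h \<circ> (\<lambda>s. (fst s, f (fst s) (snd s))) = lab R f"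
    unfolding lab_def h_def[symmetric] by auto
  moreover have "fst (lab R f (Some x, i)) = x" if x: "x \<in> W" "i < pcount B a (Some x)" for x i
  proof -
    have "f (Some x) i < pcount B a (Some x)"
      using permutes_in_image[OF fp, of "Some x" i] x unfolding pidx_def by auto
    then show ?thesis using h x unfolding lab_def h_def[symmetric] labelling_def by auto
  qed
  ultimately show ?thesis unfolding labelling_def by simp
qed

lemma lab_inj:
  assumes R: "R \<in> core_graphs C W B a" and f: "f \<in> lab_perms" "f' \<in> lab_perms"
    and eq: "\<And>s. s \<in> points W B a \<Longrightarrow> lab R f s = lab R f' s"
  shows "f = f'"
proof -
  define h where "h = (SOME h. labelling W B a R h)"
  have h: "labelling W B a R h" unfolding h_def by (rule someI_ex[OF labelling_exists[OF R]])
  have inj: "inj_on h (points W B a)" using h unfolding labelling_def bij_betw_def by auto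
  have fp: "f z permutes {..<pcount B a z}" "f' z permutes {..<pcount B a z}" if "z \<in> pidx W" for z
    using f that unfolding lab_perms_def by auto
  show ?thesis
  proof (rule PiE_ext[OF f[unfolded lab_perms_def]])
    fix z assume z: "z \<in> pidx W"
    show "f z = f' z"
    proof
      fix i
      show "f z i = f' z i"
      proof (cases "i < pcount B a z")
        case True
        have "(z, i) \<in> points W B a" using z True unfolding points_def by auto
        from eq[OF this] have "h (z, f z i) = h (z, f' z i)" unfolding lab_def h_def[symmetric] by simp
        moreover have "(z, f z i) \<in> points W B a" "(z, f' z i) \<in> points W B a"
          using z True permutes_in_image[OF fp(1)[OF z], of i] permutes_in_image[OF fp(2)[OF z], of i]
          unfolding points_def by auto
        ultimately show ?thesis using inj unfolding inj_on_def by blast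
      next
        case False
        then show ?thesis using permutes_not_in[OF fp(1)[OF z], of i] permutes_not_in[OF fp(2)[OF z], of i] by simp
      qed
    qed
  qed
qed

text \<open>The two points of a degree-two vertex already occupy both of its half-edges. A free
  point therefore has at most \<open>card C + card B\<close> possible owners.\<close>

lemma labelling_free_owner:
  assumes R: "R \<in> core_graphs C W B a" and h: "labelling W B a R h"
    and s: "s \<in> points W B a" and x: "fst (h s) \<in> W - B"
  shows "fst s = Some (fst (h s))"
proof -
  define x where "x = fst (h s)"
  have bij: "bij_betw h (points W B a) (half_edges R)" using h unfolding labelling_def by auto
  have xW: "x \<in> W" "x \<notin> B" using x unfolding x_def by auto
  have pc: "pcount B a (Some x) = 2" using xW unfolding pcount_def by auto
  let ?P = "Pair (Some x) ` {..<2::nat}"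
  have PS: "?P \<subseteq> points W B a" using xW pc unfolding points_def pidx_def by auto
  have sub: "h ` ?P \<subseteq> Pair x ` nbrs R x"
  proof
    fix q assume "q \<in> h ` ?P"
    then obtain i where i: "i < 2" "q = h (Some x, i)" by auto
    have "(Some x, i) \<in> points W B a" using i PS by auto
    then have "q \<in> half_edges R" using bij i(2) unfolding bij_betw_def by auto
    moreover have "fst q = x" using h xW i pc unfolding labelling_def by auto
    ultimately show "q \<in> Pair x ` nbrs R x" unfolding half_edges_def nbrs_def by (cases q) auto
  qed
  have "card (h ` ?P) = card ?P" using bij PS unfolding bij_betw_def by (intro card_image) (auto intro: inj_on_subset)
  also have "\<dots> = 2" by (simp add: card_image inj_on_def)
  finally have "card (h ` ?P) = card (Pair x ` nbrs R x)"
    using core_deg2[OF R, of x] xW by (simp add: card_image inj_on_def)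
  then have eq: "h ` ?P = Pair x ` nbrs R x"
    using sub core_finite_nbrs[OF R, of x] by (intro card_subset_eq) auto
  have "h s \<in> half_edges R" using bij s unfolding bij_betw_def by auto
  then have "h s \<in> Pair x ` nbrs R x" unfolding x_def half_edges_def nbrs_def by (cases "h s") auto
  then have "h s \<in> h ` ?P" using eq by simp
  then obtain t where t: "t \<in> ?P" "h s = h t" by auto
  then have "s = t" using bij s PS unfolding bij_betw_def inj_on_def by blast
  moreover have "fst t = Some x" using t(1) by auto
  ultimately show ?thesis unfolding x_def by simp
qed

text \<open>Partners are the points whose half-edges \<open>(x, y)\<close> and \<open>(y, x)\<close>
  are the two halves of one edge.\<close>

definition lab_pairing :: "nat set set \<Rightarrow> (nat option \<times> nat \<Rightarrow> nat \<times> nat) \<Rightarrow> nat option \<times> nat \<Rightarrow> nat option \<times> nat" where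
  "lab_pairing R h = restrict (\<lambda>s. inv_into (points W B a) h (prod.swap (h s))) (points W B a)"

definition lab_owner :: "(nat option \<times> nat \<Rightarrow> nat \<times> nat) \<Rightarrow> nat \<Rightarrow> nat" where
  "lab_owner h = restrict (\<lambda>i. fst (h (None, i))) {..<a}"

definition blocks :: "(nat option \<times> nat) set set" where
  "blocks = (\<lambda>x. {(Some x, 0), (Some x, 1)}) ` (W - B)"

lemma lab_pairing:
  assumes R: "R \<in> core_graphs C W B a" and h: "labelling W B a R h" and s: "s \<in> points W B a"
  shows "lab_pairing R h s \<in> points W B a" "h (lab_pairing R h s) = prod.swap (h s)"
proof -
  have bij: "bij_betw h (points W B a) (half_edges R)" using h unfolding labelling_def by auto
  have "h s \<in> half_edges R" using bij s unfolding bij_betw_def by auto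
  then have "prod.swap (h s) \<in> half_edges R" unfolding half_edges_def by (cases "h s") (auto simp: insert_commute)
  then have "prod.swap (h s) \<in> h ` points W B a" using bij unfolding bij_betw_def by simp
  then show "lab_pairing R h s \<in> points W B a" "h (lab_pairing R h s) = prod.swap (h s)"
    using s inv_into_into[of "prod.swap (h s)" h "points W B a"] f_inv_into_f[of "prod.swap (h s)" h "points W B a"]
    unfolding lab_pairing_def by auto
qed

lemma lab_pairing_pairings:
  assumes R: "R \<in> core_graphs C W B a" and h: "labelling W B a R h"
  shows "lab_pairing R h \<in> pairings (points W B a)"
proof -
  have bij: "bij_betw h (points W B a) (half_edges R)" using h unfolding labelling_def by auto
  note lp = lab_pairing[OF R h]
  have "lab_pairing R h \<in> points W B a \<rightarrow>\<^sub>E points W B a"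
    by (rule PiE_I) (use lp(1) in blast, simp add: lab_pairing_def)
  moreover have "lab_pairing R h s \<noteq> s \<and> lab_pairing R h (lab_pairing R h s) = s" if s: "s \<in> points W B a" for s
  proof
    have hs: "h s \<in> half_edges R" using bij s unfolding bij_betw_def by auto
    show "lab_pairing R h s \<noteq> s"
    proof
      assume "lab_pairing R h s = s"
      then have "h s = prod.swap (h s)" using lp(2)[OF s] by simp
      then have "fst (h s) = fst (prod.swap (h s))" by (rule arg_cong)
      then have "fst (h s) = snd (h s)" by simp
      then have "{fst (h s)} \<in> R" using hs unfolding half_edges_def by (cases "h s") auto
      from core_edge2[OF R this] show False by simp
    qed
    have "h (lab_pairing R h (lab_pairing R h s)) = h s" using lp(2)[OF lp(1)[OF s]] lp(2)[OF s] by simp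
    then show "lab_pairing R h (lab_pairing R h s) = s"
      using bij lp(1)[OF lp(1)[OF s]] s unfolding bij_betw_def inj_on_def by blast
  qed
  ultimately show ?thesis unfolding pairings_def by simp
qed

text \<open>A closed family of blocks would give a nonempty set of degree-two vertices with no edge
  leaving it, contrary to \<open>core_open\<close>.\<close>

lemma lab_pairing_good:
  assumes R: "R \<in> core_graphs C W B a" and h: "labelling W B a R h"
  shows "lab_pairing R h \<in> good_pairings (points W B a) blocks"
proof -
  have bij: "bij_betw h (points W B a) (half_edges R)" using h unfolding labelling_def by auto
  note lp = lab_pairing[OF R h]
  have "\<not> lab_pairing R h ` \<Union>D' \<subseteq> \<Union>D'" if D': "D' \<subseteq> blocks" "D' \<noteq> {}" for D'
  proof
    assume cl: "lab_pairing R h ` \<Union>D' \<subseteq> \<Union>D'"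
    define X where "X = {x \<in> W - B. {(Some x, 0), (Some x, 1)} \<in> D'}"
    have XW: "X \<subseteq> W - B" unfolding X_def by auto
    have D'X: "\<exists>x\<in>X. d = {(Some x, 0), (Some x, 1)}" if "d \<in> D'" for d
    proof -
      obtain x where "x \<in> W - B" "d = {(Some x, 0), (Some x, 1)}" using D'(1) \<open>d \<in> D'\<close> unfolding blocks_def by blast
      then show ?thesis using \<open>d \<in> D'\<close> unfolding X_def by blast
    qed
    have "X \<noteq> {}" using D'(2) D'X by blast
    then obtain x y where xy: "x \<in> X" "y \<notin> X" "{x, y} \<in> R" using core_open[OF R XW] by blast
    have "(x, y) \<in> half_edges R" using xy unfolding half_edges_def by simp
    then obtain s where s: "s \<in> points W B a" "h s = (x, y)" using bij unfolding bij_betw_def by (metis imageE)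
    have "fst s = Some x" using labelling_free_owner[OF R h s(1)] s xy XW by auto
    moreover have "snd s < 2" using s(1) calculation xy XW unfolding points_def pcount_def by auto
    ultimately have "s = (Some x, 0) \<or> s = (Some x, 1)" by (cases s) auto
    then have "s \<in> \<Union>D'" using xy(1) unfolding X_def by blast
    then have "lab_pairing R h s \<in> \<Union>D'" using cl by blast
    then obtain d where "d \<in> D'" "lab_pairing R h s \<in> d" by blast
    then obtain x' where "x' \<in> X" "lab_pairing R h s \<in> {(Some x', 0), (Some x', 1)}" using D'X[of d] by blast
    then obtain i where x': "x' \<in> X" "lab_pairing R h s = (Some x', i)" "i < 2" by fastforce
    have "pcount B a (Some x') = 2" using x' XW unfolding pcount_def by auto
    then have "fst (h (Some x', i)) = x'" using h x' XW unfolding labelling_def by auto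
    then have "x' = y" using lp(2)[OF s(1)] s(2) x'(2) by simp
    then show False using xy x' by simp
  qed
  then show ?thesis using lab_pairing_pairings[OF R h] unfolding good_pairings_def by simp
qed

lemma lab_owner_in:
  assumes R: "R \<in> core_graphs C W B a" and h: "labelling W B a R h"
  shows "lab_owner h \<in> {..<a} \<rightarrow>\<^sub>E (C \<union> B)"
proof (rule PiE_I)
  fix i assume i: "i \<in> {..<a}"
  have bij: "bij_betw h (points W B a) (half_edges R)" using h unfolding labelling_def by auto
  have s: "(None, i) \<in> points W B a" using i unfolding points_def pidx_def pcount_def by auto
  have "h (None, i) \<in> half_edges R" using bij s unfolding bij_betw_def by auto
  then have "fst (h (None, i)) \<in> C \<union> W" using core_edge[OF R, of "{fst (h (None, i)), snd (h (None, i))}"]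
    unfolding half_edges_def by (cases "h (None, i)") simp
  moreover have "fst (h (None, i)) \<notin> W - B" using labelling_free_owner[OF R h s] by auto
  ultimately show "lab_owner h i \<in> C \<union> B" using i unfolding lab_owner_def by auto
qed (simp add: lab_owner_def)

text \<open>The owner of each point is known, from its label or from \<open>lab_owner\<close>, and
  the far end of its half-edge is the owner of its partner.\<close>

lemma labelling_recover:
  assumes R: "R \<in> core_graphs C W B a" "R' \<in> core_graphs C W B a"
    and h: "labelling W B a R h" "labelling W B a R' h'"
    and eq: "lab_owner h = lab_owner h'" "lab_pairing R h = lab_pairing R' h'"
    and s: "s \<in> points W B a"
  shows "h s = h' s"
proof -
  have own: "fst (h t) = fst (h' t)" if t: "t \<in> points W B a" for t
  proof (cases "fst t")
    case None
    then have i: "t = (None, snd t)" "snd t < a" using t unfolding points_def pcount_def by auto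
    then show ?thesis using fun_cong[OF eq(1), of "snd t"] unfolding lab_owner_def by auto
  next
    case (Some x)
    then have "t = (Some x, snd t)" "x \<in> W" "snd t < pcount B a (Some x)"
      using t unfolding points_def pidx_def by auto
    then show ?thesis using h unfolding labelling_def by metis
  qed
  have "snd (h s) = fst (h (lab_pairing R h s))" using lab_pairing(2)[OF R(1) h(1) s] by simp
  also have "\<dots> = fst (h' (lab_pairing R' h' s))"
    using own[OF lab_pairing(1)[OF R(1) h(1) s]] eq(2) by simp
  also have "\<dots> = snd (h' s)" using lab_pairing(2)[OF R(2) h(2) s] by simp
  finally show ?thesis using own[OF s] by (rule prod_eqI[rotated])
qed

text \<open>Pairs of a graph and a family of fibre permutations are encoded injectively by the
  owners of the free points together with a good pairing of all points.\<close>

lemma card_core_graphs: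
  assumes m: "3 * card B + a = 2 * m"
  shows "card (core_graphs C W B a) * (fact a * 2 ^ card (W - B) * 6 ^ card B) \<le>
    (card C + card B) ^ a * ((\<Prod>i<card (W - B). 2 * (m + i)) * (\<Prod>i<m. 2 * i + 1))"
proof -
  let ?T = "({..<a} \<rightarrow>\<^sub>E (C \<union> B)) \<times> good_pairings (points W B a) blocks"
  let ?\<Phi> = "\<lambda>(R, f). (lab_owner (lab R f), lab_pairing R (lab R f))"
  have fB: "finite B" using BW fin finite_subset by blast
  have fT: "finite ?T"
    using fin fB finite_pairings[OF finite_points[OF fin(2)]] unfolding good_pairings_def
    by (auto intro: finite_PiE)
  have finp: "finite lab_perms" unfolding lab_perms_def
    using fin(2) by (intro finite_PiE) (auto simp: pidx_def finite_permutations)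
  have "card (core_graphs C W B a \<times> lab_perms) \<le> card ?T"
  proof (rule card_inj_on_le[of ?\<Phi>])
    show "inj_on ?\<Phi> (core_graphs C W B a \<times> lab_perms)"
    proof (rule inj_onI)
      fix p q assume p: "p \<in> core_graphs C W B a \<times> lab_perms" and q: "q \<in> core_graphs C W B a \<times> lab_perms"
        and e: "?\<Phi> p = ?\<Phi> q"
      obtain R f R' f' where pq: "p = (R, f)" "q = (R', f')" by (metis prod.exhaust)
      have R: "R \<in> core_graphs C W B a" "R' \<in> core_graphs C W B a" and f: "f \<in> lab_perms" "f' \<in> lab_perms"
        using p q pq by auto
      have e': "lab_owner (lab R f) = lab_owner (lab R' f')" "lab_pairing R (lab R f) = lab_pairing R' (lab R' f')"
        using e unfolding pq by auto
      note l = labelling_lab[OF R(1) f(1)] labelling_lab[OF R(2) f(2)]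
      have same: "lab R f s = lab R' f' s" if "s \<in> points W B a" for s
        by (rule labelling_recover[OF R l e' that])
      have "half_edges R = lab R f ` points W B a" using l(1) unfolding labelling_def bij_betw_def by simp
      also have "\<dots> = lab R' f' ` points W B a" using same by (intro image_cong) auto
      also have "\<dots> = half_edges R'" using l(2) unfolding labelling_def bij_betw_def by simp
      finally have he: "half_edges R = half_edges R'" .
      have RR: "R = R'"
      proof -
        have "R = (\<lambda>(x, y). {x, y}) ` half_edges R" by (rule edges_from_half_edges) (rule core_edge2[OF R(1)])
        also have "\<dots> = (\<lambda>(x, y). {x, y}) ` half_edges R'" by (simp only: he)
        also have "\<dots> = R'" by (rule edges_from_half_edges[symmetric]) (rule core_edge2[OF R(2)])
        finally show ?thesis .
      qed
      then have "f = f'" using lab_inj[OF R(1) f] same by simp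
      then show "p = q" using pq RR by simp
    qed
    show "?\<Phi> ` (core_graphs C W B a \<times> lab_perms) \<subseteq> ?T"
    proof (rule image_subsetI)
      fix p assume p: "p \<in> core_graphs C W B a \<times> lab_perms"
      obtain R f where pq: "p = (R, f)" by (metis prod.exhaust)
      have R: "R \<in> core_graphs C W B a" and f: "f \<in> lab_perms" using p pq by auto
      note l = labelling_lab[OF R f]
      show "?\<Phi> p \<in> ?T" unfolding pq using lab_owner_in[OF R l] lab_pairing_good[OF R l] by simp
    qed
  qed (rule fT)
  moreover have "card lab_perms = fact a * 2 ^ card (W - B) * 6 ^ card B"
  proof -
    have "card lab_perms = (\<Prod>z\<in>pidx W. card {\<pi>. \<pi> permutes {..<pcount B a z}})"
      unfolding lab_perms_def using fin(2) by (intro card_PiE) (auto simp: pidx_def)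
    also have "\<dots> = (\<Prod>z\<in>pidx W. fact (pcount B a z))"
      by (intro prod.cong refl card_permutations) auto
    also have "\<dots> = fact a * fact 2 ^ card (W - B) * fact 3 ^ card B"
      by (rule pidx_prod[OF fin(2) BW])
    finally show ?thesis by (simp add: eval_nat_numeral)
  qed
  moreover have "card ?T \<le> (card C + card B) ^ a * ((\<Prod>i<card (W - B). 2 * (m + i)) * (\<Prod>i<m. 2 * i + 1))"
  proof -
    have "C \<inter> B = {}" using disj BW by auto
    then have c: "card ({..<a} \<rightarrow>\<^sub>E (C \<union> B)) = (card C + card B) ^ a"
      using fin fB by (simp add: card_PiE card_Un_disjoint)
    have bl: "card blocks = card (W - B)"
      unfolding blocks_def by (intro card_image) (auto simp: inj_on_def doubleton_eq_iff)
    have "card (good_pairings (points W B a) blocks) \<le> (\<Prod>i<card blocks. 2 * (m + i)) * (\<Prod>i<m. 2 * i + 1)"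
    proof (rule card_good_pairings)
      show "finite blocks" unfolding blocks_def using fin by auto
      show "finite (points W B a)" using finite_points fin by auto
      show "\<Union>blocks \<subseteq> points W B a" unfolding blocks_def points_def pidx_def pcount_def by auto
      show "card d = 2" if "d \<in> blocks" for d using that unfolding blocks_def by auto
      show "d \<inter> d' = {}" if "d \<in> blocks" "d' \<in> blocks" "d \<noteq> d'" for d d' using that unfolding blocks_def by auto
      show "card (points W B a) = 2 * (card blocks + m)" using card_points[OF fin(2) BW] m bl by simp
    qed
    then show ?thesis unfolding bl card_cartesian_product c by (rule mult_le_mono2)
  qed
  ultimately show ?thesis by (simp add: card_cartesian_product)
qed

end

subsection \<open>The core of a component containing a cycle\<close>

text \<open>The empty list has no cycle edges, so \<open>l = 0\<close> can stand for a core without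
  a marked cycle.\<close>

definition cycle_edges :: "nat list \<Rightarrow> nat set set" where
  "cycle_edges vs = (\<lambda>i. {vs ! i, vs ! ((i + 1) mod length vs)}) ` {..<length vs}"

lemma cycle_edgeI: "i < length vs \<Longrightarrow> {vs ! i, vs ! ((i + 1) mod length vs)} \<in> cycle_edges vs"
  unfolding cycle_edges_def by blast

lemma rooted_forest_not_inside: "rooted_forest U J F \<Longrightarrow> e \<in> F \<Longrightarrow> \<not> e \<subseteq> U"
proof (induction arbitrary: e rule: rooted_forest.induct)
  case (step U u S J F)
  have u: "u \<in> U" using step by simp
  have uS: "u \<notin> S" "u \<notin> J" using u step.hyps(4,5) by auto
  from step.prems consider x where "x \<in> S" "e = {u, x}" | "e \<in> F" by blast
  then show ?case
  proof cases
    case 1 then show ?thesis using step.hyps(4,5) by blast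
  next
    case 2
    have "e \<subseteq> U - {u} \<union> S \<union> (J - S)" using rooted_forest_edges[OF step.hyps(6) 2] .
    then have "u \<notin> e" using uS by blast
    then show ?thesis using step.IH[OF 2] by blast
  qed
qed simp

text \<open>The predecessor of index \<open>i\<close> is written as
  \<open>i + (length vs - 1)\<close> modulo the length, which also covers \<open>i = 0\<close>.
  Length at least 3 keeps the two neighbours apart.\<close>

lemma cycle_nbrs:
  assumes d: "distinct vs" and l: "3 \<le> length vs" and i: "i < length vs"
  defines "y \<equiv> vs ! ((i + 1) mod length vs)" and "z \<equiv> vs ! ((i + (length vs - 1)) mod length vs)"
  shows "y \<in> set vs" "z \<in> set vs" "y \<noteq> z" "{vs ! i, y} \<in> cycle_edges vs" "{vs ! i, z} \<in> cycle_edges vs"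
proof -
  let ?l = "length vs"
  have l0: "?l > 0" using l by linarith
  have j: "(i + 1) mod ?l < ?l" "(i + (?l - 1)) mod ?l < ?l" using l0 by auto
  show "y \<in> set vs" "z \<in> set vs" using j unfolding y_def z_def by auto
  have ne: "(i + 1) mod ?l \<noteq> (i + (?l - 1)) mod ?l"
  proof (cases "i = 0")
    case True then show ?thesis using l by simp
  next
    case False
    then have "i + (?l - 1) = (i - 1) + ?l" using l0 by linarith
    then have "(i + (?l - 1)) mod ?l = (i - 1) mod ?l" by simp
    then have 1: "(i + (?l - 1)) mod ?l = i - 1" using i by simp
    show ?thesis
    proof (cases "i + 1 < ?l")
      case True then show ?thesis using 1 False by simp
    next
      case False
      then have "i + 1 = ?l" using i by simp
      then show ?thesis using 1 l by simp
    qed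
  qed
  show "y \<noteq> z" using ne j d unfolding y_def z_def by (simp add: nth_eq_iff_index_eq)
  show "{vs ! i, y} \<in> cycle_edges vs" unfolding cycle_edges_def y_def using i by auto
  have "((i + (?l - 1)) mod ?l + 1) mod ?l = (i + (?l - 1) + 1) mod ?l" by (simp only: mod_add_left_eq)
  also have "i + (?l - 1) + 1 = i + ?l" using l0 by simp
  also have "(i + ?l) mod ?l = i" using i by simp
  finally have "{z, vs ! i} \<in> cycle_edges vs"
    unfolding cycle_edges_def z_def using j(2) by (metis (no_types, lifting) image_eqI lessThan_iff)
  then show "{vs ! i, z} \<in> cycle_edges vs" by (simp add: insert_commute)
qed

lemma card_cycle_edges:
  assumes d: "distinct vs" and l: "3 \<le> length vs"
  shows "card (cycle_edges vs) = length vs"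
proof -
  let ?l = "length vs"
  have "inj_on (\<lambda>i. {vs ! i, vs ! ((i + 1) mod ?l)}) {..<?l}"
  proof (rule inj_onI)
    fix i j assume ij: "i \<in> {..<?l}" "j \<in> {..<?l}" and e: "{vs ! i, vs ! ((i + 1) mod ?l)} = {vs ! j, vs ! ((j + 1) mod ?l)}"
    have lt: "(i + 1) mod ?l < ?l" "(j + 1) mod ?l < ?l" using ij by (auto intro!: mod_less_divisor)
    show "i = j"
    proof (rule ccontr)
      assume "i \<noteq> j"
      then have "vs ! i \<noteq> vs ! j" using ij d by (simp add: nth_eq_iff_index_eq)
      then have "vs ! i = vs ! ((j + 1) mod ?l)" "vs ! j = vs ! ((i + 1) mod ?l)" using e by (auto simp: doubleton_eq_iff)
      then have 1: "i = (j + 1) mod ?l" "j = (i + 1) mod ?l" using ij lt d by (auto simp: nth_eq_iff_index_eq)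
      show False
      proof (cases "j + 1 < ?l")
        case True
        have "i = j + 1" using 1(1) mod_less[OF True] by (rule trans)
        then have "i + 1 = j + 2" by simp
        then have "j = (j + 2) mod ?l" using 1(2) by metis
        moreover have "j + 2 < ?l \<or> j + 2 = ?l" using True by linarith
        ultimately show False
        proof (elim disjE)
          assume "j = (j + 2) mod ?l" "j + 2 < ?l"
          then show False by (simp only: mod_less)
        next
          assume a: "j = (j + 2) mod ?l" "j + 2 = ?l"
          then have "j = 0" by (simp only: mod_self)
          then show False using a(2) l by linarith
        qed
      next
        case False
        then have jl: "j + 1 = ?l" using ij by simp
        have "i = 0" using 1(1) unfolding jl by simp
        then have "j = 1 mod ?l" using 1(2) by simp
        also have "\<dots> = 1" by (rule mod_less) (use l in linarith)
        finally show False using jl l by linarith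
      qed
    qed
  qed
  then show ?thesis unfolding cycle_edges_def by (simp add: card_image)
qed

lemma cycle_edges_subset: "e \<in> cycle_edges vs \<Longrightarrow> e \<subseteq> set vs"
proof -
  assume "e \<in> cycle_edges vs"
  then obtain i where i: "i < length vs" "e = {vs ! i, vs ! ((i + 1) mod length vs)}"
    unfolding cycle_edges_def by blast
  then have "(i + 1) mod length vs < length vs" by (intro mod_less_divisor) linarith
  then show ?thesis using i by simp
qed

lemma is_cycle_edges: "is_cycle E vs \<longleftrightarrow> 3 \<le> length vs \<and> distinct vs \<and> cycle_edges vs \<subseteq> E"
  unfolding is_cycle_def cycle_edges_def by auto

lemma cycle_edges_rotate: "cycle_edges (rotate m vs) \<subseteq> cycle_edges vs"
proof
  fix e assume "e \<in> cycle_edges (rotate m vs)"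
  then obtain i where i: "i < length vs" "e = {rotate m vs ! i, rotate m vs ! ((i + 1) mod length vs)}"
    unfolding cycle_edges_def by auto
  let ?l = "length vs"
  have l0: "0 < ?l" using i by auto
  have "(m + (i + 1) mod ?l) mod ?l = (m + (i + 1)) mod ?l" by (simp only: mod_add_right_eq)
  also have "\<dots> = ((m + i) mod ?l + 1) mod ?l" by (simp only: mod_add_left_eq add.assoc)
  finally have "e = {vs ! ((m + i) mod ?l), vs ! (((m + i) mod ?l + 1) mod ?l)}"
    using i l0 by (simp add: nth_rotate)
  then show "e \<in> cycle_edges vs" unfolding cycle_edges_def using l0 by (metis (no_types, lifting) image_eqI lessThan_iff mod_less_divisor)
qed

lemma cycle_edges_rotate_eq: "m \<le> length vs \<Longrightarrow> cycle_edges (rotate m vs) = cycle_edges vs"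
proof
  assume m: "m \<le> length vs"
  have "vs = rotate (length vs - m) (rotate m vs)" using m by (simp add: rotate_rotate)
  then show "cycle_edges vs \<subseteq> cycle_edges (rotate m vs)" using cycle_edges_rotate by metis
qed (rule cycle_edges_rotate)

text \<open>\<open>U\<close> is the union of all subsets of the component \<open>K\<close> that
  induce minimum degree at least two, hence the largest of them. Maximality makes the remainder
  peelable, connectedness of \<open>K\<close> attaches every tree to \<open>U\<close>, and a cut of
  \<open>U\<close> would extend along the trees to a cut of \<open>K\<close>.\<close>

lemma core_decomposition:
  assumes E: "E \<subseteq> all_edges n" and cyc: "is_cycle E vs"
  obtains U J where "set vs \<subseteq> U" "U \<union> J \<subseteq> {1..n}" "U \<inter> J = {}"
    "\<And>x y. x \<in> U \<union> J \<Longrightarrow> {x, y} \<in> E \<Longrightarrow> y \<in> U \<union> J"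
    "\<And>x. x \<in> U \<Longrightarrow> 2 \<le> card (nbrs E x \<inter> U)"
    "rooted_forest U J {e \<in> E. e \<subseteq> U \<union> J \<and> \<not> e \<subseteq> U}"
    "\<And>X. X \<subseteq> U \<Longrightarrow> X \<noteq> {} \<Longrightarrow> X \<noteq> U \<Longrightarrow> \<exists>x\<in>X. \<exists>y\<in>U - X. {x, y} \<in> E"
    "\<And>X. vs ! 0 \<in> X \<Longrightarrow> (\<And>x y. x \<in> X \<Longrightarrow> {x, y} \<in> E \<Longrightarrow> y \<in> X) \<Longrightarrow> U \<union> J \<subseteq> X"
proof -
  have l: "3 \<le> length vs" "distinct vs" "cycle_edges vs \<subseteq> E" using cyc by (auto simp: is_cycle_edges)
  have edge: "e \<subseteq> {1..n}" "card e = 2" if "e \<in> E" for e using E that unfolding all_edges_eq by auto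
  have vsn: "set vs \<subseteq> {1..n}"
  proof
    fix x assume "x \<in> set vs"
    then obtain i where "i < length vs" "x = vs ! i" by (auto simp: in_set_conv_nth)
    then have "{x, vs ! ((i + 1) mod length vs)} \<in> E" using l(3) unfolding cycle_edges_def by auto
    then show "x \<in> {1..n}" using edge(1) by blast
  qed
  define r where "r = {(x, y). {x, y} \<in> E}"
  have "sym r" unfolding sym_def r_def by (auto simp: insert_commute)
  then have symr: "sym (r\<^sup>*)" by (rule sym_rtrancl)
  define K where "K = {x. (vs ! 0, x) \<in> r\<^sup>*}"
  have K0: "vs ! 0 \<in> K" unfolding K_def by simp
  have Kcl: "y \<in> K" if "x \<in> K" "{x, y} \<in> E" for x y
    using that unfolding K_def r_def by (auto intro: rtrancl_into_rtrancl)
  have reachX: "y \<in> X" if "(x, y) \<in> r\<^sup>*" "x \<in> X" "\<And>x y. x \<in> X \<Longrightarrow> {x, y} \<in> E \<Longrightarrow> y \<in> X" for X x y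
    using that(1) by (induction rule: rtrancl_induct) (use that in \<open>auto simp: r_def\<close>)
  have Kmin: "K \<subseteq> X" if "vs ! 0 \<in> X" "\<And>x y. x \<in> X \<Longrightarrow> {x, y} \<in> E \<Longrightarrow> y \<in> X" for X
  proof
    fix y assume "y \<in> K"
    then have "(vs ! 0, y) \<in> r\<^sup>*" unfolding K_def by blast
    then show "y \<in> X" by (rule reachX) (rule that, assumption?)+
  qed
  have Kn: "K \<subseteq> {1..n}"
  proof (rule Kmin)
    show "vs ! 0 \<in> {1..n}" using vsn l(1) by (meson nth_mem subsetD less_le_trans zero_less_numeral)
    show "y \<in> {1..n}" if "x \<in> {1..n}" "{x, y} \<in> E" for x y using edge(1)[OF that(2)] by simp
  qed
  have finK: "finite K" using Kn finite_subset by blast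
  have Kconn: "X = K" if X: "X \<subseteq> K" "X \<noteq> {}" "\<And>x y. x \<in> X \<Longrightarrow> {x, y} \<in> E \<Longrightarrow> y \<in> X" for X
  proof -
    obtain x where x: "x \<in> X" using X by blast
    then have "(vs ! 0, x) \<in> r\<^sup>*" using X(1) unfolding K_def by blast
    then have "(x, vs ! 0) \<in> r\<^sup>*" using symr unfolding sym_def by blast
    then have "vs ! 0 \<in> X" by (rule reachX) (rule x, rule X(3))
    then have "K \<subseteq> X" by (rule Kmin) (rule X(3))
    then show ?thesis using X(1) by blast
  qed
  have vsK: "set vs \<subseteq> K"
  proof -
    have "vs ! i \<in> K" if "i < length vs" for i
      using that
    proof (induction i)
      case 0 then show ?case using K0 by simp
    next
      case (Suc i)
      then have "{vs ! i, vs ! ((i + 1) mod length vs)} \<in> E" using l(3) cycle_edgeI[of i vs] by auto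
      moreover have "(i + 1) mod length vs = Suc i" using Suc.prems by simp
      ultimately have "{vs ! i, vs ! Suc i} \<in> E" by simp
      moreover have "vs ! i \<in> K" using Suc by simp
      ultimately show ?case using Kcl by blast
    qed
    then show ?thesis by (auto simp: in_set_conv_nth)
  qed
  define Q where "Q = {U'. U' \<subseteq> K \<and> (\<forall>x\<in>U'. 2 \<le> card (nbrs E x \<inter> U'))}"
  define U where "U = \<Union>Q"
  define J where "J = K - U"
  have UK: "U \<subseteq> K" unfolding U_def Q_def by auto
  have UJ: "U \<union> J = K" using UK unfolding J_def by auto
  have finU: "finite U" using UK finK finite_subset by blast
  have QU: "U' \<subseteq> U" if "U' \<subseteq> K" "\<And>x. x \<in> U' \<Longrightarrow> 2 \<le> card (nbrs E x \<inter> U')" for U'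
    using that unfolding U_def Q_def by auto
  have Udeg: "2 \<le> card (nbrs E x \<inter> U)" if "x \<in> U" for x
  proof -
    obtain U' where U': "U' \<in> Q" "x \<in> U'" using \<open>x \<in> U\<close> unfolding U_def by blast
    have "2 \<le> card (nbrs E x \<inter> U')" using U' unfolding Q_def by blast
    also have "\<dots> \<le> card (nbrs E x \<inter> U)" using U' finU unfolding U_def by (intro card_mono) auto
    finally show ?thesis .
  qed
  have vsU: "set vs \<subseteq> U"
  proof (rule QU[OF vsK])
    fix x assume "x \<in> set vs"
    then obtain i where i: "i < length vs" "x = vs ! i" by (auto simp: in_set_conv_nth)
    note c = cycle_nbrs[OF l(2,1) i(1)]
    show "2 \<le> card (nbrs E x \<inter> set vs)"
      by (rule two_le_card[OF _ _ c(3)]) (use c l(3) i in \<open>auto simp: nbrs_def\<close>)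
  qed
  define F where "F = {e \<in> E. e \<subseteq> U \<union> J \<and> \<not> e \<subseteq> U}"
  have forest: "rooted_forest U J F"
  proof (rule rooted_forestI)
    show "finite U" "finite J" "U \<inter> J = {}" using finU finK unfolding J_def by auto
    show "e \<subseteq> U \<union> J \<and> card e = 2 \<and> \<not> e \<subseteq> U" if "e \<in> F" for e
      using that edge(2) unfolding F_def by blast
  next
    fix J' assume J': "J' \<subseteq> J" "J' \<noteq> {}"
    show "\<exists>x\<in>J'. card {y \<in> U \<union> J'. {x, y} \<in> F} \<le> 1"
    proof (rule ccontr)
      assume "\<not> ?thesis"
      then have no: "2 \<le> card {y \<in> U \<union> J'. {x, y} \<in> F}" if "x \<in> J'" for x using that by force
      have fUJ: "finite (U \<union> J')" using finU finK J' unfolding J_def by (meson finite_Diff finite_UnI finite_subset)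
      have "U \<union> J' \<subseteq> U"
      proof (rule QU)
        show "U \<union> J' \<subseteq> K" using J' UJ by blast
        fix x assume "x \<in> U \<union> J'"
        then show "2 \<le> card (nbrs E x \<inter> (U \<union> J'))"
        proof
          assume "x \<in> U"
          have "card (nbrs E x \<inter> U) \<le> card (nbrs E x \<inter> (U \<union> J'))" using fUJ by (intro card_mono) auto
          then show ?thesis using Udeg[OF \<open>x \<in> U\<close>] by linarith
        next
          assume "x \<in> J'"
          have "card {y \<in> U \<union> J'. {x, y} \<in> F} \<le> card (nbrs E x \<inter> (U \<union> J'))"
            using fUJ by (intro card_mono) (auto simp: F_def nbrs_def)
          then show ?thesis using no[OF \<open>x \<in> J'\<close>] by linarith
        qed
      qed
      then show False using J' unfolding J_def by blast
    qed
    show "\<exists>x\<in>J'. \<exists>y\<in>U \<union> J - J'. {x, y} \<in> F"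
    proof (rule ccontr)
      assume no: "\<not> ?thesis"
      have "J' = K"
      proof (rule Kconn)
        show "J' \<subseteq> K" using J' UJ by blast
        show "J' \<noteq> {}" by (rule J')
        fix x y assume x: "x \<in> J'" "{x, y} \<in> E"
        have xJ: "x \<in> J" "x \<in> K" using x J' UJ by auto
        have "y \<in> K" using Kcl[OF xJ(2) x(2)] .
        then have "{x, y} \<in> F" using x xJ UJ unfolding F_def J_def by auto
        then show "y \<in> J'" using no x(1) \<open>y \<in> K\<close> UJ by blast
      qed
      then have "vs ! 0 \<in> J" using K0 J' by blast
      moreover have "vs ! 0 \<in> U" using vsU l(1) by (meson nth_mem subsetD less_le_trans zero_less_numeral)
      ultimately show False unfolding J_def by blast
    qed
  qed
  have conn: "\<exists>x\<in>X. \<exists>y\<in>U - X. {x, y} \<in> E" if X: "X \<subseteq> U" "X \<noteq> {}" "X \<noteq> U" for X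
  proof (rule ccontr)
    assume no: "\<not> ?thesis"
    obtain X' where X': "X' \<inter> U = X \<and> X' \<subseteq> U \<union> J \<and> (\<forall>e\<in>F. e \<subseteq> X' \<or> e \<inter> X' = {})"
      using rooted_forest_closed_extension[OF forest X(1)] ..
    have "X' = K"
    proof (rule Kconn)
      show "X' \<subseteq> K" using X' UJ by simp
      show "X' \<noteq> {}" using X' X(2) by blast
      fix x y assume x: "x \<in> X'" "{x, y} \<in> E"
      have xK: "x \<in> K" using x X' UJ by blast
      have yK: "y \<in> K" using Kcl[OF xK x(2)] .
      show "y \<in> X'"
      proof (cases "{x, y} \<subseteq> U")
        case True
        then have "x \<in> X" using x X' by blast
        then have "y \<in> X" using no x True by blast
        then show ?thesis using X' by blast
      next
        case False
        then have "{x, y} \<in> F" using x xK yK UJ unfolding F_def by blast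
        then have "{x, y} \<subseteq> X' \<or> {x, y} \<inter> X' = {}"
          by (rule bspec[OF X'[THEN conjunct2, THEN conjunct2]])
        then show ?thesis using x(1) by simp
      qed
    qed
    then show False using X' UK X(3) by blast
  qed
  show ?thesis
  proof (rule that[of U J])
    show "set vs \<subseteq> U" by (rule vsU)
    show "U \<union> J \<subseteq> {1..n}" using UJ Kn by simp
    show "U \<inter> J = {}" unfolding J_def by auto
    show "y \<in> U \<union> J" if "x \<in> U \<union> J" "{x, y} \<in> E" for x y using Kcl that UJ by simp
    show "2 \<le> card (nbrs E x \<inter> U)" if "x \<in> U" for x by (rule Udeg[OF that])
    show "rooted_forest U J {e \<in> E. e \<subseteq> U \<union> J \<and> \<not> e \<subseteq> U}" using forest unfolding F_def .
    show "\<exists>x\<in>X. \<exists>y\<in>U - X. {x, y} \<in> E" if "X \<subseteq> U" "X \<noteq> {}" "X \<noteq> U" for X by (rule conn[OF that])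
    show "U \<union> J \<subseteq> X" if "vs ! 0 \<in> X" "\<And>x y. x \<in> X \<Longrightarrow> {x, y} \<in> E \<Longrightarrow> y \<in> X" for X
      unfolding UJ by (rule Kmin) (rule that, assumption?)+
  qed
qed

subsection \<open>Certificates\<close>

text \<open>That \<open>K\<close> has no edges to its outside and carries a given edge set is a
  cylinder event over exactly these potential edges.\<close>

definition touching :: "nat \<Rightarrow> nat set \<Rightarrow> nat set set" where
  "touching n K = {e \<in> all_edges n. e \<inter> K \<noteq> {}}"

lemma card_touching:
  assumes K: "K \<subseteq> {1..n}"
  shows "real (card (touching n K)) = real (card K) * real n - real (card K) * (real (card K) + 1) / 2"
proof -
  let ?k = "card K"
  have fK: "finite K" using K finite_subset by blast
  have kn: "?k \<le> n" using card_mono[OF _ K] by simp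
  have "touching n K = all_edges n - {e. e \<subseteq> {1..n} - K \<and> card e = 2}"
    unfolding touching_def all_edges_eq by auto
  then have "card (touching n K) = card (all_edges n) - card {e. e \<subseteq> {1..n} - K \<and> card e = 2}"
    by (simp only:) (rule card_Diff_subset, auto simp: all_edges_eq)
  moreover have "card {e. e \<subseteq> {1..n} - K \<and> card e = 2} = (n - ?k) choose 2"
    using n_subsets[of "{1..n} - K" 2] fK K by (simp add: card_Diff_subset)
  moreover have "card {e. e \<subseteq> {1..n} - K \<and> card e = 2} \<le> card (all_edges n)"
    by (rule card_mono) (auto simp: all_edges_eq)
  ultimately have "real (card (touching n K)) = real (n choose 2) - real ((n - ?k) choose 2)"
    by (simp add: card_all_edges of_nat_diff)
  then show ?thesis unfolding real_choose_two using kn by (simp add: of_nat_diff field_simps)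
qed

lemma card_Sigma_le:
  assumes "finite A" "\<And>x. x \<in> A \<Longrightarrow> finite (B x) \<and> real (card (B x)) \<le> M"
  shows "finite (Sigma A B) \<and> real (card (Sigma A B)) \<le> real (card A) * M"
proof -
  have "real (card (Sigma A B)) = (\<Sum>x\<in>A. real (card (B x)))"
    using assms by (subst card_SigmaI) auto
  also have "\<dots> \<le> (\<Sum>x\<in>A. M)" using assms by (intro sum_mono) auto
  finally show ?thesis using assms by auto
qed

definition core_coeff :: "nat \<Rightarrow> nat \<Rightarrow> nat \<Rightarrow> nat \<Rightarrow> nat \<Rightarrow> real" where
  "core_coeff l w2 b a m = (real l + real b) ^ a * ((\<Prod>i<w2. 2 * (real m + real i)) * (\<Prod>i<m. 2 * real i + 1))
     / (fact a * 2 ^ w2 * 6 ^ b)"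

lemma core_coeff_nonneg: "0 \<le> core_coeff l w2 b a m"
  unfolding core_coeff_def by (intro divide_nonneg_nonneg mult_nonneg_nonneg prod_nonneg) auto

lemma card_core_graphs_real:
  assumes "finite C" "finite W" "C \<inter> W = {}" "B \<subseteq> W" "3 * card B + a = 2 * m"
  shows "real (card (core_graphs C W B a)) \<le> core_coeff (card C) (card W - card B) (card B) a m"
proof -
  have "finite B" using assms finite_subset by blast
  then have wb: "card (W - B) = card W - card B" using assms by (simp add: card_Diff_subset)
  have "real (card (core_graphs C W B a) * (fact a * 2 ^ card (W - B) * 6 ^ card B)) \<le>
    real ((card C + card B) ^ a * ((\<Prod>i<card (W - B). 2 * (m + i)) * (\<Prod>i<m. 2 * i + 1)))"
    unfolding of_nat_le_iff by (rule card_core_graphs[OF assms])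
  then have "real (card (core_graphs C W B a)) * (fact a * 2 ^ card (W - B) * 6 ^ card B) \<le>
    (real (card C) + real (card B)) ^ a * ((\<Prod>i<card (W - B). 2 * (real m + real i)) * (\<Prod>i<m. 2 * real i + 1))"
    by (simp add: of_nat_prod add.commute)
  then show ?thesis unfolding core_coeff_def wb[symmetric] by (subst pos_le_divide_eq) auto
qed

text \<open>A certificate lists a marked cycle \<open>vs\<close>, the other core vertices
  \<open>W\<close>, those of degree at least three among them, the core edges off the cycle, the
  tree vertices and the forest. Nesting the choices lets \<open>card_Sigma_le\<close> bound the
  number one layer at a time.\<close>

definition certs :: "nat \<Rightarrow> nat \<Rightarrow> nat \<Rightarrow> nat \<Rightarrow> nat \<Rightarrow> nat \<Rightarrow>
    (nat list \<times> nat set \<times> nat set \<times> nat set set \<times> nat set \<times> nat set set) set" where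
  "certs n l w b a j = (SIGMA vs:{vs. length vs = l \<and> distinct vs \<and> set vs \<subseteq> {1..n}}.
     SIGMA W:{W. W \<subseteq> {1..n} - set vs \<and> card W = w}. SIGMA B:{B. B \<subseteq> W \<and> card B = b}.
     SIGMA R:core_graphs (set vs) W B a. SIGMA J:{J. J \<subseteq> {1..n} - (set vs \<union> W) \<and> card J = j}.
     {F. rooted_forest (set vs \<union> W) J F})"

definition cert_holds :: "nat \<Rightarrow> nat list \<times> nat set \<times> nat set \<times> nat set set \<times> nat set \<times> nat set set
    \<Rightarrow> nat set set \<Rightarrow> bool" where
  "cert_holds n c E = (case c of (vs, W, B, R, J, F) \<Rightarrow>
     R \<inter> cycle_edges vs = {} \<and> E \<inter> touching n (set vs \<union> W \<union> J) = cycle_edges vs \<union> R \<union> F)"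

text \<open>The number of lists and the binomial coefficients multiply to a falling factorial of
  \<open>n\<close>; \<open>fact j\<close> and \<open>fact w\<close> cancel, and
  \<open>fact b * fact (w - b)\<close> stays in the denominator.\<close>

lemma card_certs:
  assumes kn: "l + w + j \<le> n" and m: "3 * b + a = 2 * m"
  shows "finite (certs n l w b a j) \<and> real (card (certs n l w b a j)) \<le>
    fact n / fact (n - (l + w + j)) * forest_coeff (l + w) j * (core_coeff l (w - b) b a m / (fact b * fact (w - b)))"
proof (cases "b \<le> w")
  case False
  have "certs n l w b a j = {}"
  proof -
    have "c \<notin> certs n l w b a j" for c
    proof
      assume c: "c \<in> certs n l w b a j"
      obtain vs W B X where cc: "c = (vs, W, B, X)" by (metis prod_cases4)
      have W: "W \<subseteq> {1..n} - set vs" "card W = w" "B \<subseteq> W" "card B = b"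
        using c unfolding cc certs_def by auto
      have "card B \<le> card W" using W finite_subset[OF W(1)] by (intro card_mono) auto
      then show False using W False by simp
    qed
    then show ?thesis by blast
  qed
  then show ?thesis
    by (simp add: core_coeff_nonneg forest_coeff_nonneg)
next
  case True
  let ?cf = "core_coeff l (w - b) b a m"
  let ?N = "\<lambda>vs W. {1..n} - (set vs \<union> W)"
  have lists: "finite {vs. length vs = l \<and> distinct vs \<and> set vs \<subseteq> {1..n}} \<and>
    real (card {vs. length vs = l \<and> distinct vs \<and> set vs \<subseteq> {1..n}}) = fact n / fact (n - l)"
  proof
    show "finite {vs. length vs = l \<and> distinct vs \<and> set vs \<subseteq> {1..n}}"
      by (rule finite_subset[OF _ finite_lists_length_eq[of "{1..n}" l]]) auto
    have "card {vs. length vs = l \<and> distinct vs \<and> set vs \<subseteq> {1..n}} = \<Prod>{n - l + 1..n}"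
      using card_lists_distinct_length_eq[of "{1..n}" l] kn by simp
    also have "\<dots> = fact n div fact (n - l)" using fact_div_fact[of "n - l" n] by simp
    finally show "real (card {vs. length vs = l \<and> distinct vs \<and> set vs \<subseteq> {1..n}}) = fact n / fact (n - l)"
      by (simp add: real_of_nat_div fact_dvd)
  qed
  have inner: "finite (SIGMA W:{W. W \<subseteq> {1..n} - set vs \<and> card W = w}. SIGMA B:{B. B \<subseteq> W \<and> card B = b}.
     SIGMA R:core_graphs (set vs) W B a. SIGMA J:{J. J \<subseteq> ?N vs W \<and> card J = j}. {F. rooted_forest (set vs \<union> W) J F}) \<and>
    real (card (SIGMA W:{W. W \<subseteq> {1..n} - set vs \<and> card W = w}. SIGMA B:{B. B \<subseteq> W \<and> card B = b}.
     SIGMA R:core_graphs (set vs) W B a. SIGMA J:{J. J \<subseteq> ?N vs W \<and> card J = j}. {F. rooted_forest (set vs \<union> W) J F})) \<le>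
     real ((n - l) choose w) * (real (w choose b) * (?cf * (real ((n - l - w) choose j) * (fact j * forest_coeff (l + w) j))))"
    if vs: "vs \<in> {vs. length vs = l \<and> distinct vs \<and> set vs \<subseteq> {1..n}}" for vs
  proof -
    have cv: "card (set vs) = l" using vs by (auto simp: distinct_card)
    have c1: "card ({1..n} - set vs) = n - l" using vs cv by (subst card_Diff_subset) auto
    have "real ((n - l) choose w) = real (card {W. W \<subseteq> {1..n} - set vs \<and> card W = w})"
      using n_subsets[of "{1..n} - set vs" w] c1 by simp
    moreover have "finite {W. W \<subseteq> {1..n} - set vs \<and> card W = w}" by simp
    ultimately show ?thesis
    proof (simp only:, intro card_Sigma_le)
      fix W assume W: "W \<in> {W. W \<subseteq> {1..n} - set vs \<and> card W = w}"
      then have fW: "finite W" and cW: "card W = w" using finite_subset[of W "{1..n}"] by auto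
      have "real (w choose b) = real (card {B. B \<subseteq> W \<and> card B = b})" using n_subsets[OF fW, of b] cW by simp
      moreover have "finite {B. B \<subseteq> W \<and> card B = b}" using fW by simp
      ultimately show "finite (SIGMA B:{B. B \<subseteq> W \<and> card B = b}.
         SIGMA R:core_graphs (set vs) W B a. SIGMA J:{J. J \<subseteq> ?N vs W \<and> card J = j}. {F. rooted_forest (set vs \<union> W) J F}) \<and>
        real (card (SIGMA B:{B. B \<subseteq> W \<and> card B = b}.
         SIGMA R:core_graphs (set vs) W B a. SIGMA J:{J. J \<subseteq> ?N vs W \<and> card J = j}. {F. rooted_forest (set vs \<union> W) J F})) \<le>
         real (w choose b) * (?cf * (real ((n - l - w) choose j) * (fact j * forest_coeff (l + w) j)))"
      proof (simp only:, intro card_Sigma_le)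
        fix B assume B: "B \<in> {B. B \<subseteq> W \<and> card B = b}"
        have disj: "set vs \<inter> W = {}" using W by auto
        have core: "finite (core_graphs (set vs) W B a)" "real (card (core_graphs (set vs) W B a)) \<le> ?cf"
          using finite_core_graphs[of "set vs" W B a] card_core_graphs_real[of "set vs" W B a m] fW disj B m cv cW by auto
        have cU: "card (set vs \<union> W) = l + w" using cv cW disj fW by (simp add: card_Un_disjoint)
        have cN: "card (?N vs W) = n - l - w"
        proof -
          have "card (?N vs W) = card {1..n} - card (set vs \<union> W)"
            using vs W fW by (intro card_Diff_subset) auto
          then show ?thesis using cU by simp
        qed
        have JF: "finite (SIGMA J:{J. J \<subseteq> ?N vs W \<and> card J = j}. {F. rooted_forest (set vs \<union> W) J F}) \<and>
          real (card (SIGMA J:{J. J \<subseteq> ?N vs W \<and> card J = j}. {F. rooted_forest (set vs \<union> W) J F})) \<le>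
          real (card {J. J \<subseteq> ?N vs W \<and> card J = j}) * (fact j * forest_coeff (l + w) j)"
        proof (rule card_Sigma_le)
          show "finite {J. J \<subseteq> ?N vs W \<and> card J = j}" by simp
          fix J assume J: "J \<in> {J. J \<subseteq> ?N vs W \<and> card J = j}"
          have "finite J" using J finite_subset[of J "{1..n}"] by auto
          then show "finite {F. rooted_forest (set vs \<union> W) J F} \<and>
            real (card {F. rooted_forest (set vs \<union> W) J F}) \<le> fact j * forest_coeff (l + w) j"
            using card_rooted_forests[of "set vs \<union> W" J] fW J cU by auto
        qed
        have cJ: "card {J. J \<subseteq> ?N vs W \<and> card J = j} = (n - l - w) choose j"
          using n_subsets[of "?N vs W" j] cN by simp
        have nn: "0 \<le> real ((n - l - w) choose j) * (fact j * forest_coeff (l + w) j)"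
          by (simp add: forest_coeff_nonneg)
        have "finite (SIGMA R:core_graphs (set vs) W B a. SIGMA J:{J. J \<subseteq> ?N vs W \<and> card J = j}. {F. rooted_forest (set vs \<union> W) J F}) \<and>
          real (card (SIGMA R:core_graphs (set vs) W B a. SIGMA J:{J. J \<subseteq> ?N vs W \<and> card J = j}. {F. rooted_forest (set vs \<union> W) J F}))
          \<le> real (card (core_graphs (set vs) W B a)) * (real ((n - l - w) choose j) * (fact j * forest_coeff (l + w) j))"
          by (rule card_Sigma_le[OF core(1)]) (use JF cJ in simp)
        moreover have "real (card (core_graphs (set vs) W B a)) * (real ((n - l - w) choose j) * (fact j * forest_coeff (l + w) j))
          \<le> ?cf * (real ((n - l - w) choose j) * (fact j * forest_coeff (l + w) j))"
          by (rule mult_right_mono[OF core(2) nn])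
        ultimately show "finite (SIGMA R:core_graphs (set vs) W B a. SIGMA J:{J. J \<subseteq> ?N vs W \<and> card J = j}. {F. rooted_forest (set vs \<union> W) J F}) \<and>
          real (card (SIGMA R:core_graphs (set vs) W B a. SIGMA J:{J. J \<subseteq> ?N vs W \<and> card J = j}. {F. rooted_forest (set vs \<union> W) J F}))
          \<le> ?cf * (real ((n - l - w) choose j) * (fact j * forest_coeff (l + w) j))"
          by linarith
      qed
    qed
  qed
  have "finite (certs n l w b a j) \<and> real (card (certs n l w b a j)) \<le>
    real (card {vs. length vs = l \<and> distinct vs \<and> set vs \<subseteq> {1..n}}) *
    (real ((n - l) choose w) * (real (w choose b) * (?cf * (real ((n - l - w) choose j) * (fact j * forest_coeff (l + w) j)))))"
    unfolding certs_def by (rule card_Sigma_le) (use lists inner in auto)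
  moreover have "real (card {vs. length vs = l \<and> distinct vs \<and> set vs \<subseteq> {1..n}}) *
    (real ((n - l) choose w) * (real (w choose b) * (?cf * (real ((n - l - w) choose j) * (fact j * forest_coeff (l + w) j)))))
    = fact n / fact (n - (l + w + j)) * forest_coeff (l + w) j * (?cf / (fact b * fact (w - b)))"
  proof -
    have 1: "real ((n - l) choose w) = fact (n - l) / (fact w * fact (n - l - w))"
      using kn by (intro binomial_fact) simp
    have 2: "real ((n - l - w) choose j) = fact (n - l - w) / (fact j * fact (n - (l + w + j)))"
      using kn binomial_fact[of j "n - l - w", where 'a = real] by simp
    have 3: "real (w choose b) = fact w / (fact b * fact (w - b))"
      using True by (rule binomial_fact)
    show ?thesis unfolding lists[THEN conjunct2] 1 2 3 by (simp add: mult_ac)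
  qed
  ultimately show ?thesis by simp
qed

text \<open>\<open>R\<close> has \<open>w + m - b\<close> edges, so the component has
  \<open>m - b\<close> more edges than vertices. Every other potential edge meeting the component is
  absent, at a factor of at most \<open>exp (- p)\<close> each.\<close>

lemma rprob_cert_holds:
  assumes p: "0 < p" "p \<le> 1" and l: "l = 0 \<or> 3 \<le> l" and m: "3 * b + a = 2 * m"
    and c: "c \<in> certs n l w b a j"
  shows "rprob p (all_edges n) (cert_holds n c) \<le> p ^ (l + w + j + (m - b)) *
    exp (- p * (real (l + w + j) * real n - real (l + w + j) * (real (l + w + j) + 1) / 2 - real (l + w + j + (m - b))))"
    (is "_ \<le> ?rhs")
proof -
  obtain vs W B R J F where cc: "c = (vs, W, B, R, J, F)" by (metis prod_cases6)
  have vs: "length vs = l" "distinct vs" "set vs \<subseteq> {1..n}" and W: "W \<subseteq> {1..n} - set vs" "card W = w"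
    and B: "B \<subseteq> W" "card B = b" and R: "R \<in> core_graphs (set vs) W B a"
    and J: "J \<subseteq> {1..n} - (set vs \<union> W)" "card J = j" and F: "rooted_forest (set vs \<union> W) J F"
    using c unfolding cc certs_def by auto
  let ?K = "set vs \<union> W \<union> J" and ?Fc = "cycle_edges vs \<union> R \<union> F"
  have fin: "finite W" "finite J" "finite B" using W J B finite_subset[of _ "{1..n}"] by (auto intro: finite_subset)
  have rhs0: "0 \<le> ?rhs" using p by simp
  show ?thesis
  proof (cases "R \<inter> cycle_edges vs = {} \<and> ?Fc \<subseteq> touching n ?K")
    case False
    then have "\<not> cert_holds n c E" for E unfolding cc cert_holds_def by auto
    then show ?thesis using rhs0 by simp
  next
    case True
    have disj: "set vs \<inter> W = {}" using W by auto
    have cK: "card ?K = l + w + j"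
      using vs W J fin by (subst card_Un_disjoint, simp, simp, blast)+ (auto simp: distinct_card)
    have cR: "finite R" "card R = w + m - b"
    proof -
      note fc = core_finite[OF _ fin(1) disj B(1) R] core_card[OF _ fin(1) disj B(1) R]
      show "finite R" using fc by simp
      have bw: "b \<le> w" using B W fin card_mono by blast
      have "card (W - B) = w - b" using B W fin by (simp add: card_Diff_subset)
      then show "card R = w + m - b" using fc(2) B m bw by simp
    qed
    have bm: "b \<le> m" "b \<le> w" using m B W fin card_mono[of W B] by auto
    have cyc: "finite (cycle_edges vs)" "card (cycle_edges vs) = l"
      using l vs card_cycle_edges[of vs] unfolding cycle_edges_def by auto
    have cF: "finite F" "card F = j" using rooted_forest_card[OF F fin(2)] J by auto
    have "card ?Fc = card (cycle_edges vs \<union> R) + card F"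
    proof (rule card_Un_disjoint)
      have "e \<subseteq> set vs \<union> W" if "e \<in> cycle_edges vs \<union> R" for e
        using that cycle_edges_subset[of e vs] core_edge[OF _ fin(1) disj B(1) R, of e] by auto
      then show "(cycle_edges vs \<union> R) \<inter> F = {}" using rooted_forest_not_inside[OF F] by blast
    qed (use cyc cR cF in auto)
    also have "card (cycle_edges vs \<union> R) = l + card R"
      using card_Un_disjoint[OF cyc(1) cR(1)] True cyc by (simp add: Int_commute)
    finally have cFc: "card ?Fc = l + w + j + (m - b)" using cR cF bm by simp
    have fFc: "finite ?Fc" using cyc cR cF by simp
    have KN: "?K \<subseteq> {1..n}" using vs W J by auto
    have "rprob p (all_edges n) (cert_holds n c) = rprob p (all_edges n) (\<lambda>E. E \<inter> touching n ?K = ?Fc)"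
      by (rule rexp_cong) (use True in \<open>simp add: cc cert_holds_def\<close>)
    also have "\<dots> = p ^ card ?Fc * (1 - p) ^ card (touching n ?K - ?Fc)"
      by (rule rprob_cylinder) (use True in \<open>auto simp: touching_def\<close>)
    also have "\<dots> \<le> p ^ card ?Fc * exp (- p) ^ card (touching n ?K - ?Fc)"
      using p exp_ge_add_one_self[of "- p"] by (intro mult_left_mono power_mono) auto
    also have "exp (- p) ^ card (touching n ?K - ?Fc) = exp (- p * real (card (touching n ?K - ?Fc)))"
      by (simp add: exp_of_nat_mult[symmetric] mult.commute)
    also have "real (card (touching n ?K - ?Fc)) = real (card (touching n ?K)) - real (card ?Fc)"
    proof -
      have ft: "finite (touching n ?K)" unfolding touching_def by simp
      have "?Fc \<subseteq> touching n ?K" using True by blast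
      then show ?thesis using card_Diff_subset[OF fFc] card_mono[OF ft] by (simp add: of_nat_diff)
    qed
    finally show ?thesis unfolding cFc card_touching[OF KN] cK by simp
  qed
qed

definition has_cert :: "nat \<Rightarrow> nat \<Rightarrow> nat \<Rightarrow> nat \<Rightarrow> nat \<Rightarrow> nat \<Rightarrow> nat set set \<Rightarrow> bool" where
  "has_cert n l w b a j E \<longleftrightarrow> (\<exists>c\<in>certs n l w b a j. cert_holds n c E)"

text \<open>A cycle occurs in \<open>l\<close> rotated forms, which accounts for the factor \<open>1 / l\<close>.\<close>

lemma has_cert_le_sum:
  assumes h: "has_cert n l w b a j E" and fin: "finite (certs n l w b a j)"
  shows "real (max 1 l) \<le> (\<Sum>c\<in>certs n l w b a j. of_bool (cert_holds n c E))"
proof -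
  obtain c where c: "c \<in> certs n l w b a j" "cert_holds n c E" using h unfolding has_cert_def by blast
  obtain vs X where cc: "c = (vs, X)" by (metis prod.exhaust)
  have vs: "length vs = l" "distinct vs" using c unfolding cc certs_def by auto
  define f where "f i = (rotate i vs, X)" for i
  have f1: "f i \<in> certs n l w b a j" for i using c(1) unfolding cc f_def certs_def by auto
  have f2: "cert_holds n (f i) E" if "i \<le> l" for i
    using c(2) cycle_edges_rotate_eq[of i vs] that vs unfolding cc f_def cert_holds_def by (auto split: prod.splits)
  have inj: "inj_on f {..<max 1 l}"
  proof (rule inj_onI)
    fix i i' assume i: "i \<in> {..<max 1 l}" "i' \<in> {..<max 1 l}" and e: "f i = f i'"
    show "i = i'"
    proof (cases "l = 0")
      case False
      have "rotate i vs ! 0 = rotate i' vs ! 0" using e unfolding f_def by simp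
      then have "vs ! i = vs ! i'" using i False vs by (simp add: nth_rotate)
      then show ?thesis using i False vs by (simp add: nth_eq_iff_index_eq)
    qed (use i in auto)
  qed
  have "real (max 1 l) = (\<Sum>c\<in>f ` {..<max 1 l}. 1)" using card_image[OF inj] by simp
  also have "\<dots> = (\<Sum>c\<in>f ` {..<max 1 l}. of_bool (cert_holds n c E))"
    by (rule sum.cong[OF refl]) (use f2 in \<open>auto simp: max_def split: if_splits\<close>)
  also have "\<dots> \<le> (\<Sum>c\<in>certs n l w b a j. of_bool (cert_holds n c E))"
    using fin f1 by (intro sum_mono2) auto
  finally show ?thesis .
qed

text \<open>First moment method with multiplicity: the expected number of valid certificates is at
  least \<open>max 1 l\<close> times the probability that one exists.\<close>

lemma rprob_has_cert:
  assumes p: "0 < p" "p \<le> 1" and l: "l = 0 \<or> 3 \<le> l" and m: "3 * b + a = 2 * m" and kn: "l + w + j \<le> n"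
  shows "rprob p (all_edges n) (has_cert n l w b a j) \<le> 1 / real (max 1 l) *
    (fact n / fact (n - (l + w + j)) * forest_coeff (l + w) j * (core_coeff l (w - b) b a m / (fact b * fact (w - b)))) *
    (p ^ (l + w + j + (m - b)) *
    exp (- p * (real (l + w + j) * real n - real (l + w + j) * (real (l + w + j) + 1) / 2 - real (l + w + j + (m - b)))))"
    (is "_ \<le> _ * ?N * ?P")
proof -
  note cN = card_certs[OF kn m]
  have P0: "0 \<le> ?P" using p by simp
  have "real (max 1 l) * rprob p (all_edges n) (has_cert n l w b a j)
    = rexp p (all_edges n) (\<lambda>E. real (max 1 l) * of_bool (has_cert n l w b a j E))" by (simp add: rexp_cmult)
  also have "\<dots> \<le> rexp p (all_edges n) (\<lambda>E. \<Sum>c\<in>certs n l w b a j. of_bool (cert_holds n c E))"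
  proof (rule rexp_mono)
    fix E
    show "real (max 1 l) * of_bool (has_cert n l w b a j E) \<le> (\<Sum>c\<in>certs n l w b a j. of_bool (cert_holds n c E))"
    proof (cases "has_cert n l w b a j E")
      case True
      then show ?thesis using has_cert_le_sum[OF True] cN by simp
    qed (simp add: sum_nonneg)
  qed (use p in auto)
  also have "\<dots> = (\<Sum>c\<in>certs n l w b a j. rprob p (all_edges n) (cert_holds n c))" by (rule rexp_sum)
  also have "\<dots> \<le> (\<Sum>c\<in>certs n l w b a j. ?P)" by (rule sum_mono, rule rprob_cert_holds[OF p l m])
  also have "\<dots> = real (card (certs n l w b a j)) * ?P" by simp
  also have "\<dots> \<le> ?N * ?P" using cN P0 by (intro mult_right_mono) auto
  finally have "real (max 1 l) * rprob p (all_edges n) (has_cert n l w b a j) \<le> ?N * ?P" .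
  moreover have "real (max 1 l) > 0" by simp
  ultimately show ?thesis by (simp only: pos_le_divide_eq[symmetric] mult.commute[of "real (max 1 l)"])
     (simp add: field_simps)
qed

text \<open>For \<open>m = 0\<close> no edge of \<open>R\<close> reaches the cycle and all vertices
  of \<open>W\<close> have degree two, so a nonempty \<open>W\<close> would be closed. In the
  enumeration this appears as the factor \<open>i = 0\<close> of the product.\<close>

lemma has_cert_tree_like:
  assumes "has_cert n l w 0 0 j E"
  shows "w = 0"
proof (rule ccontr)
  assume w: "w \<noteq> 0"
  obtain c where "c \<in> certs n l w 0 0 j" using assms unfolding has_cert_def by blast
  moreover obtain vs W B R X where "c = (vs, W, B, R, X)" by (metis prod_cases5)
  ultimately have W: "W \<subseteq> {1..n} - set vs" "card W = w" "B \<subseteq> W" "card B = 0"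
    and R: "R \<in> core_graphs (set vs) W B 0" unfolding certs_def by auto
  have fW: "finite W" using finite_subset[OF W(1)] by simp
  then have B0: "B = {}" using W(3,4) finite_subset by fastforce
  have d: "set vs \<inter> W = {}" using W by auto
  have "card (core_graphs (set vs) W B 0) * (fact 0 * 2 ^ card (W - B) * 6 ^ card B) \<le>
    (card (set vs) + card B) ^ 0 * ((\<Prod>i<card (W - B). 2 * (0 + i)) * (\<Prod>i<0. 2 * i + 1))"
    using W by (intro card_core_graphs[OF _ fW d W(3)]) auto
  also have "(\<Prod>i<card (W - B). 2 * (0 + i)) = 0"
    using w W(2) B0 by (intro prod_zero) auto
  finally have "card (core_graphs (set vs) W B 0) = 0" by simp
  then show False using R finite_core_graphs[OF _ fW d W(3), of 0] by auto
qed

text \<open>One core is described twice, with its cycle marked and unmarked. The unmarked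
  description is available only if some core vertex has degree at least three; otherwise the core is
  the cycle itself. The edge counts are recorded because sparsity of the core will bound
  \<open>m\<close>, and \<open>survives\<close> ties the size of the component to the
  exploration.\<close>

lemma cycle_certificate:
  assumes E: "E \<subseteq> all_edges n" and cyc: "is_cycle E vs"
  obtains U j where "U \<subseteq> {1..n}" "card U + j \<le> n" "length vs \<le> card U"
    "\<And>t. survives E {vs ! 0} ({1..n} - {vs ! 0}) t \<or> card U + j < t" "vs ! 0 \<in> {1..n}"
    "\<exists>b a m. 3 * b + a = 2 * m \<and> has_cert n (length vs) (card U - length vs) b a j E \<and>
      card {e \<in> E. e \<subseteq> U} = card U + (m - b)"
    "(\<exists>b a m. 3 * b + a = 2 * m \<and> 1 \<le> m \<and> has_cert n 0 (card U) b a j E \<and>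
      card {e \<in> E. e \<subseteq> U} = card U + (m - b)) \<or> card U = length vs \<and> has_cert n (length vs) 0 0 0 j E"
proof (rule core_decomposition[OF E cyc])
  fix U J assume vsU: "set vs \<subseteq> U" and UJn: "U \<union> J \<subseteq> {1..n}" and UJ: "U \<inter> J = {}"
    and closed: "\<And>x y. x \<in> U \<union> J \<Longrightarrow> {x, y} \<in> E \<Longrightarrow> y \<in> U \<union> J"
    and deg: "\<And>x. x \<in> U \<Longrightarrow> 2 \<le> card (nbrs E x \<inter> U)"
    and forest: "rooted_forest U J {e \<in> E. e \<subseteq> U \<union> J \<and> \<not> e \<subseteq> U}"
    and conn: "\<And>X. X \<subseteq> U \<Longrightarrow> X \<noteq> {} \<Longrightarrow> X \<noteq> U \<Longrightarrow> \<exists>x\<in>X. \<exists>y\<in>U - X. {x, y} \<in> E"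
    and least: "\<And>X. vs ! 0 \<in> X \<Longrightarrow> (\<And>x y. x \<in> X \<Longrightarrow> {x, y} \<in> E \<Longrightarrow> y \<in> X) \<Longrightarrow> U \<union> J \<subseteq> X"
  have l: "3 \<le> length vs" "distinct vs" "cycle_edges vs \<subseteq> E" using cyc by (auto simp: is_cycle_edges)
  have edge: "e \<subseteq> {1..n}" "card e = 2" if "e \<in> E" for e using E that unfolding all_edges_eq by auto
  have fin: "finite U" "finite J" using finite_subset[OF UJn] by auto
  have finE: "finite E" using E finite_subset by (metis finite_all_edges)
  define EU where "EU = {e \<in> E. e \<subseteq> U}"
  have nEU: "nbrs EU x = nbrs E x \<inter> U" if "x \<in> U" for x
    using that unfolding nbrs_def EU_def by auto
  have sumEU: "2 * card EU = (\<Sum>x\<in>U. card (nbrs E x \<inter> U))"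
  proof -
    have "2 * card EU = card (half_edges EU)"
      using card_half_edges[of EU] finE edge unfolding EU_def by auto
    also have "half_edges EU = (SIGMA x:U. nbrs EU x)" by (rule half_edges_eq_Sigma) (auto simp: EU_def)
    also have "card \<dots> = (\<Sum>x\<in>U. card (nbrs EU x))"
      using fin nEU by (intro card_SigmaI) auto
    also have "\<dots> = (\<Sum>x\<in>U. card (nbrs E x \<inter> U))" using nEU by (intro sum.cong) auto
    finally show ?thesis .
  qed
  \<comment> \<open>This is applied to \<open>us = vs\<close> and to \<open>us = []\<close>. The
    hypothesis \<open>op\<close> excludes the case where unmarked degree-two vertices make up the
    entire core, which has no edge leaving it.\<close>
  have gen: "\<exists>b a m. 3 * b + a = 2 * m \<and> has_cert n (length us) (card (U - set us)) b a (card J) E \<and>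
      card EU = card U + (m - b) \<and> b = card {x \<in> U - set us. 3 \<le> card (nbrs E x \<inter> U)}"
    if us: "us = [] \<or> 3 \<le> length us" "distinct us" "set us \<subseteq> U" "cycle_edges us \<subseteq> E"
      and op: "\<And>X. X \<subseteq> {x \<in> U - set us. card (nbrs E x \<inter> U) = 2} \<Longrightarrow> X \<noteq> {} \<Longrightarrow> X \<noteq> U" for us
  proof -
    define W where "W = U - set us"
    define R where "R = EU - cycle_edges us"
    define B where "B = {x \<in> W. 3 \<le> card (nbrs E x \<inter> U)}"
    have WU: "W \<subseteq> U" "set us \<inter> W = {}" "set us \<union> W = U" using us unfolding W_def by auto
    have BW: "B \<subseteq> W" unfolding B_def by auto
    have fW: "finite W" "finite B" using fin BW unfolding W_def by (auto intro: finite_subset)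
    have nR: "nbrs R x = nbrs E x \<inter> U" if "x \<in> W" for x
    proof -
      have "{x, y} \<notin> cycle_edges us" for y using cycle_edges_subset[of "{x, y}" us] \<open>x \<in> W\<close> unfolding W_def by auto
      then show ?thesis using \<open>x \<in> W\<close> WU unfolding R_def EU_def nbrs_def by auto
    qed
    have d2: "card (nbrs R x) = 2" if "x \<in> W - B" for x
      using nR[of x] deg[of x] that WU unfolding B_def by force
    have d3: "3 \<le> card (nbrs R x)" if "x \<in> B" for x using nR[of x] that unfolding B_def by auto
    have Redge: "e \<subseteq> U" "card e = 2" if "e \<in> R" for e using that edge unfolding R_def EU_def by auto
    have finR: "finite R" using finE unfolding R_def EU_def by auto
    have "2 * card R = card (half_edges R)" using card_half_edges[OF finR Redge(2)] by simp
    also have "half_edges R = (SIGMA x:U. nbrs R x)" by (rule half_edges_eq_Sigma) (rule Redge)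
    also have "card \<dots> = (\<Sum>x\<in>U. card (nbrs R x))"
      using fin finite_nbrs[OF fin(1), of R] Redge by (intro card_SigmaI) auto
    finally have s1: "2 * card R = (\<Sum>x\<in>U. card (nbrs R x))" .
    have s2: "(\<Sum>x\<in>W. card (nbrs R x)) \<le> (\<Sum>x\<in>U. card (nbrs R x))" using fin WU by (intro sum_mono2) auto
    have s3: "(\<Sum>x\<in>W. card (nbrs R x)) = (\<Sum>x\<in>W - B. card (nbrs R x)) + (\<Sum>x\<in>B. card (nbrs R x))"
      using sum.subset_diff[OF BW fW(1)] by blast
    have s4: "(\<Sum>x\<in>W - B. card (nbrs R x)) = 2 * card (W - B)" using d2 by simp
    have s5: "(\<Sum>x\<in>B. 3) \<le> (\<Sum>x\<in>B. card (nbrs R x))" by (intro sum_mono d3)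
    have ge: "2 * card (W - B) + 3 * card B \<le> 2 * card R" using s1 s2 s3 s4 s5 by simp
    define a where "a = 2 * card R - (2 * card (W - B) + 3 * card B)"
    define m where "m = card R - card (W - B)"
    define b where "b = card B"
    have aR: "2 * card R = 2 * card (W - B) + 3 * card B + a" using ge unfolding a_def by simp
    have m: "3 * b + a = 2 * m" using aR unfolding b_def m_def by simp
    have core: "R \<in> core_graphs (set us) W B a"
      unfolding core_graphs_def mem_Collect_eq
    proof (intro conjI ballI allI impI)
      fix X assume X: "X \<subseteq> W - B" "X \<noteq> {}"
      have "X \<noteq> U"
      proof (rule op[OF _ X(2)])
        show "X \<subseteq> {x \<in> U - set us. card (nbrs E x \<inter> U) = 2}"
          using X(1) d2 nR unfolding W_def[symmetric] by auto
      qed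
      moreover have "X \<subseteq> U" using X WU by auto
      ultimately obtain x y where xy: "x \<in> X" "y \<in> U - X" "{x, y} \<in> E" using conn[OF _ X(2)] by blast
      have "y \<in> nbrs R x" using xy X nR[of x] unfolding nbrs_def by auto
      then show "\<exists>x\<in>X. \<exists>y. y \<notin> X \<and> {x, y} \<in> R" using xy unfolding nbrs_def by blast
    qed (use Redge WU d2 d3 aR in auto)
    define F where "F = {e \<in> E. e \<subseteq> U \<union> J \<and> \<not> e \<subseteq> U}"
    have "(us, W, B, R, J, F) \<in> certs n (length us) (card W) b a (card J)"
      unfolding certs_def using us(2,3) UJn WU BW core forest UJ
      by (auto simp: b_def F_def)
    moreover have "cert_holds n (us, W, B, R, J, F) E"
      unfolding cert_holds_def prod.case
    proof
      show "R \<inter> cycle_edges us = {}" unfolding R_def by auto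
      have ceu: "cycle_edges us \<subseteq> EU" using us(3,4) cycle_edges_subset[of _ us] unfolding EU_def by blast
      have "E \<inter> touching n (U \<union> J) = {e \<in> E. e \<subseteq> U \<union> J}"
      proof
        show "E \<inter> touching n (U \<union> J) \<subseteq> {e \<in> E. e \<subseteq> U \<union> J}"
        proof
          fix e assume e: "e \<in> E \<inter> touching n (U \<union> J)"
          obtain x y where xy: "e = {x, y}" using edge(2)[of e] e by (auto simp: card_2_iff)
          have "x \<in> U \<union> J \<or> y \<in> U \<union> J" using e xy unfolding touching_def by auto
          then have "e \<subseteq> U \<union> J" using closed[of x y] closed[of y x] e unfolding xy by (auto simp: insert_commute)
          then show "e \<in> {e \<in> E. e \<subseteq> U \<union> J}" using e by simp
        qed
        show "{e \<in> E. e \<subseteq> U \<union> J} \<subseteq> E \<inter> touching n (U \<union> J)"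
        proof
          fix e assume e: "e \<in> {e \<in> E. e \<subseteq> U \<union> J}"
          then have "e \<noteq> {}" using edge(2)[of e] by auto
          then have "e \<inter> (U \<union> J) \<noteq> {}" using e by blast
          then show "e \<in> E \<inter> touching n (U \<union> J)" unfolding touching_def using e E by blast
        qed
      qed
      also have "\<dots> = EU \<union> F" unfolding EU_def F_def by auto
      also have "EU = cycle_edges us \<union> R" using ceu unfolding R_def by auto
      finally show "E \<inter> touching n (set us \<union> W \<union> J) = cycle_edges us \<union> R \<union> F" using WU by simp
    qed
    ultimately have hc: "has_cert n (length us) (card W) b a (card J) E" unfolding has_cert_def by blast
    have cyce: "finite (cycle_edges us)" "card (cycle_edges us) = length us" "cycle_edges us \<subseteq> EU"
      using us card_cycle_edges[of us] cycle_edges_subset[of _ us] unfolding EU_def by (auto simp: cycle_edges_def)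
    have "card R = card EU - length us" unfolding R_def using cyce by (simp add: card_Diff_subset)
    moreover have "card (cycle_edges us) \<le> card EU" using cyce finE by (intro card_mono) (auto simp: EU_def)
    moreover have "card W = card U - length us" unfolding W_def using us fin by (simp add: card_Diff_subset distinct_card)
    moreover have "length us \<le> card U" using card_mono[OF fin(1) us(3)] us(2) by (simp add: distinct_card)
    moreover have "card (W - B) = card W - b" "b \<le> card W"
      using BW fW card_mono[OF fW(1) BW] unfolding b_def by (auto simp: card_Diff_subset)
    moreover have "card (W - B) \<le> card R" "b \<le> m" using ge m unfolding b_def by auto
    ultimately have "card EU = card U + (m - b)" unfolding m_def using cyce by simp
    then show ?thesis using m hc unfolding b_def B_def W_def by blast
  qed
  have lU: "length vs \<le> card U" using card_mono[OF fin(1) vsU] l(2) by (simp add: distinct_card)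
  have cW: "card (U - set vs) = card U - length vs" using vsU fin l(2) by (simp add: card_Diff_subset distinct_card)
  have v0: "vs ! 0 \<in> set vs" using l(1) by (intro nth_mem) linarith
  obtain b a m where c1: "3 * b + a = 2 * m" "has_cert n (length vs) (card U - length vs) b a (card J) E"
    "card EU = card U + (m - b)" "b = card {x \<in> U - set vs. 3 \<le> card (nbrs E x \<inter> U)}"
    using gen[of vs] l vsU v0 unfolding cW by blast
  show thesis
  proof (rule that[of U "card J"])
    show "U \<subseteq> {1..n}" using UJn by auto
    have "card U + card J = card (U \<union> J)" using card_Un_disjoint[OF fin UJ] by simp
    then show cn: "card U + card J \<le> n" using card_mono[OF _ UJn] by simp
    show "length vs \<le> card U" by (rule lU)
    show vn: "vs ! 0 \<in> {1..n}" using v0 vsU UJn by blast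
    show "survives E {vs ! 0} ({1..n} - {vs ! 0}) t \<or> card U + card J < t" for t
    proof (rule disjCI)
      assume nt: "\<not> card U + card J < t"
      show "survives E {vs ! 0} ({1..n} - {vs ! 0}) t"
      proof (rule ccontr)
        assume "\<not> survives E {vs ! 0} ({1..n} - {vs ! 0}) t"
        from survives_stops[OF this] obtain X where X: "{vs ! 0} \<subseteq> X" "X \<subseteq> {vs ! 0} \<union> ({1..n} - {vs ! 0})"
          "card X < t" "\<forall>x\<in>X. \<forall>y\<in>{1..n} - {vs ! 0}. {x, y} \<in> E \<longrightarrow> y \<in> X" by auto
        have "U \<union> J \<subseteq> X"
        proof (rule least)
          show "vs ! 0 \<in> X" using X by simp
          fix x y assume xy: "x \<in> X" "{x, y} \<in> E"
          have "y \<in> {1..n}" using edge(1)[OF xy(2)] by simp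
          then show "y \<in> X" using X(1,4) xy by (cases "y = vs ! 0") auto
        qed
        moreover have "finite X" by (rule finite_subset[OF X(2)]) simp
        ultimately have "card (U \<union> J) \<le> card X" by (intro card_mono)
        then show False using X(3) nt \<open>card U + card J = card (U \<union> J)\<close> by simp
      qed
    qed
    show "\<exists>b a m. 3 * b + a = 2 * m \<and> has_cert n (length vs) (card U - length vs) b a (card J) E \<and>
      card {e \<in> E. e \<subseteq> U} = card U + (m - b)"
      using c1 unfolding EU_def by blast
    show "(\<exists>b a m. 3 * b + a = 2 * m \<and> 1 \<le> m \<and> has_cert n 0 (card U) b a (card J) E \<and>
      card {e \<in> E. e \<subseteq> U} = card U + (m - b)) \<or> card U = length vs \<and> has_cert n (length vs) 0 0 0 (card J) E"
    proof (cases "\<exists>x\<in>U. 3 \<le> card (nbrs E x \<inter> U)")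
      case True
      have e0: "cycle_edges [] = {}" unfolding cycle_edges_def by simp
      obtain b a m where c2: "3 * b + a = 2 * m" "has_cert n 0 (card U) b a (card J) E"
        "card EU = card U + (m - b)" "b = card {x \<in> U. 3 \<le> card (nbrs E x \<inter> U)}"
      proof -
        have "\<exists>b a m. 3 * b + a = 2 * m \<and> has_cert n (length ([] :: nat list)) (card (U - set [])) b a (card J) E \<and>
          card EU = card U + (m - b) \<and> b = card {x \<in> U - set []. 3 \<le> card (nbrs E x \<inter> U)}"
        proof (rule gen)
          fix X assume X: "X \<subseteq> {x \<in> U - set []. card (nbrs E x \<inter> U) = 2}"
          show "X \<noteq> U"
          proof
            assume "X = U"
            then have "card (nbrs E x \<inter> U) = 2" if "x \<in> U" for x using X that by auto
            then show False using True by fastforce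
          qed
        qed (auto simp: e0)
        then show ?thesis using that by auto
      qed
      have "b \<noteq> 0" using c2(4) True fin by auto
      then have "1 \<le> m" using c2(1) by linarith
      then show ?thesis using c2 unfolding EU_def by blast
    next
      case False
      have d2: "card (nbrs E x \<inter> U) = 2" if "x \<in> U" for x using deg[OF that] False that by force
      have "2 * card EU = 2 * card U" unfolding sumEU using d2 by simp
      moreover have b0: "b = 0"
      proof -
        have "{x \<in> U - set vs. 3 \<le> card (nbrs E x \<inter> U)} = {}" using False by auto
        then show ?thesis unfolding c1(4) by (simp only: card.empty)
      qed
      ultimately have "m = 0" using c1(3) by simp
      then have "a = 0" using c1(1) by simp
      then have hc: "has_cert n (length vs) (card U - length vs) 0 0 (card J) E" using c1(2) b0 by simp
      then have "card U - length vs = 0" by (rule has_cert_tree_like)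
      then show ?thesis using hc lU by simp
    qed
  qed
qed

subsection \<open>First-moment bounds for certificates\<close>

lemma one_minus_le_exp_quadratic:
  fixes x :: real
  assumes "0 \<le> x" "x \<le> 1"
  shows "1 - x \<le> exp (- x - x\<^sup>2 / 2)"
proof (cases "x = 1")
  case False
  then have x: "x < 1" using assms by simp
  define f where "f t = ln (1 - t) + t + t\<^sup>2 / 2" for t :: real
  have "f x \<le> f 0"
  proof (rule DERIV_nonpos_imp_nonincreasing[OF assms(1)])
    fix t assume t: "0 \<le> t" "t \<le> x"
    then have t1: "t < 1" using x by simp
    have "(f has_real_derivative (-1 / (1 - t) + 1 + t)) (at t)"
      unfolding f_def using t1 by (auto intro!: derivative_eq_intros simp: divide_simps) algebra
    moreover have "-1 / (1 - t) + 1 + t \<le> 0" using t1 t by (simp add: divide_simps) (simp add: algebra_simps)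
    ultimately show "\<exists>y. (f has_real_derivative y) (at t) \<and> y \<le> 0" by blast
  qed
  then have "ln (1 - x) \<le> - x - x\<^sup>2 / 2" unfolding f_def by simp
  then have "exp (ln (1 - x)) \<le> exp (- x - x\<^sup>2 / 2)" by simp
  then show ?thesis using x by simp
qed simp

lemma one_plus_le_exp_cubic:
  fixes x :: real
  assumes "0 \<le> x"
  shows "1 + x \<le> exp (x - x\<^sup>2 / 2 + x ^ 3 / 3)"
proof -
  define f where "f t = t - t\<^sup>2 / 2 + t ^ 3 / 3 - ln (1 + t)" for t :: real
  have "f 0 \<le> f x"
  proof (rule DERIV_nonneg_imp_nondecreasing[OF assms(1)])
    fix t assume t: "0 \<le> t" "t \<le> x"
    have "(f has_real_derivative (1 - t + t\<^sup>2 - 1 / (1 + t))) (at t)"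
      unfolding f_def using t by (auto intro!: derivative_eq_intros simp: divide_simps) algebra
    moreover have "1 - t + t\<^sup>2 - 1 / (1 + t) = t ^ 3 / (1 + t)"
      using t by (simp add: divide_simps) (simp add: algebra_simps power2_eq_square power3_eq_cube)
    ultimately show "\<exists>y. (f has_real_derivative y) (at t) \<and> 0 \<le> y" using t by (metis divide_nonneg_nonneg add_nonneg_nonneg zero_le_one zero_le_power)
  qed
  then have "ln (1 + x) \<le> x - x\<^sup>2 / 2 + x ^ 3 / 3" unfolding f_def by simp
  then have "exp (ln (1 + x)) \<le> exp (x - x\<^sup>2 / 2 + x ^ 3 / 3)" by simp
  then show ?thesis using assms by simp
qed

lemma neg_ln_one_minus_le:
  fixes x :: real
  assumes "0 \<le> x" "x \<le> 1/2"
  shows "- ln (1 - x) \<le> x + x\<^sup>2 / 2 + x ^ 3"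
proof -
  define f where "f t = t + t\<^sup>2 / 2 + t ^ 3 + ln (1 - t)" for t :: real
  have "f 0 \<le> f x"
  proof (rule DERIV_nonneg_imp_nondecreasing[OF assms(1)])
    fix t assume t: "0 \<le> t" "t \<le> x"
    then have t1: "t \<le> 1/2" using assms by simp
    have "(f has_real_derivative (1 + t + 3 * t\<^sup>2 - 1 / (1 - t))) (at t)"
      unfolding f_def using t1 by (auto intro!: derivative_eq_intros simp: divide_simps) algebra
    moreover have "1 + t + 3 * t\<^sup>2 - 1 / (1 - t) = t\<^sup>2 * (2 - 3 * t) / (1 - t)"
      using t1 by (simp add: divide_simps) (simp add: algebra_simps power2_eq_square)
    moreover have "t\<^sup>2 * (2 - 3 * t) / (1 - t) \<ge> 0" using t1 by (intro divide_nonneg_nonneg mult_nonneg_nonneg) auto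
    ultimately show "\<exists>y. (f has_real_derivative y) (at t) \<and> 0 \<le> y" by metis
  qed
  then show ?thesis unfolding f_def by simp
qed

text \<open>The cubic term matters because relevant component sizes \<open>k\<close> are of order
  \<open>e n\<close>, where it is of order \<open>\<mu>\<close>. The constant 3/4 is 1/2 from
  \<open>k / (2 n)\<close> plus 1/4 from \<open>k\<^sup>2 / (4 n\<^sup>2)\<close>.\<close>

lemma falling_factorial_le:
  assumes "k \<le> n" "0 < n"
  shows "fact n / fact (n - k) \<le>
    real n ^ k * exp (- (real k)\<^sup>2 / (2 * real n) - (real k) ^ 3 / (6 * (real n)\<^sup>2) + 3 / 4)"
proof -
  have *: "k \<le> n \<Longrightarrow> fact n / fact (n - k) \<le> real n ^ k * exp (- (\<Sum>i<k. real i / real n + (real i / real n)\<^sup>2 / 2))"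
  proof (induction k)
    case (Suc k)
    have e: "fact (n - k) = real (n - k) * fact (n - Suc k)"
      using Suc.prems by (metis Suc_diff_Suc Suc_le_lessD fact_Suc of_nat_fact of_nat_mult)
    have "fact n / fact (n - Suc k) = real (n - k) * (fact n / fact (n - k))"
      unfolding e using Suc.prems by simp
    also have "\<dots> \<le> (real n * exp (- (real k / real n) - (real k / real n)\<^sup>2 / 2)) *
        (real n ^ k * exp (- (\<Sum>i<k. real i / real n + (real i / real n)\<^sup>2 / 2)))"
    proof (intro mult_mono)
      have "1 - real k / real n \<le> exp (- (real k / real n) - (real k / real n)\<^sup>2 / 2)"
        using Suc.prems assms by (intro one_minus_le_exp_quadratic) auto
      then have "real n * (1 - real k / real n) \<le> real n * exp (- (real k / real n) - (real k / real n)\<^sup>2 / 2)"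
        by (intro mult_left_mono) auto
      moreover have "real n * (1 - real k / real n) = real (n - k)"
        using Suc.prems assms by (simp add: field_simps of_nat_diff)
      ultimately show "real (n - k) \<le> real n * exp (- (real k / real n) - (real k / real n)\<^sup>2 / 2)" by simp
    qed (use Suc in auto)
    also have "\<dots> = real n ^ Suc k * exp (- (\<Sum>i<Suc k. real i / real n + (real i / real n)\<^sup>2 / 2))"
      by (simp add: mult_exp_exp algebra_simps)
    finally show ?case .
  qed simp
  have s1: "(\<Sum>i<k. real i) = real k * (real k - 1) / 2" by (induction k) (auto simp: field_simps)
  have s2: "(\<Sum>i<k. (real i)\<^sup>2) = (real k - 1) * real k * (2 * real k - 1) / 6"
    by (induction k) (auto simp: field_simps power2_eq_square)
  let ?n = "real n" and ?k = "real k"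
  have "(\<Sum>i<k. real i / ?n + (real i / ?n)\<^sup>2 / 2) = (\<Sum>i<k. real i) / ?n + (\<Sum>i<k. (real i)\<^sup>2) / (2 * ?n\<^sup>2)"
    by (simp add: sum.distrib sum_divide_distrib power_divide mult.commute)
  also have "\<dots> = ?k\<^sup>2 / (2 * ?n) + ?k ^ 3 / (6 * ?n\<^sup>2) - (?k / (2 * ?n) + ?k\<^sup>2 / (4 * ?n\<^sup>2) - ?k / (12 * ?n\<^sup>2))"
    unfolding s1 s2 using assms(2) by (simp add: field_simps power2_eq_square power3_eq_cube)
  finally have sum: "(\<Sum>i<k. real i / ?n + (real i / ?n)\<^sup>2 / 2) =
     ?k\<^sup>2 / (2 * ?n) + ?k ^ 3 / (6 * ?n\<^sup>2) - (?k / (2 * ?n) + ?k\<^sup>2 / (4 * ?n\<^sup>2) - ?k / (12 * ?n\<^sup>2))" .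
  have "?k / (2 * ?n) \<le> 1 / 2" using assms by (simp add: field_simps)
  moreover have "?k\<^sup>2 / (4 * ?n\<^sup>2) \<le> 1 / 4" using assms power_mono[of ?k ?n 2] by (simp add: field_simps)
  moreover have "0 \<le> ?k / (12 * ?n\<^sup>2)" by simp
  ultimately have "- (\<Sum>i<k. real i / ?n + (real i / ?n)\<^sup>2 / 2) \<le> - ?k\<^sup>2 / (2 * ?n) - ?k ^ 3 / (6 * ?n\<^sup>2) + 3 / 4"
    unfolding sum by linarith
  then have "real n ^ k * exp (- (\<Sum>i<k. real i / ?n + (real i / ?n)\<^sup>2 / 2)) \<le>
    real n ^ k * exp (- ?k\<^sup>2 / (2 * ?n) - ?k ^ 3 / (6 * ?n\<^sup>2) + 3 / 4)"
    by (intro mult_left_mono) auto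
  with *[OF assms(1)] show ?thesis by linarith
qed

section \<open>Summation over the component size\<close>

definition comp_rate :: "nat \<Rightarrow> real \<Rightarrow> real \<Rightarrow> real" where
  "comp_rate n e t = real n * ((e + t)\<^sup>2 * (2 * t - e) / 6)"

text \<open>With \<open>q = k / n\<close> the gap between the two sides is
  \<open>n * (q - e - t)\<^sup>2 * (q - e + 2 * t) / 6\<close>, so the maximum is attained at
  component size \<open>(e + t) n\<close>. The condition \<open>e \<le> 2 * t\<close> keeps the last
  factor nonnegative.\<close>

lemma comp_rate_max:
  assumes n: "0 < n" and t: "e \<le> 2 * t" and k: "0 \<le> k"
  shows "k * (t\<^sup>2 - e\<^sup>2) / 2 + e * k\<^sup>2 / (2 * real n) - k ^ 3 / (6 * (real n)\<^sup>2) \<le> comp_rate n e t"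
proof -
  define q where "q = k / real n"
  have kq: "k = q * real n" using n unfolding q_def by simp
  have q0: "0 \<le> q" using k n unfolding q_def by simp
  have "k * (t\<^sup>2 - e\<^sup>2) / 2 + e * k\<^sup>2 / (2 * real n) - k ^ 3 / (6 * (real n)\<^sup>2) =
     real n * (q * (t\<^sup>2 - e\<^sup>2) / 2 + e * q\<^sup>2 / 2 - q ^ 3 / 6)"
    unfolding kq using n by (simp add: field_simps power2_eq_square power3_eq_cube)
  also have "\<dots> \<le> real n * ((e + t)\<^sup>2 * (2 * t - e) / 6)"
  proof (rule mult_left_mono)
    have "(e + t)\<^sup>2 * (2 * t - e) / 6 - (q * (t\<^sup>2 - e\<^sup>2) / 2 + e * q\<^sup>2 / 2 - q ^ 3 / 6) =
       (q - e - t)\<^sup>2 * (q - e + 2 * t) / 6"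
      by (simp add: field_simps power2_eq_square power3_eq_cube)
    moreover have "(q - e - t)\<^sup>2 * (q - e + 2 * t) / 6 \<ge> 0" using q0 t by simp
    ultimately show "q * (t\<^sup>2 - e\<^sup>2) / 2 + e * q\<^sup>2 / 2 - q ^ 3 / 6 \<le> (e + t)\<^sup>2 * (2 * t - e) / 6" by linarith
  qed simp
  finally show ?thesis unfolding comp_rate_def .
qed

text \<open>\<open>t\<close> is a tilt, to be optimised later. Each forest vertex receives the
  weight for which the generating function condition holds with equality at
  \<open>L = 1 - t\<close>; the price is \<open>comp_rate\<close>, the worst case over all component
  sizes. The slightly larger \<open>t'\<close> absorbs the cubic remainders.\<close>

lemma component_weight_le:
  fixes e t t' p :: real
  assumes n: "0 < n" and k: "v \<le> k" "k \<le> n" and p: "p = (1 + e) / real n" and e: "0 \<le> e"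
    and t: "0 \<le> t" "t \<le> 1/2" and t': "t\<^sup>2 + 2 * t ^ 3 + e ^ 3 \<le> t'\<^sup>2" "e \<le> 2 * t'"
  shows "fact n / fact (n - k) * p ^ k * exp (- p * (real k * real n - (real k)\<^sup>2 / 2)) \<le>
    exp (3 / 4 + comp_rate n e t' - real v) * ((1 - t) * exp (- (1 - t))) ^ (k - v)"
proof -
  let ?n = "real n" and ?k = "real k" and ?v = "real v"
  define u where "u = - ln (1 - t)"
  have u: "u \<le> t + t\<^sup>2 / 2 + t ^ 3" unfolding u_def by (rule neg_ln_one_minus_le[OF t])
  have u2: "t \<le> u" unfolding u_def using ln_add_one_self_le_self2[of "- t"] t by simp
  have eu: "1 - t = exp (- u)" unfolding u_def using t by simp
  have pk: "p ^ k = (1 + e) ^ k / ?n ^ k" unfolding p by (simp add: power_divide)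
  have "(1 + e) ^ k \<le> exp (e - e\<^sup>2 / 2 + e ^ 3 / 3) ^ k"
    using e by (intro power_mono one_plus_le_exp_cubic) auto
  also have "\<dots> = exp (?k * (e - e\<^sup>2 / 2 + e ^ 3 / 3))" by (rule exp_of_nat_mult[symmetric])
  finally have ek: "(1 + e) ^ k \<le> exp (?k * (e - e\<^sup>2 / 2 + e ^ 3 / 3))" .
  have "fact n / fact (n - k) * p ^ k * exp (- p * (?k * ?n - ?k\<^sup>2 / 2)) \<le>
    (?n ^ k * exp (- ?k\<^sup>2 / (2 * ?n) - ?k ^ 3 / (6 * ?n\<^sup>2) + 3 / 4)) * (exp (?k * (e - e\<^sup>2 / 2 + e ^ 3 / 3)) / ?n ^ k)
      * exp (- p * (?k * ?n - ?k\<^sup>2 / 2))"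
    unfolding pk using ek e by (intro mult_right_mono mult_mono falling_factorial_le divide_right_mono k n) auto
  also have "\<dots> = exp (- ?k\<^sup>2 / (2 * ?n) - ?k ^ 3 / (6 * ?n\<^sup>2) + 3 / 4 + ?k * (e - e\<^sup>2 / 2 + e ^ 3 / 3)
      - p * (?k * ?n - ?k\<^sup>2 / 2))"
  proof -
    have "N * exp x * (exp y / N) * exp z = exp (x + y + z)" if "N \<noteq> 0" for N x y z :: real
      using that by (simp add: exp_add)
    from this[of "?n ^ k"] show ?thesis using n by simp
  qed
  also have "- ?k\<^sup>2 / (2 * ?n) - ?k ^ 3 / (6 * ?n\<^sup>2) + 3 / 4 + ?k * (e - e\<^sup>2 / 2 + e ^ 3 / 3)
      - p * (?k * ?n - ?k\<^sup>2 / 2) =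
      3 / 4 - ?k + ?k * (- (e\<^sup>2) / 2 + e ^ 3 / 3) + e * ?k\<^sup>2 / (2 * ?n) - ?k ^ 3 / (6 * ?n\<^sup>2)"
    unfolding p using n by (simp add: field_simps power2_eq_square power3_eq_cube)
  also have "exp \<dots> \<le> exp (3 / 4 + comp_rate n e t' - ?v + (?k - ?v) * (- u - (1 - t)))"
  proof -
    have "?k * (- (e\<^sup>2) / 2 + e ^ 3 / 3) + ?k * (u - t) \<le> ?k * (t'\<^sup>2 - e\<^sup>2) / 2"
    proof -
      have "e ^ 3 / 3 + (u - t) \<le> t'\<^sup>2 / 2" using u t'(1) e t zero_le_power[OF e, of 3] by linarith
      then have "?k * (- (e\<^sup>2) / 2 + e ^ 3 / 3 + (u - t)) \<le> ?k * ((t'\<^sup>2 - e\<^sup>2) / 2)"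
        by (intro mult_left_mono) auto
      then show ?thesis by (simp add: algebra_simps)
    qed
    moreover have "?k * (t'\<^sup>2 - e\<^sup>2) / 2 + e * ?k\<^sup>2 / (2 * ?n) - ?k ^ 3 / (6 * ?n\<^sup>2) \<le> comp_rate n e t'"
      by (rule comp_rate_max[OF n t'(2)]) simp
    moreover have "- ?v + (?k - ?v) * (- u - (1 - t)) = - ?k - ?k * (u - t) + ?v * (u - t)"
      by (simp add: algebra_simps)
    moreover have "0 \<le> ?v * (u - t)" using u2 by simp
    ultimately show ?thesis by (simp only: exp_le_cancel_iff)
  qed
  also have "\<dots> = exp (3 / 4 + comp_rate n e t' - ?v) * ((1 - t) * exp (- (1 - t))) ^ (k - v)"
  proof -
    have "((1 - t) * exp (- (1 - t))) ^ (k - v) = exp (- u - (1 - t)) ^ (k - v)"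
    proof -
      have "(1 - t) * exp (- (1 - t)) = exp (- u) * exp (- (1 - t))"
        by (rule arg_cong[where f = "\<lambda>x. x * exp (- (1 - t))"]) (rule eu)
      also have "\<dots> = exp (- u - (1 - t))" unfolding mult_exp_exp by simp
      finally show ?thesis by simp
    qed
    also have "\<dots> = exp (real (k - v) * (- u - (1 - t)))" by (rule exp_of_nat_mult[symmetric])
    finally show ?thesis using k by (simp add: exp_add of_nat_diff)
  qed
  finally show ?thesis .
qed

text \<open>The forests contribute at most \<open>exp ((1 - t) * v)\<close>, so each core vertex
  costs a factor \<open>exp (- t)\<close>. All forest sizes are covered at once and no factor for
  their number appears.\<close>

lemma forest_sum_le:
  fixes e t t' p :: real
  assumes n: "0 < n" and v: "v \<le> n" and p: "p = (1 + e) / real n" and e: "0 \<le> e"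
    and t: "0 \<le> t" "t \<le> 1/2" and t': "t\<^sup>2 + 2 * t ^ 3 + e ^ 3 \<le> t'\<^sup>2" "e \<le> 2 * t'"
  shows "(\<Sum>j\<le>n - v. fact n / fact (n - (v + j)) * forest_coeff v j * p ^ (v + j) *
      exp (- p * (real (v + j) * real n - (real (v + j))\<^sup>2 / 2))) \<le>
    exp (3 / 4 + comp_rate n e t' - real v * t)"
proof -
  let ?y = "(1 - t) * exp (- (1 - t))" and ?A = "exp (3 / 4 + comp_rate n e t' - real v)"
  have "(\<Sum>j\<le>n - v. fact n / fact (n - (v + j)) * forest_coeff v j * p ^ (v + j) *
      exp (- p * (real (v + j) * real n - (real (v + j))\<^sup>2 / 2))) \<le> (\<Sum>j\<le>n - v. ?A * (forest_coeff v j * ?y ^ j))"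
  proof (rule sum_mono)
    fix j assume j: "j \<in> {..n - v}"
    have "fact n / fact (n - (v + j)) * p ^ (v + j) * exp (- p * (real (v + j) * real n - (real (v + j))\<^sup>2 / 2))
      \<le> ?A * ?y ^ ((v + j) - v)"
      using j v by (intro component_weight_le[OF n _ _ p e t t']) auto
    then have "forest_coeff v j * (fact n / fact (n - (v + j)) * p ^ (v + j) * exp (- p * (real (v + j) * real n - (real (v + j))\<^sup>2 / 2)))
      \<le> forest_coeff v j * (?A * ?y ^ j)"
      by (intro mult_left_mono forest_coeff_nonneg) auto
    then show "fact n / fact (n - (v + j)) * forest_coeff v j * p ^ (v + j) *
      exp (- p * (real (v + j) * real n - (real (v + j))\<^sup>2 / 2)) \<le> ?A * (forest_coeff v j * ?y ^ j)"
      by (simp only: mult_ac times_divide_eq_left times_divide_eq_right)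
  qed
  also have "\<dots> = ?A * (\<Sum>j\<le>n - v. forest_coeff v j * ?y ^ j)" by (simp only: sum_distrib_left)
  also have "\<dots> \<le> ?A * exp ((1 - t) * real v)"
  proof -
    have "?y * exp (1 - t) = 1 - t" by (simp add: mult.assoc mult_exp_exp)
    then show ?thesis using t by (intro mult_left_mono forest_coeff_generating_function) auto
  qed
  also have "\<dots> = exp (3 / 4 + comp_rate n e t' - real v * t)"
    by (simp add: mult_exp_exp algebra_simps)
  finally show ?thesis .
qed

section \<open>Exponential form of the enumeration of cores\<close>

lemma pochhammer_quotient_le:
  assumes "1 \<le> m"
  shows "(\<Prod>i<w. real m + real i) / fact w \<le> (real w + real m) ^ (m - 1) / fact (m - 1)"
proof -
  have 1: "(\<Prod>i<w. real m + real i) * fact (m - 1) = fact (w + (m - 1))"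
  proof (induction w)
    case (Suc w)
    have "Suc w + (m - 1) = Suc (w + (m - 1))" by simp
    moreover have "real (Suc (w + (m - 1))) = real m + real w" using assms by simp
    ultimately show ?case using Suc by (simp only: fact_Suc prod.lessThan_Suc) (simp add: mult_ac)
  qed simp
  have 2: "fact (w + r) \<le> (fact w :: real) * (real w + real r + 1) ^ r" for r
  proof (induction r)
    case (Suc r)
    have "fact (w + Suc r) = (real w + real r + 1) * fact (w + r)" by (simp add: algebra_simps)
    also have "\<dots> \<le> (real w + real (Suc r) + 1) * (fact w * (real w + real (Suc r) + 1) ^ r)"
      using Suc power_mono[of "real w + real r + 1" "real w + real (Suc r) + 1" r]
      by (intro mult_mono order_trans[OF Suc] mult_left_mono) auto
    finally show ?case by (simp add: mult_ac)
  qed simp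
  have "(\<Prod>i<w. real m + real i) * fact (m - 1) \<le> fact w * (real w + real m) ^ (m - 1)"
    unfolding 1 using 2[of "m - 1"] assms by (simp add: add.assoc of_nat_diff)
  then show ?thesis by (simp add: field_simps)
qed

lemma odd_prod_le: "(\<Prod>i<m. 2 * real i + 1) \<le> 2 ^ m * fact m"
proof (induction m)
  case (Suc m)
  have "(\<Prod>i<Suc m. 2 * real i + 1) \<le> (2 ^ m * fact m) * (2 * (real m + 1))"
    unfolding prod.lessThan_Suc using Suc by (intro mult_mono) (auto intro!: prod_nonneg)
  then show ?case by (simp add: algebra_simps)
qed simp

text \<open>Because \<open>2 * m = a + 3 * b\<close> and \<open>2 * (m - b) = a + b\<close>, square
  roots split the bound into an \<open>a\<close>-th power over \<open>fact a\<close> and a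
  \<open>b\<close>-th power over \<open>fact b\<close>, so sums over \<open>a\<close> and
  \<open>b\<close> become exponential series. The 6 under \<open>z ^ 3\<close> comes from the
  orderings of three half-edges at a branch vertex.\<close>

lemma core_coeff_le:
  fixes g p :: real
  assumes m: "3 * b + a = 2 * m" "1 \<le> m" "real m \<le> g * real (l + w)" and g: "0 < g" and p: "0 \<le> p"
    and v: "0 < l + w"
  defines "z \<equiv> sqrt (2 * (real w + g * real (l + w)))"
  shows "core_coeff l (w - b) b a m / (fact b * fact (w - b)) * p ^ (m - b) \<le>
    1 / (g\<^sup>2 * real (l + w)) * (((1 + g) * ((real l + g * real (l + w)) * z * sqrt p)) ^ a / fact a *
      (((1 + g) ^ 3 * (z ^ 3 * sqrt p / 6)) ^ b / fact b))"
proof -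
  define y0 where "y0 = real w + g * real (l + w)"
  let ?w2 = "w - b" and ?v = "real (l + w)"
  have gv: "0 < g * ?v" using g v by (intro mult_pos_pos) (simp_all del: of_nat_add)
  have y0: "g * ?v \<le> y0" "0 < y0" using gv unfolding y0_def by auto
  have bm: "b \<le> m" using m by simp
  have 1: "(\<Prod>i<?w2. 2 * (real m + real i)) = 2 ^ ?w2 * (\<Prod>i<?w2. real m + real i)"
    by (simp only: prod.distrib prod_constant card_lessThan)
  define P where "P = (\<Prod>i<?w2. real m + real i)"
  define O1 where "O1 = (\<Prod>i<m. 2 * real i + 1)"
  have P0: "0 \<le> P" "0 \<le> O1" unfolding P_def O1_def by (auto intro!: prod_nonneg)
  have P: "P / fact ?w2 * O1 \<le> real m / y0 * (2 * y0) ^ m"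
  proof -
    have "P / fact ?w2 \<le> (real ?w2 + real m) ^ (m - 1) / fact (m - 1)"
      unfolding P_def by (rule pochhammer_quotient_le[OF m(2)])
    also have "\<dots> \<le> y0 ^ (m - 1) / fact (m - 1)"
    proof (intro divide_right_mono power_mono)
      have "real ?w2 \<le> real w" by simp
      then show "real ?w2 + real m \<le> y0" using m(3) unfolding y0_def by linarith
    qed auto
    finally have "P / fact ?w2 * O1 \<le> y0 ^ (m - 1) / fact (m - 1) * (2 ^ m * fact m)"
      using odd_prod_le[of m] P0 y0 unfolding O1_def by (intro mult_mono) auto
    also have "\<dots> = real m / y0 * (2 * y0) ^ m"
    proof -
      obtain r where r: "m = Suc r" using m(2) by (cases m) auto
      show ?thesis unfolding r using y0 by (simp add: power_mult_distrib field_simps)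
    qed
    finally show ?thesis .
  qed
  \<comment> \<open>Bernoulli's inequality trades the factor \<open>m\<close> for slightly larger
    bases, which keeps the product form.\<close>
  have mg: "real m \<le> 1 / g * (1 + g) ^ (a + 3 * b)"
  proof -
    have "1 + real (2 * m) * g \<le> (1 + g) ^ (2 * m)" using Bernoulli_inequality[of g "2 * m"] g by simp
    moreover have "real m * g \<le> 1 + real (2 * m) * g" using g by simp
    ultimately have "real m * g \<le> (1 + g) ^ (2 * m)" by linarith
    then show ?thesis using g m(1) by (simp add: field_simps add.commute)
  qed
  \<comment> \<open>Dividing by \<open>y0\<close> yields the factor \<open>1 / (l + w)\<close>
    needed when core sizes are summed.\<close>
  have my: "real m / y0 \<le> 1 / (g\<^sup>2 * ?v) * (1 + g) ^ (a + 3 * b)"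
  proof -
    have "real m / y0 \<le> (1 / g * (1 + g) ^ (a + 3 * b)) / (g * ?v)"
      using mg y0 gv g by (intro frac_le) auto
    then show ?thesis using g by (simp add: power2_eq_square field_simps)
  qed
  have z: "z\<^sup>2 = 2 * y0" "0 \<le> z" using y0 unfolding z_def y0_def by auto
  have zz: "(2 * y0) ^ m = z ^ (a + 3 * b)"
  proof -
    have "(2 * y0) ^ m = z ^ (2 * m)" unfolding z(1)[symmetric] power_mult by simp
    then show ?thesis using m(1) by (simp add: add.commute)
  qed
  have pp: "p ^ (m - b) = sqrt p ^ (a + b)"
  proof -
    have "p ^ (m - b) = (sqrt p ^ 2) ^ (m - b)" using p by simp
    also have "\<dots> = sqrt p ^ (2 * (m - b))" by (simp only: power_mult)
    also have "2 * (m - b) = a + b" using m(1) bm by simp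
    finally show ?thesis .
  qed
  have la: "(real l + real b) ^ a \<le> (real l + g * ?v) ^ a"
    using bm m(3) by (intro power_mono) auto
  have PO: "P / fact ?w2 * O1 \<le> 1 / (g\<^sup>2 * ?v) * (1 + g) ^ (a + 3 * b) * z ^ (a + 3 * b)"
    using P my zz z mult_right_mono[OF my, of "z ^ (a + 3 * b)"] by simp
  have "core_coeff l ?w2 b a m / (fact b * fact ?w2) * p ^ (m - b) =
     (real l + real b) ^ a * (P / fact ?w2 * O1) * (sqrt p ^ (a + b) / (fact a * fact b * 6 ^ b))"
    unfolding core_coeff_def 1 P_def[symmetric] O1_def[symmetric] pp by (simp add: field_simps)
  also have "\<dots> \<le> (real l + g * ?v) ^ a * (1 / (g\<^sup>2 * ?v) * (1 + g) ^ (a + 3 * b) * z ^ (a + 3 * b))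
      * (sqrt p ^ (a + b) / (fact a * fact b * 6 ^ b))"
    by (rule mult_right_mono, rule mult_mono[OF la PO]) (use P0 gv p in auto)
  also have "\<dots> = 1 / (g\<^sup>2 * ?v) * (((1 + g) * ((real l + g * ?v) * z * sqrt p)) ^ a / fact a *
      (((1 + g) ^ 3 * (z ^ 3 * sqrt p / 6)) ^ b / fact b))"
  proof -
    have e1: "x ^ (a + 3 * b) = x ^ a * (x ^ 3) ^ b" for x :: real by (simp only: power_add power_mult)
    show ?thesis unfolding e1 power_add[of "sqrt p"] power_mult_distrib power_divide by (simp add: mult_ac)
  qed
  finally show ?thesis .
qed

text \<open>The upper bound on \<open>m\<close> restricts to sparse cores, as
  \<open>core_coeff_le\<close> demands. The case \<open>m = 0\<close> forces the core to be a bare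
  cycle and is the event \<open>ev_pure_cycle\<close>.\<close>

definition ev_cert :: "nat \<Rightarrow> real \<Rightarrow> nat \<Rightarrow> nat \<Rightarrow> nat set set \<Rightarrow> bool" where
  "ev_cert n g l w E \<longleftrightarrow> (\<exists>j b a m. 3 * b + a = 2 * m \<and> 1 \<le> m \<and> real m \<le> g * real (l + w) \<and>
     l + w + j \<le> n \<and> has_cert n l w b a j E)"

definition ev_pure_cycle :: "nat \<Rightarrow> nat \<Rightarrow> nat set set \<Rightarrow> bool" where
  "ev_pure_cycle n l E \<longleftrightarrow> (\<exists>j. l + j \<le> n \<and> has_cert n l 0 0 0 j E)"

text \<open>The number of absent edges differs from \<open>k n - k\<^sup>2 / 2\<close> by at most
  \<open>k / 2 + k + (m - b)\<close>, hence by at most \<open>5 / 2 * n\<close>. With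
  \<open>p * n \<le> 2\<close> this costs the constant \<open>exp 5\<close>.\<close>

lemma rprob_has_cert_le:
  fixes e p :: real
  assumes n: "2 \<le> n" and p: "p = (1 + e) / real n" and e: "0 \<le> e" "e \<le> 1"
    and l: "l = 0 \<or> 3 \<le> l" and m: "3 * b + a = 2 * m" "m \<le> n" and kn: "l + w + j \<le> n"
  shows "rprob p (all_edges n) (has_cert n l w b a j) \<le> (1 / real (max 1 l) * exp 5) *
    ((fact n / fact (n - (l + w + j)) * forest_coeff (l + w) j * p ^ (l + w + j) *
      exp (- p * (real (l + w + j) * real n - (real (l + w + j))\<^sup>2 / 2))) *
     (core_coeff l (w - b) b a m / (fact b * fact (w - b)) * p ^ (m - b)))"
proof -
  define k where "k = l + w + j"
  define A where "A = fact n / fact (n - k) * forest_coeff (l + w) j"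
  define B where "B = core_coeff l (w - b) b a m / (fact b * fact (w - b))"
  have AB: "0 \<le> A" "0 \<le> B" unfolding A_def B_def by (auto simp: forest_coeff_nonneg core_coeff_nonneg)
  have p01: "0 < p" "p \<le> 1" "p * real n \<le> 2" using n e unfolding p by (auto simp: field_simps)
  have "rprob p (all_edges n) (has_cert n l w b a j) \<le> 1 / real (max 1 l) * (A * B) *
    (p ^ (k + (m - b)) * exp (- p * (real k * real n - real k * (real k + 1) / 2 - real (k + (m - b)))))"
    unfolding A_def B_def k_def by (rule rprob_has_cert[OF p01(1,2) l m(1) kn])
  also have "exp (- p * (real k * real n - real k * (real k + 1) / 2 - real (k + (m - b)))) =
     exp (- p * (real k * real n - (real k)\<^sup>2 / 2)) * exp (p * (real k / 2 + real (k + (m - b))))"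
    unfolding mult_exp_exp by (simp add: field_simps power2_eq_square)
  also have "1 / real (max 1 l) * (A * B) * (p ^ (k + (m - b)) *
      (exp (- p * (real k * real n - (real k)\<^sup>2 / 2)) * exp (p * (real k / 2 + real (k + (m - b)))))) \<le>
    1 / real (max 1 l) * (A * B) * (p ^ (k + (m - b)) *
      (exp (- p * (real k * real n - (real k)\<^sup>2 / 2)) * exp 5))"
  proof -
    have "real k / 2 + real (k + (m - b)) \<le> 5 / 2 * real n" 
    proof -
      have "real k \<le> real n" "real (m - b) \<le> real n" using kn m(2) unfolding k_def by auto
      then show ?thesis by simp
    qed
    then have "p * (real k / 2 + real (k + (m - b))) \<le> p * (5 / 2 * real n)" using p01 by (intro mult_left_mono) auto
    then have "p * (real k / 2 + real (k + (m - b))) \<le> 5" using p01 by linarith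
    then show ?thesis using AB p01 by (intro mult_left_mono) auto
  qed
  also have "\<dots> = (1 / real (max 1 l) * exp 5) *
    ((A * p ^ k * exp (- p * (real k * real n - (real k)\<^sup>2 / 2))) * (B * p ^ (m - b)))"
    by (simp add: power_add)
  finally show ?thesis unfolding A_def B_def k_def .
qed

text \<open>The sum over the forest size \<open>j\<close>, the number \<open>b\<close> of branch
  vertices and the surplus \<open>a\<close> factorises into a forest sum and two partial exponential
  series. The constants \<open>exp 5\<close> and \<open>exp (3 / 4)\<close> are rounded up to
  \<open>exp 6\<close>.\<close>

lemma rprob_ev_cert:
  fixes e g p t t' :: real
  assumes n: "2 \<le> n" and p: "p = (1 + e) / real n" and e: "0 \<le> e" "e \<le> 1"
    and l: "l = 0 \<or> 3 \<le> l" and v: "0 < l + w" "l + w \<le> n" and g: "0 < g" "g \<le> 1"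
    and t: "0 \<le> t" "t \<le> 1/2" and t': "t\<^sup>2 + 2 * t ^ 3 + e ^ 3 \<le> t'\<^sup>2" "e \<le> 2 * t'"
  defines "z \<equiv> sqrt (2 * (real w + g * real (l + w)))"
  shows "rprob p (all_edges n) (ev_cert n g l w) \<le> exp 6 / (real (max 1 l) * (g\<^sup>2 * real (l + w))) *
    exp (comp_rate n e t' - real (l + w) * t +
      (1 + g) * ((real l + g * real (l + w)) * z * sqrt p) + (1 + g) ^ 3 * (z ^ 3 * sqrt p / 6))"
proof -
  have p01: "0 < p" "p \<le> 1" using n e unfolding p by (auto simp: field_simps)
  define v where "v = l + w"
  define X where "X = (1 + g) * ((real l + g * real v) * z * sqrt p)"
  define Y where "Y = (1 + g) ^ 3 * (z ^ 3 * sqrt p / 6)"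
  have z0: "0 \<le> z" using g unfolding z_def by simp
  have XY: "0 \<le> X" "0 \<le> Y" using g z0 p01 unfolding X_def Y_def by auto
  define A where "A j = fact n / fact (n - (v + j)) * forest_coeff v j * p ^ (v + j) *
      exp (- p * (real (v + j) * real n - (real (v + j))\<^sup>2 / 2))" for j
  have A0: "0 \<le> A j" for j using p01 unfolding A_def by (auto simp: forest_coeff_nonneg)
  define c where "c = 1 / real (max 1 l) * exp 5 * (1 / (g\<^sup>2 * real v))"
  have c0: "0 \<le> c" unfolding c_def by simp
  define Q where "Q j b a E \<longleftrightarrow> (\<exists>m. 3 * b + a = 2 * m \<and> 1 \<le> m \<and> real m \<le> g * real v \<and>
     has_cert n l w b a j E)" for j b a E
  have mn: "m \<le> n" if "real m \<le> g * real v" for m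
  proof -
    have "g * real v \<le> 1 * real v" using g by (intro mult_right_mono) auto
    then have "real m \<le> real v" using that by linarith
    then show ?thesis using v(2) unfolding v_def by linarith
  qed
  have tm: "rprob p (all_edges n) (Q j b a) \<le> c * (A j * (X ^ a / fact a * (Y ^ b / fact b)))"
    if j: "j \<le> n - v" for j b a
  proof (cases "\<exists>m. 3 * b + a = 2 * m \<and> 1 \<le> m \<and> real m \<le> g * real v")
    case True
    then obtain m where m: "3 * b + a = 2 * m" "1 \<le> m" "real m \<le> g * real v" by blast
    have "rprob p (all_edges n) (Q j b a) \<le> rprob p (all_edges n) (has_cert n l w b a j)"
      using p01 by (intro rexp_mono) (auto simp: Q_def)
    also have "\<dots> \<le> (1 / real (max 1 l) * exp 5) *
      (A j * (core_coeff l (w - b) b a m / (fact b * fact (w - b)) * p ^ (m - b)))"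
      unfolding A_def v_def by (rule rprob_has_cert_le[OF n p e l m(1) mn[OF m(3)]]) (use j v in \<open>simp add: v_def\<close>)
    also have "\<dots> \<le> (1 / real (max 1 l) * exp 5) * (A j * (1 / (g\<^sup>2 * real v) * (X ^ a / fact a * (Y ^ b / fact b))))"
    proof (intro mult_left_mono A0)
      show "core_coeff l (w - b) b a m / (fact b * fact (w - b)) * p ^ (m - b) \<le>
        1 / (g\<^sup>2 * real v) * (X ^ a / fact a * (Y ^ b / fact b))"
        using core_coeff_le[OF m(1,2) m(3)[unfolded v_def] g(1) _ v(1), of p] p01
        unfolding X_def Y_def z_def v_def by simp
    qed auto
    finally show ?thesis unfolding c_def by (simp only: mult_ac)
  next
    case False
    then have "\<not> Q j b a E" for E unfolding Q_def by blast
    then show ?thesis using c0 A0[of j] XY by simp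
  qed
  have "rprob p (all_edges n) (ev_cert n g l w) \<le>
     (\<Sum>i\<in>{..n - v} \<times> {..n} \<times> {..2 * n}. rprob p (all_edges n) (Q (fst i) (fst (snd i)) (snd (snd i))))"
  proof (rule rprob_le_sum)
    fix E assume "ev_cert n g l w E"
    then obtain j b a m where h: "3 * b + a = 2 * m" "1 \<le> m" "real m \<le> g * real v" "v + j \<le> n"
      "has_cert n l w b a j E" unfolding ev_cert_def v_def by blast
    have "Q j b a E" unfolding Q_def using h by blast
    moreover have "(j, b, a) \<in> {..n - v} \<times> {..n} \<times> {..2 * n}" using h mn[OF h(3)] by auto
    ultimately show "\<exists>i\<in>{..n - v} \<times> {..n} \<times> {..2 * n}. Q (fst i) (fst (snd i)) (snd (snd i)) E" by force
  qed (use p01 in auto)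
  also have "\<dots> \<le> (\<Sum>i\<in>{..n - v} \<times> {..n} \<times> {..2 * n}.
      c * (A (fst i) * (X ^ snd (snd i) / fact (snd (snd i)) * (Y ^ fst (snd i) / fact (fst (snd i))))))"
    by (intro sum_mono tm) auto
  also have "\<dots> = c * (\<Sum>j\<le>n - v. A j * (\<Sum>b\<le>n. \<Sum>a\<le>2 * n. X ^ a / fact a * (Y ^ b / fact b)))"
    by (simp only: sum_distrib_left sum.cartesian_product split_beta)
  also have "\<dots> = c * ((\<Sum>j\<le>n - v. A j) * ((\<Sum>b\<le>n. Y ^ b / fact b) * (\<Sum>a\<le>2 * n. X ^ a / fact a)))"
  proof -
    have "(\<Sum>b\<le>n. \<Sum>a\<le>2 * n. X ^ a / fact a * (Y ^ b / fact b)) = (\<Sum>b\<le>n. Y ^ b / fact b) * (\<Sum>a\<le>2 * n. X ^ a / fact a)"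
      unfolding sum_product by (simp only: mult.commute)
    then show ?thesis by (simp only: sum_distrib_right)
  qed
  also have "\<dots> \<le> c * (exp (3 / 4 + comp_rate n e t' - real v * t) * (exp Y * exp X))"
  proof (intro mult_left_mono mult_mono exp_partial_sum_le XY c0)
    show "(\<Sum>j\<le>n - v. A j) \<le> exp (3 / 4 + comp_rate n e t' - real v * t)"
      unfolding A_def using v n by (intro forest_sum_le[OF _ _ p e(1) t t']) (auto simp: v_def)
  qed (auto intro!: sum_nonneg mult_nonneg_nonneg divide_nonneg_nonneg zero_le_power XY A0)
  also have "\<dots> = 1 / (real (max 1 l) * (g\<^sup>2 * real v)) * exp (5 + 3 / 4) * exp (comp_rate n e t' - real v * t + X + Y)"
    unfolding c_def exp_add exp_diff by simp
  also have "\<dots> \<le> 1 / (real (max 1 l) * (g\<^sup>2 * real v)) * exp 6 * exp (comp_rate n e t' - real v * t + X + Y)"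
    by (intro mult_right_mono mult_left_mono) auto
  finally show ?thesis unfolding X_def Y_def v_def by simp
qed

lemma rprob_ev_pure_cycle:
  fixes e p t t' :: real
  assumes n: "2 \<le> n" and p: "p = (1 + e) / real n" and e: "0 \<le> e" "e \<le> 1"
    and l: "3 \<le> l" "l \<le> n"
    and t: "0 \<le> t" "t \<le> 1/2" and t': "t\<^sup>2 + 2 * t ^ 3 + e ^ 3 \<le> t'\<^sup>2" "e \<le> 2 * t'"
  shows "rprob p (all_edges n) (ev_pure_cycle n l) \<le> exp 6 / real l * exp (comp_rate n e t' - real l * t)"
proof -
  have p01: "0 < p" "p \<le> 1" using n e unfolding p by (auto simp: field_simps)
  define A where "A j = fact n / fact (n - (l + j)) * forest_coeff l j * p ^ (l + j) *
      exp (- p * (real (l + j) * real n - (real (l + j))\<^sup>2 / 2))" for j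
  have "rprob p (all_edges n) (ev_pure_cycle n l) \<le> (\<Sum>j\<le>n - l. rprob p (all_edges n) (has_cert n l 0 0 0 j))"
    using p01 l by (intro rprob_le_sum) (auto simp: ev_pure_cycle_def intro: exI)
  also have "\<dots> \<le> (\<Sum>j\<le>n - l. 1 / real l * exp 5 * A j)"
  proof (rule sum_mono)
    fix j assume j: "j \<in> {..n - l}"
    have "rprob p (all_edges n) (has_cert n l 0 0 0 j) \<le> (1 / real (max 1 l) * exp 5) *
    ((fact n / fact (n - (l + 0 + j)) * forest_coeff (l + 0) j * p ^ (l + 0 + j) *
      exp (- p * (real (l + 0 + j) * real n - (real (l + 0 + j))\<^sup>2 / 2))) *
     (core_coeff l (0 - 0) 0 0 0 / (fact 0 * fact (0 - 0)) * p ^ (0 - 0)))"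
      using j l by (intro rprob_has_cert_le[OF n p e]) auto
    then show "rprob p (all_edges n) (has_cert n l 0 0 0 j) \<le> 1 / real l * exp 5 * A j"
      using l unfolding A_def core_coeff_def by (simp add: max_def)
  qed
  also have "\<dots> = 1 / real l * exp 5 * (\<Sum>j\<le>n - l. A j)" by (simp only: sum_distrib_left)
  also have "\<dots> \<le> 1 / real l * exp 5 * exp (3 / 4 + comp_rate n e t' - real l * t)"
    unfolding A_def using l n by (intro mult_left_mono forest_sum_le[OF _ _ p e(1) t t']) auto
  also have "\<dots> = 1 / real l * exp (5 + 3 / 4) * exp (comp_rate n e t' - real l * t)"
    unfolding exp_add exp_diff by simp
  also have "\<dots> \<le> 1 / real l * exp 6 * exp (comp_rate n e t' - real l * t)"
    by (intro mult_right_mono mult_left_mono) auto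
  finally show ?thesis by simp
qed

subsection \<open>The rate functions\<close>

text \<open>Since \<open>exp (- x) \<le> 1 - x / 2\<close> on the unit interval, each term is at
  most \<open>2 / x\<close> times a difference of consecutive terms, and the sum telescopes.\<close>

lemma geometric_tail_le:
  fixes x A :: real
  assumes x: "0 < x" "x \<le> 1"
  shows "(\<Sum>v | v \<le> n \<and> A \<le> real v. exp (- x * real v)) \<le> 2 / x * exp (- x * A)"
proof -
  define a where "a = nat \<lceil>A\<rceil>"
  have tele: "exp (- x * real v) \<le> 2 / x * (exp (- x * real v) - exp (- x * real (Suc v)))" for v
  proof -
    have "exp (- x) \<le> 1 - x + x\<^sup>2 / 2"
    proof -
      have "1 + x + x\<^sup>2 / 2 \<le> exp x" using exp_lower_Taylor_quadratic[of x] x by simp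
      then have "exp (- x) \<le> 1 / (1 + x + x\<^sup>2 / 2)"
        unfolding exp_minus inverse_eq_divide using x by (intro divide_left_mono) (auto simp: add_pos_nonneg)
      also have "\<dots> \<le> 1 - x + x\<^sup>2 / 2"
      proof -
        have "(1 - x + x\<^sup>2 / 2) * (1 + x + x\<^sup>2 / 2) = 1 + x ^ 4 / 4"
          by (simp add: field_simps power2_eq_square power4_eq_xxxx)
        then have "1 \<le> (1 - x + x\<^sup>2 / 2) * (1 + x + x\<^sup>2 / 2)" by simp
        then show ?thesis using x by (subst pos_divide_le_eq) (auto simp: add_pos_nonneg)
      qed
      finally show ?thesis .
    qed
    also have "\<dots> \<le> 1 - x / 2"
    proof -
      have "x * x \<le> x" using mult_left_mono[OF x(2), of x] x by simp
      then show ?thesis unfolding power2_eq_square by linarith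
    qed
    finally have "1 \<le> 2 / x * (1 - exp (- x))" using x by (simp add: field_simps)
    then have "exp (- x * real v) * 1 \<le> exp (- x * real v) * (2 / x * (1 - exp (- x)))"
      by (intro mult_left_mono) auto
    also have "exp (- x * real v) * (2 / x * (1 - exp (- x))) =
      2 / x * (exp (- x * real v) - exp (- x * real v) * exp (- x))" using x by (simp add: field_simps)
    also have "exp (- x * real v) * exp (- x) = exp (- x * real (Suc v))"
      unfolding mult_exp_exp by (simp add: algebra_simps)
    finally show ?thesis by simp
  qed
  have sum: "(\<Sum>v\<in>{a..<m}. exp (- x * real v)) \<le> 2 / x * (exp (- x * real a) - exp (- x * real m))" if "a \<le> m" for m
    using that
  proof (induction m rule: dec_induct)
    case (step m)
    have "(\<Sum>v\<in>{a..<Suc m}. exp (- x * real v)) = (\<Sum>v\<in>{a..<m}. exp (- x * real v)) + exp (- x * real m)"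
      using step by simp
    also have "\<dots> \<le> 2 / x * (exp (- x * real a) - exp (- x * real m)) + 2 / x * (exp (- x * real m) - exp (- x * real (Suc m)))"
      by (intro add_mono step tele)
    also have "\<dots> = 2 / x * (exp (- x * real a) - exp (- x * real (Suc m)))" by (simp add: algebra_simps)
    finally show ?case .
  qed simp
  have "(\<Sum>v | v \<le> n \<and> A \<le> real v. exp (- x * real v)) \<le> (\<Sum>v\<in>{a..<max a (Suc n)}. exp (- x * real v))"
    by (rule sum_mono2) (auto simp: a_def)
  also have "\<dots> \<le> 2 / x * (exp (- x * real a) - exp (- x * real (max a (Suc n))))" by (rule sum) simp
  also have "\<dots> \<le> 2 / x * exp (- x * real a)" using x by (intro mult_left_mono) auto
  also have "\<dots> \<le> 2 / x * exp (- x * A)"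
  proof -
    have "A \<le> real a" unfolding a_def by (simp add: real_nat_ceiling_ge)
    then show ?thesis using x by (intro mult_left_mono) auto
  qed
  finally show ?thesis .
qed

text \<open>At \<open>c = 1\<close> the factor of \<open>\<mu>\<close> is 2/3, the constant term of
  the exponents for cores near the typical size.\<close>

lemma comp_rate_scaled: "comp_rate n e (c * e) = (1 + c)\<^sup>2 * (2 * c - 1) / 6 * (e ^ 3 * real n)"
  unfolding comp_rate_def by (simp add: field_simps power2_eq_square power3_eq_cube)

lemma sqrt_edge_prob_le:
  assumes "0 \<le> e" "e \<le> g" "0 < n" "p = (1 + e) / real n"
  shows "sqrt p \<le> (1 + g) / sqrt (real n)"
proof -
  have "sqrt (1 + e) \<le> sqrt ((1 + g)\<^sup>2)"
  proof (rule real_sqrt_le_mono)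
    have "1 + e \<le> 1 + g" using assms by simp
    also have "\<dots> \<le> (1 + g)\<^sup>2" using assms by (intro self_le_power) auto
    finally show "1 + e \<le> (1 + g)\<^sup>2" .
  qed
  then have "sqrt (1 + e) \<le> 1 + g" using assms by simp
  then show ?thesis unfolding assms(4) real_sqrt_divide by (intro divide_right_mono) auto
qed

text \<open>Here \<open>x\<close> is the number of core vertices off the cycle and \<open>l\<close> the length of the cycle, both in
  units of \<open>e\<^sup>2 n\<close>, and \<open>g\<close> is slack; for \<open>g = 0\<close> and \<open>l + x = 2\<close> the sign changes at \<open>l = \<surd>3\<close>.\<close>

lemma cycle_rate_negative:
  fixes g l x z :: real
  assumes g: "0 \<le> g" "g \<le> 1 / 10 ^ 10" and l: "(1739/1000) \<le> l" and x: "0 \<le> x" "l + x \<le> (401/200)"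
    and z: "0 \<le> z" "z\<^sup>2 = 2 * (x + (401/200) * g)"
  shows "(2 + g)\<^sup>2 * (1 + 2 * g) / 6 - (l + x) + (1 + g)\<^sup>2 * (l + (401/200) * g) * z + (1 + g) ^ 4 * z ^ 3 / 6 \<le> - (1/250)"
proof -
  \<comment> \<open>The hypotheses leave \<open>x \<le> 0.266\<close>, and twice this lies just
    below the square of 0.73, which is 0.5329.\<close>
  have "z\<^sup>2 \<le> (73/100)\<^sup>2" unfolding z using l x g by (simp add: power2_eq_square)
  then have z73: "z \<le> (73/100)" by (rule power2_le_imp_le) simp
  have g1: "g \<le> 1 / 10" using g by simp
  have gg: "g\<^sup>2 \<le> g" using g g1 by (simp add: power2_eq_square mult_left_le)
  have "(1 + g)\<^sup>2 = 1 + 2 * g + g\<^sup>2" by (simp add: power2_eq_square algebra_simps)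
  then have p2: "(1 + g)\<^sup>2 \<le> 1 + 3 * g" using gg by linarith
  have p4: "(1 + g) ^ 4 \<le> 1 + 15 * g"
  proof -
    have "(1 + g) ^ 4 = ((1 + g)\<^sup>2)\<^sup>2" by (simp add: power2_eq_square power4_eq_xxxx)
    also have "\<dots> \<le> (1 + 3 * g)\<^sup>2" using p2 by (intro power_mono) auto
    also have "\<dots> = 1 + 6 * g + 9 * g\<^sup>2" by (simp add: power2_eq_square algebra_simps)
    also have "\<dots> \<le> 1 + 15 * g" using gg by linarith
    finally show ?thesis .
  qed
  have a: "(2 + g)\<^sup>2 * (1 + 2 * g) / 6 \<le> 2 / 3 + 10 * g"
  proof -
    have "(2 + g)\<^sup>2 = 4 + 4 * g + g\<^sup>2" by (simp add: power2_eq_square algebra_simps)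
    then have "(2 + g)\<^sup>2 \<le> 4 + 5 * g" using gg by linarith
    then have "(2 + g)\<^sup>2 * (1 + 2 * g) \<le> (4 + 5 * g) * (1 + 2 * g)" using g by (intro mult_right_mono) auto
    also have "\<dots> = 4 + 13 * g + 10 * g\<^sup>2" by (simp add: power2_eq_square algebra_simps)
    also have "\<dots> \<le> 4 + 60 * g" using gg g by linarith
    finally show ?thesis by simp
  qed
  have l2: "l \<le> (401/200)" using x by simp
  have b: "(1 + g)\<^sup>2 * (l + (401/200) * g) * z \<le> l * z + 10 * g"
  proof -
    have "(1 + g)\<^sup>2 * (l + (401/200) * g) \<le> (1 + 3 * g) * (l + (401/200) * g)" using p2 l g by (intro mult_right_mono) auto
    also have "\<dots> = l + (401/200) * g + 3 * (g * l) + (1203/200) * g\<^sup>2" by (simp add: power2_eq_square algebra_simps)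
    also have "\<dots> \<le> l + (401/200) * g + 3 * (g * (401/200)) + (1203/200) * (g * (1 / 10))"
    proof -
      have "g * l \<le> g * (401/200)" using l2 g by (intro mult_left_mono) auto
      moreover have "g\<^sup>2 \<le> g * (1 / 10)" unfolding power2_eq_square using g g1 by (intro mult_left_mono) auto
      ultimately show ?thesis by linarith
    qed
    also have "\<dots> \<le> l + 10 * g" using g by simp
    finally have "(1 + g)\<^sup>2 * (l + (401/200) * g) * z \<le> (l + 10 * g) * z" using z by (intro mult_right_mono) auto
    also have "\<dots> = l * z + 10 * (g * z)" by (simp add: algebra_simps)
    also have "g * z \<le> g * 1" using z73 g by (intro mult_left_mono) auto
    finally show ?thesis by simp
  qed
  have c: "(1 + g) ^ 4 * z ^ 3 / 6 \<le> z ^ 3 / 6 + 3 * g"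
  proof -
    have z3: "z ^ 3 \<le> 1" using z z73 by (intro power_le_one) auto
    have "(1 + g) ^ 4 * z ^ 3 \<le> (1 + 15 * g) * z ^ 3" using p4 z by (intro mult_right_mono) auto
    also have "\<dots> = z ^ 3 + 15 * (g * z ^ 3)" by (simp add: algebra_simps)
    also have "g * z ^ 3 \<le> g * 1" using z3 g by (intro mult_left_mono) auto
    finally have "(1 + g) ^ 4 * z ^ 3 \<le> z ^ 3 + 15 * (g * 1)" by simp
    then show ?thesis using g by simp
  qed
  have d: "x = z\<^sup>2 / 2 - (401/200) * g" unfolding z(2) by (simp add: field_simps)
  \<comment> \<open>As \<open>z < 1\<close>, the shortest admissible cycle is the worst
    case.\<close>
  have e: "- l * (1 - z) \<le> - (1739/1000) * (1 - z)" using l z73 by (intro mult_right_mono) auto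
  \<comment> \<open>The left side increases with \<open>z\<close>, so it is compared with its value
    at 73/100, which is about -0.00448.\<close>
  have f: "2 / 3 - (1739/1000) * (1 - z) - z\<^sup>2 / 2 + z ^ 3 / 6 \<le> - (11/2500)"
  proof -
    have "(2 / 3 - (1739/1000) * (1 - (73/100)) - (73/100)\<^sup>2 / 2 + (73/100) ^ 3 / 6) - (2 / 3 - (1739/1000) * (1 - z) - z\<^sup>2 / 2 + z ^ 3 / 6)
      = ((73/100) - z) * ((1739/1000) - ((73/100) + z) / 2 + ((73/100)\<^sup>2 + (73/100) * z + z\<^sup>2) / 6)"
      by (simp add: field_simps power2_eq_square power3_eq_cube)
    moreover have "((73/100) - z) * ((1739/1000) - ((73/100) + z) / 2 + ((73/100)\<^sup>2 + (73/100) * z + z\<^sup>2) / 6) \<ge> 0"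
    proof (rule mult_nonneg_nonneg)
      have "0 \<le> ((73/100)\<^sup>2 + (73/100) * z + z\<^sup>2) / 6" using z(1) by (intro divide_nonneg_nonneg add_nonneg_nonneg) auto
      moreover have "0 \<le> (1739/1000) - ((73/100) + z) / 2" using z73 by simp
      ultimately show "0 \<le> (1739/1000) - ((73/100) + z) / 2 + ((73/100)\<^sup>2 + (73/100) * z + z\<^sup>2) / 6"
        by (rule add_nonneg_nonneg[rotated])
    qed (use z73 in simp)
    moreover have "2 / 3 - (1739/1000) * (1 - (73/100)) - (73/100)\<^sup>2 / 2 + (73/100) ^ 3 / 6 \<le> (- (11/2500) :: real)"
      by (simp add: power2_eq_square power3_eq_cube)
    moreover have "Y \<le> K" if "X - Y = Z" "0 \<le> Z" "X \<le> K" for X Y Z K :: real using that by linarith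
    ultimately show ?thesis by blast
  qed
  have "- (l + x) + l * z = - l * (1 - z) - z\<^sup>2 / 2 + (401/200) * g" unfolding d by (simp add: algebra_simps)
  then have "(2 + g)\<^sup>2 * (1 + 2 * g) / 6 - (l + x) + (1 + g)\<^sup>2 * (l + (401/200) * g) * z + (1 + g) ^ 4 * z ^ 3 / 6
     \<le> - (11/2500) + 30 * g" using a b c e f g by linarith
  then show ?thesis using g by simp
qed

text \<open>The exponential rate of cores of size \<open>t (e + t) n\<close> vanishes only at the typical size \<open>t = e\<close>,
  because \<open>(4 t\<^sup>2 - t e + e\<^sup>2)\<^sup>2 - 8 t\<^sup>3 (e + t) = (t - e)\<^sup>2 (8 t\<^sup>2 + e\<^sup>2)\<close>.\<close>

lemma core_rate_negative:
  fixes e g s t :: real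
  assumes g: "0 \<le> g" "g \<le> 1 / 10 ^ 10" and e: "0 \<le> e" "(1001/1000) * e \<le> t" and s: "0 \<le> s" "s\<^sup>2 = t * (e + t)"
  shows "(e + (1 + g) * t)\<^sup>2 * (2 * ((1 + g) * t) - e) / 6 - t\<^sup>2 * (e + t) + sqrt 2 / 3 * (1 + 10 * g) * s ^ 3
    \<le> - (1 / 10 ^ 7) * t ^ 3"
proof -
  have t: "0 \<le> t" "e \<le> t" using e by auto
  have t3: "0 \<le> t ^ 3" using t by simp
  have D: "(e + (1 + g) * t)\<^sup>2 * (2 * ((1 + g) * t) - e) \<le> (e + t)\<^sup>2 * (2 * t - e) + 20 * g * t ^ 3"
  proof -
    have "(e + (1 + g) * t)\<^sup>2 * (2 * ((1 + g) * t) - e) - (e + t)\<^sup>2 * (2 * t - e) =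
      g * (t\<^sup>2 * (6 * e + 6 * t + g * (3 * e + 6 * t) + 2 * g\<^sup>2 * t))"
      by (simp add: field_simps power2_eq_square power3_eq_cube)
    also have "\<dots> \<le> g * (t\<^sup>2 * (20 * t))"
    proof (intro mult_left_mono)
      have "g * (3 * e + 6 * t) \<le> (1 / 10) * (9 * t)" using g e t by (intro mult_mono) auto
      moreover have "g\<^sup>2 * t \<le> 1 * t" using g t by (intro mult_right_mono power_le_one) auto
      ultimately show "6 * e + 6 * t + g * (3 * e + 6 * t) + 2 * g\<^sup>2 * t \<le> 20 * t" using t by linarith
    qed (use g in auto)
    finally show ?thesis by (simp add: algebra_simps power2_eq_square power3_eq_cube)
  qed
  \<comment> \<open>At \<open>g = 0\<close> the rate equals \<open>- (e + t) / 6 * (P - Q)\<close>.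
    Comparing the squares of \<open>P\<close> and \<open>Q\<close> removes the square roots hidden
    in \<open>s\<close>.\<close>
  define P where "P = 4 * t\<^sup>2 - t * e + e\<^sup>2"
  define Q where "Q = 2 * sqrt 2 * s * t"
  have te: "0 \<le> t * e" "e\<^sup>2 \<le> t * e" "t * e \<le> t\<^sup>2" using e t by (auto simp: power2_eq_square mult_right_mono mult_left_mono)
  have P0: "0 \<le> P" "P \<le> 4 * t\<^sup>2" unfolding P_def using te zero_le_power2[of e] zero_le_power2[of t] by linarith+
  have Q0: "0 \<le> Q" unfolding Q_def using s t by simp
  have Q2: "Q\<^sup>2 = 8 * t ^ 3 * (e + t)"
  proof -
    have "Q\<^sup>2 = 8 * (s\<^sup>2 * t\<^sup>2)" unfolding Q_def by (simp add: power_mult_distrib)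
    then show ?thesis unfolding s by (simp add: power2_eq_square power3_eq_cube algebra_simps)
  qed
  have "Q\<^sup>2 \<le> (4 * t\<^sup>2)\<^sup>2"
  proof -
    have "8 * t ^ 3 * (e + t) \<le> 8 * t ^ 3 * (2 * t)" using t t3 by (intro mult_left_mono) auto
    then show ?thesis unfolding Q2 by (simp add: power2_eq_square power3_eq_cube algebra_simps)
  qed
  then have Q4: "Q \<le> 4 * t\<^sup>2" by (rule power2_le_imp_le) simp
  have "P\<^sup>2 - Q\<^sup>2 = (t - e)\<^sup>2 * (8 * t\<^sup>2 + e\<^sup>2)"
    unfolding Q2 P_def by (simp add: power2_eq_square power3_eq_cube algebra_simps)
  then have PQ: "(P - Q) * (P + Q) = (t - e)\<^sup>2 * (8 * t\<^sup>2 + e\<^sup>2)" by (simp add: power2_eq_square algebra_simps)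
  have PQ2: "(t - e)\<^sup>2 \<le> P - Q"
  proof (cases "t = 0")
    case True
    then have "e = 0" using e by simp
    then show ?thesis using True unfolding P_def Q_def by simp
  next
    case False
    have pos: "0 < 8 * t\<^sup>2" using False by simp
    have le: "P + Q \<le> 8 * t\<^sup>2" using P0 Q4 by linarith
    have "(t - e)\<^sup>2 * (8 * t\<^sup>2) \<le> (P - Q) * (P + Q)" unfolding PQ by (intro mult_left_mono) auto
    also have "\<dots> \<le> (P - Q) * (8 * t\<^sup>2)"
    proof (rule mult_left_mono[OF le])
      show "0 \<le> P - Q"
      proof (rule ccontr)
        assume "\<not> 0 \<le> P - Q"
        then have "P - Q < 0" "0 < P + Q" using P0 Q0 by linarith+
        then have "(P - Q) * (P + Q) < 0" by (rule mult_neg_pos)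
        moreover have "0 \<le> (t - e)\<^sup>2 * (8 * t\<^sup>2 + e\<^sup>2)" by simp
        ultimately show False using PQ by linarith
      qed
    qed
    finally show ?thesis using pos by (simp only: mult_le_cancel_right_pos)
  qed
  \<comment> \<open>From \<open>t \<ge> 1001/1000 * e\<close> follows
    \<open>t - e \<ge> t / 1001\<close>, rounded down to \<open>99/100000 * t\<close>.\<close>
  have te2: "((99/100000) * t)\<^sup>2 \<le> (t - e)\<^sup>2" using e t by (intro power_mono) auto
  have s3: "s ^ 3 = s * (t * (e + t))" using s(2) by (simp add: power2_eq_square power3_eq_cube)
  have base: "(e + t)\<^sup>2 * (2 * t - e) / 6 - t\<^sup>2 * (e + t) + sqrt 2 / 3 * s ^ 3 = - ((e + t) / 6) * (P - Q)"
    unfolding s3 P_def Q_def by (simp add: field_simps power2_eq_square power3_eq_cube)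
  have "(t / 6) * ((99/100000) * t)\<^sup>2 \<le> ((e + t) / 6) * (P - Q)"
    using e t by (intro mult_mono order_trans[OF te2 PQ2]) auto
  then have base2: "(e + t)\<^sup>2 * (2 * t - e) / 6 - t\<^sup>2 * (e + t) + sqrt 2 / 3 * s ^ 3 \<le> - ((99/100000)\<^sup>2 / 6) * t ^ 3"
    unfolding base by (simp add: power2_eq_square power3_eq_cube)
  have sle: "s ^ 3 \<le> 4 * t ^ 3"
  proof -
    have "s\<^sup>2 \<le> (2 * t)\<^sup>2" unfolding s using t te by (simp add: power2_eq_square algebra_simps)
    then have "s \<le> 2 * t" by (rule power2_le_imp_le) (use t in simp)
    moreover have "t * (e + t) \<le> t * (2 * t)" using t by (intro mult_left_mono) auto
    ultimately have "s * (t * (e + t)) \<le> (2 * t) * (t * (2 * t))" using s t e by (intro mult_mono) auto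
    then show ?thesis unfolding s3 by (simp add: power3_eq_cube)
  qed
  have err: "sqrt 2 / 3 * (10 * g) * s ^ 3 \<le> 40 * g * t ^ 3"
  proof -
    have "sqrt 2 / 3 \<le> 1" using real_sqrt_le_mono[of 2 4] by simp
    then have "sqrt 2 / 3 * (10 * g) * s ^ 3 \<le> 1 * (10 * g) * (4 * t ^ 3)"
      using sle g s by (intro mult_mono) auto
    then show ?thesis by simp
  qed
  have aux: "A / 6 - B + S \<le> R" if "A \<le> A0 + 20 * G" "A0 / 6 - B + S1 \<le> K" "S = S1 + S2" "S2 \<le> 40 * G"
      "G \<le> Z" "44 * Z + K \<le> R" "0 \<le> G" for A A0 B S S1 S2 R K G Z :: real
    using that by linarith
  show ?thesis
  proof (rule aux)
    show "(e + (1 + g) * t)\<^sup>2 * (2 * ((1 + g) * t) - e) \<le> (e + t)\<^sup>2 * (2 * t - e) + 20 * (g * t ^ 3)"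
      using D by (simp only: mult.assoc)
    show "sqrt 2 / 3 * (10 * g) * s ^ 3 \<le> 40 * (g * t ^ 3)" using err by (simp only: mult.assoc)
    show "g * t ^ 3 \<le> 1 / 10 ^ 10 * t ^ 3" using g t3 by (intro mult_right_mono) auto
    show "sqrt 2 / 3 * (1 + 10 * g) * s ^ 3 = sqrt 2 / 3 * s ^ 3 + sqrt 2 / 3 * (10 * g) * s ^ 3"
      by (simp add: algebra_simps)
    \<comment> \<open>The gain \<open>(99/100000)\<^sup>2 / 6\<close> is about 1.6 / 10^7. The slack
      terms cost \<open>(20 / 6 + 40) * g\<close>, hence at most 4.4 / 10^9.\<close>
    show "44 * (1 / 10 ^ 10 * t ^ 3) + (- ((99/100000)\<^sup>2 / 6) * t ^ 3) \<le> - (1 / 10 ^ 7) * t ^ 3"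
    proof -
      have "(44 / 10 ^ 10 - (99/100000)\<^sup>2 / 6) * t ^ 3 \<le> - (1 / 10 ^ 7) * t ^ 3"
        using t3 by (intro mult_right_mono) (simp_all add: power2_eq_square)
      then show ?thesis by (simp add: algebra_simps)
    qed
    show "0 \<le> g * t ^ 3" using g t3 by simp
  qed (rule base2)
qed

subsection \<open>Summing up the first moments\<close>

text \<open>The tilt \<open>t = e\<close> suits cores of the typical size: to first order
  \<open>1 - e\<close> is the subcritical parameter conjugate to \<open>1 + e\<close>. The choice
  \<open>t' = (1 + g) * e\<close> absorbs the cubic terms once \<open>e\<close> is small against
  \<open>g\<close>.\<close>

lemma dual_parameter_conditions:
  fixes e g :: real
  assumes "0 < e" "e \<le> g / 2"
  shows "e\<^sup>2 + 2 * e ^ 3 + e ^ 3 \<le> ((1 + g) * e)\<^sup>2" "e \<le> 2 * ((1 + g) * e)"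
proof -
  have "3 * e * e\<^sup>2 \<le> (2 * g + g\<^sup>2) * e\<^sup>2" using assms by (intro mult_right_mono) (auto intro: add_increasing2)
  then show "e\<^sup>2 + 2 * e ^ 3 + e ^ 3 \<le> ((1 + g) * e)\<^sup>2" by (simp add: power2_eq_square power3_eq_cube algebra_simps)
  show "e \<le> 2 * ((1 + g) * e)" using assms by (simp add: algebra_simps)
qed

text \<open>The exponent is at most \<open>(7/10 - 1739/1000) * \<mu>\<close>, hence negative. Its
  exponential gain is given away: the geometric sum yields \<open>2 / e\<close> and the prefactor
  \<open>1 / L\<close>, together of order \<open>1 / \<mu>\<close>.\<close>

lemma pure_cycles_bound:
  fixes e g p :: real
  assumes n: "2 \<le> n" and p: "p = (1 + e) / real n" and e: "0 < e" "e \<le> g / 2" and g: "0 < g" "g \<le> 1 / 10 ^ 10"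
  shows "(\<Sum>l | l \<le> n \<and> 3 \<le> l \<and> 1739/1000 * (e\<^sup>2 * real n) \<le> real l. rprob p (all_edges n) (ev_pure_cycle n l))
    \<le> 2 * exp 6 / (e ^ 3 * real n)"
proof -
  define \<mu> where "\<mu> = e ^ 3 * real n"
  define L where "L = 1739/1000 * (e\<^sup>2 * real n)"
  have g1: "g \<le> 1 / 100" using g by simp
  have e1: "e \<le> 1/2" using e g1 by simp
  have \<mu>0: "0 < \<mu>" and L0: "0 < L" using n e unfolding \<mu>_def L_def by auto
  have eL: "e * L = 1739/1000 * \<mu>" unfolding L_def \<mu>_def by (simp add: power2_eq_square power3_eq_cube)
  note cond = dual_parameter_conditions[OF e]
  have rate: "comp_rate n e ((1 + g) * e) \<le> 7/10 * \<mu>"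
  proof -
    have "(1 + (1 + g))\<^sup>2 * (2 * (1 + g) - 1) / 6 \<le> 7/10"
    proof -
      have "(1 + (1 + g))\<^sup>2 \<le> (201/100)\<^sup>2" using g g1 by (intro power_mono) auto
      then have "(1 + (1 + g))\<^sup>2 * (2 * (1 + g) - 1) \<le> (201/100)\<^sup>2 * (102/100)" using g g1 by (intro mult_mono) auto
      then show ?thesis by (simp add: power2_eq_square)
    qed
    then show ?thesis unfolding comp_rate_scaled \<mu>_def[symmetric] using \<mu>0 by (intro mult_right_mono) auto
  qed
  have "(\<Sum>l | l \<le> n \<and> 3 \<le> l \<and> L \<le> real l. rprob p (all_edges n) (ev_pure_cycle n l)) \<le>
    (\<Sum>l | l \<le> n \<and> 3 \<le> l \<and> L \<le> real l. exp 6 / L * exp (7/10 * \<mu>) * exp (- e * real l))"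
  proof (rule sum_mono)
    fix l assume l: "l \<in> {l. l \<le> n \<and> 3 \<le> l \<and> L \<le> real l}"
    have "rprob p (all_edges n) (ev_pure_cycle n l) \<le> exp 6 / real l * exp (comp_rate n e ((1 + g) * e) - real l * e)"
      using l e e1 cond by (intro rprob_ev_pure_cycle[OF n p]) auto
    also have "\<dots> \<le> exp 6 / L * exp (7/10 * \<mu> - real l * e)"
      using l L0 rate by (intro mult_mono divide_left_mono) auto
    also have "\<dots> = exp 6 / L * exp (7/10 * \<mu>) * exp (- e * real l)"
      unfolding mult.assoc mult_exp_exp by (simp add: mult.commute)
    finally show "rprob p (all_edges n) (ev_pure_cycle n l) \<le> exp 6 / L * exp (7/10 * \<mu>) * exp (- e * real l)" .
  qed
  also have "\<dots> \<le> exp 6 / L * exp (7/10 * \<mu>) * (\<Sum>l | l \<le> n \<and> L \<le> real l. exp (- e * real l))"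
    unfolding sum_distrib_left using L0 by (intro sum_mono2) (auto intro: mult_nonneg_nonneg)
  also have "\<dots> \<le> exp 6 / L * exp (7/10 * \<mu>) * (2 / e * exp (- e * L))"
    using e e1 L0 by (intro mult_left_mono geometric_tail_le) auto
  also have "\<dots> = 2 * exp 6 / (e * L) * (exp (7/10 * \<mu>) * exp (- (1739/1000 * \<mu>)))"
    using L0 e eL by (simp add: field_simps)
  also have "\<dots> \<le> 2 * exp 6 / (e * L) * 1"
    unfolding mult_exp_exp using \<mu>0 e L0 by (intro mult_left_mono) auto
  also have "\<dots> \<le> 2 * exp 6 / \<mu>"
    unfolding eL mult_1_right using \<mu>0 by (intro divide_left_mono) auto
  finally show ?thesis unfolding \<mu>_def L_def .
qed

text \<open>The tilt is \<open>t = e\<close> and sizes are measured in units of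
  \<open>N = e\<^sup>2 n\<close>. The prefactor of order \<open>1 / N\<^sup>2\<close> balances the
  number of pairs \<open>(l, w)\<close> over which this bound will be summed.\<close>

lemma small_core_bound:
  fixes e g p :: real
  assumes n: "2 \<le> n" and p: "p = (1 + e) / real n" and e: "0 < e" "e \<le> g / 2" and g: "0 < g" "g \<le> 1 / 10 ^ 10"
    and l: "3 \<le> l" "1739/1000 * (e\<^sup>2 * real n) \<le> real l"
    and v: "l + w \<le> n" "real (l + w) \<le> 401/200 * (e\<^sup>2 * real n)"
  shows "rprob p (all_edges n) (ev_cert n g l w) \<le>
    exp 6 / (g\<^sup>2 * (1739/1000 * (e\<^sup>2 * real n))\<^sup>2) * exp (- (e ^ 3 * real n) / 250)"
proof -
  define \<mu> where "\<mu> = e ^ 3 * real n"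
  define N where "N = e\<^sup>2 * real n"
  have g1: "g \<le> 1 / 100" using g by simp
  have e1: "e \<le> 1/2" "e \<le> 1" "e \<le> g" using e g1 by auto
  have \<mu>0: "0 < \<mu>" and N0: "0 < N" using n e unfolding \<mu>_def N_def by auto
  have Ne: "N * e = \<mu>" unfolding N_def \<mu>_def by (simp add: power2_eq_square power3_eq_cube)
  note cond = dual_parameter_conditions[OF e]
  define \<Lambda> where "\<Lambda> = real l / N"
  define \<omega> where "\<omega> = real w / N"
  have lN: "real l = \<Lambda> * N" "real w = \<omega> * N" using N0 unfolding \<Lambda>_def \<omega>_def by auto
  have L1: "1739/1000 \<le> \<Lambda>" using l(2) N0 unfolding \<Lambda>_def N_def[symmetric] by (simp add: field_simps)
  have W1: "0 \<le> \<omega>" using N0 unfolding \<omega>_def by simp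
  have LW: "\<Lambda> + \<omega> \<le> 401/200"
    using v(2) N0 unfolding \<Lambda>_def \<omega>_def N_def[symmetric] by (simp add: field_simps)
  define z where "z = sqrt (2 * (real w + g * real (l + w)))"
  define z1 where "z1 = sqrt (2 * (\<omega> + 401/200 * g))"
  have z1: "0 \<le> z1" "z1\<^sup>2 = 2 * (\<omega> + 401/200 * g)" using W1 g unfolding z1_def by auto
  have z0: "0 \<le> z" using g unfolding z_def by simp
  have vN: "real (l + w) \<le> 401/200 * N" using v(2) unfolding N_def .
  have zz: "z\<^sup>2 \<le> z1\<^sup>2 * N"
  proof -
    have "z\<^sup>2 = 2 * (real w + g * real (l + w))" using g unfolding z_def by simp
    also have "\<dots> \<le> 2 * (\<omega> * N + g * (401/200 * N))"
      using vN g lN by (intro mult_left_mono add_mono) auto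
    also have "\<dots> = z1\<^sup>2 * N" unfolding z1 by (simp add: algebra_simps)
    finally show ?thesis .
  qed
  have zle: "z \<le> z1 * (e * sqrt (real n))"
  proof (rule power2_le_imp_le)
    show "z\<^sup>2 \<le> (z1 * (e * sqrt (real n)))\<^sup>2"
      using zz unfolding N_def by (simp add: power_mult_distrib)
  qed (use z1 e in auto)
  have zp: "z * sqrt p \<le> (1 + g) * z1 * e"
  proof -
    have "z * sqrt p \<le> (z1 * (e * sqrt (real n))) * ((1 + g) / sqrt (real n))"
      using zle z0 e e1 n p by (intro mult_mono sqrt_edge_prob_le[of e]) (auto simp: z1)
    also have "\<dots> = (1 + g) * z1 * e" using n by simp
    finally show ?thesis .
  qed
  have zp0: "0 \<le> z * sqrt p" using z0 p e by simp
  have X: "(1 + g) * ((real l + g * real (l + w)) * z * sqrt p) \<le> (1 + g)\<^sup>2 * (\<Lambda> + 401/200 * g) * z1 * \<mu>"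
  proof -
    have "real l + g * real (l + w) \<le> (\<Lambda> + 401/200 * g) * N"
      using mult_left_mono[OF vN, of g] g lN by (simp add: algebra_simps)
    then have "(real l + g * real (l + w)) * (z * sqrt p) \<le> ((\<Lambda> + 401/200 * g) * N) * ((1 + g) * z1 * e)"
      by (rule mult_mono[OF _ zp]) (use zp0 L1 g N0 in auto)
    then have "(1 + g) * ((real l + g * real (l + w)) * (z * sqrt p)) \<le> (1 + g) * (((\<Lambda> + 401/200 * g) * N) * ((1 + g) * z1 * e))"
      using g by (intro mult_left_mono) auto
    also have "\<dots> = (1 + g)\<^sup>2 * (\<Lambda> + 401/200 * g) * z1 * \<mu>" unfolding Ne[symmetric] by (simp add: power2_eq_square)
    finally show ?thesis by (simp only: mult.assoc)
  qed
  have Y: "(1 + g) ^ 3 * (z ^ 3 * sqrt p / 6) \<le> (1 + g) ^ 4 * z1 ^ 3 / 6 * \<mu>"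
  proof -
    have "z\<^sup>2 * (z * sqrt p) \<le> (z1\<^sup>2 * N) * ((1 + g) * z1 * e)"
      by (rule mult_mono[OF zz zp]) (use zp0 N0 in auto)
    then have "(1 + g) ^ 3 / 6 * (z\<^sup>2 * (z * sqrt p)) \<le> (1 + g) ^ 3 / 6 * ((z1\<^sup>2 * N) * ((1 + g) * z1 * e))"
      using g by (intro mult_left_mono) auto
    also have "\<dots> = (1 + g) ^ 4 * z1 ^ 3 / 6 * \<mu>" unfolding Ne[symmetric]
      by (simp add: power2_eq_square power3_eq_cube power4_eq_xxxx)
    finally show ?thesis by (simp add: power2_eq_square power3_eq_cube mult_ac)
  qed
  have rate: "comp_rate n e ((1 + g) * e) = (2 + g)\<^sup>2 * (1 + 2 * g) / 6 * \<mu>"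
    unfolding comp_rate_scaled \<mu>_def by (simp add: algebra_simps)
  have ve: "real (l + w) * e = (\<Lambda> + \<omega>) * \<mu>" unfolding of_nat_add lN Ne[symmetric] by (simp add: algebra_simps)
  have total: "comp_rate n e ((1 + g) * e) - real (l + w) * e + (1 + g) * ((real l + g * real (l + w)) * z * sqrt p) +
     (1 + g) ^ 3 * (z ^ 3 * sqrt p / 6) \<le> - \<mu> / 250"
  proof -
    have "((2 + g)\<^sup>2 * (1 + 2 * g) / 6 - (\<Lambda> + \<omega>) + (1 + g)\<^sup>2 * (\<Lambda> + (401/200) * g) * z1 + (1 + g) ^ 4 * z1 ^ 3 / 6) * \<mu> \<le> - (1/250) * \<mu>"
      using \<mu>0 g by (intro mult_right_mono cycle_rate_negative L1 W1 LW z1) auto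
    then show ?thesis using X Y unfolding rate ve by (simp add: algebra_simps)
  qed
  have "rprob p (all_edges n) (ev_cert n g l w) \<le> exp 6 / (real (max 1 l) * (g\<^sup>2 * real (l + w))) *
    exp (comp_rate n e ((1 + g) * e) - real (l + w) * e +
      (1 + g) * ((real l + g * real (l + w)) * sqrt (2 * (real w + g * real (l + w))) * sqrt p) + (1 + g) ^ 3 * (sqrt (2 * (real w + g * real (l + w))) ^ 3 * sqrt p / 6))"
    using l v g e e1 g1 cond by (intro rprob_ev_cert[OF n p]) auto
  also have "\<dots> \<le> exp 6 / (g\<^sup>2 * (1739/1000 * N)\<^sup>2) * exp (- \<mu> / 250)"
  proof (intro mult_mono)
    have lL: "1739/1000 * N \<le> real l" using l(2) unfolding N_def .
    have "(1739/1000 * N)\<^sup>2 \<le> real l * real (l + w)"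
      unfolding power2_eq_square using lL N0 by (intro mult_mono) auto
    then have "g\<^sup>2 * (1739/1000 * N)\<^sup>2 \<le> real (max 1 l) * (g\<^sup>2 * real (l + w))"
      using l g by (simp add: max_def mult_ac mult_left_mono)
    moreover have "0 < g\<^sup>2 * (1739/1000 * N)\<^sup>2" using g N0 by simp
    ultimately show "exp 6 / (real (max 1 l) * (g\<^sup>2 * real (l + w))) \<le> exp 6 / (g\<^sup>2 * (1739/1000 * N)\<^sup>2)"
      by (intro divide_left_mono) (auto intro: mult_pos_pos order.strict_trans2)
  qed (use total in \<open>simp_all add: z_def\<close>)
  finally show ?thesis unfolding N_def \<mu>_def .
qed

text \<open>The gain \<open>t ^ 3 * n\<close> is at least \<open>e * v / 2\<close>, which makes the
  sum over \<open>v\<close> geometric. The restriction to \<open>v \<le> g\<^sup>2 / 4 * n\<close>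
  ensures \<open>t \<le> g / 2\<close>.\<close>

lemma large_core_bound:
  fixes e g p :: real
  assumes n: "2 \<le> n" and p: "p = (1 + e) / real n" and e: "0 < e" "e \<le> g / 2" and g: "0 < g" "g \<le> 1 / 10 ^ 10"
    and v: "v \<le> n" "401/200 * (e\<^sup>2 * real n) \<le> real v" "real v \<le> g\<^sup>2 / 4 * real n"
  shows "rprob p (all_edges n) (ev_cert n g 0 v) \<le>
    exp 6 / (g\<^sup>2 * (401/200 * (e\<^sup>2 * real n))) * exp (- (e / (2 * 10 ^ 7)) * real v)"
proof -
  have n0: "0 < real n" using n by simp
  have g1: "g \<le> 1 / 100" using g by simp
  have e1: "e \<le> 1" "e \<le> g" using e g1 by auto
  have v0: "0 < real v"
  proof -
    have "0 < 401/200 * (e\<^sup>2 * real n)" using e n0 by simp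
    then show ?thesis using v(2) by linarith
  qed
  define q where "q = real v / real n"
  have q0: "0 < q" using v0 n0 unfolding q_def by simp
  have vq: "real v = real n * q" using n0 unfolding q_def by simp
  have q1: "401/200 * e\<^sup>2 \<le> q" using v(2) n0 unfolding q_def by (simp add: field_simps)
  have q2: "q \<le> g\<^sup>2 / 4" using v(3) n0 unfolding q_def by (simp add: field_simps)
  define s where "s = sqrt q"
  have s: "0 \<le> s" "s\<^sup>2 = q" using q0 unfolding s_def by auto
  \<comment> \<open>The positive root of \<open>t * (e + t) = q\<close>, where the derivative of
    \<open>comp_rate n e t - v * t\<close> in \<open>t\<close> vanishes: the optimal tilt for a core
    of this size.\<close>
  define t where "t = (sqrt (e\<^sup>2 + 4 * q) - e) / 2"
  have t0: "0 \<le> t"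
  proof -
    have "sqrt (e\<^sup>2) \<le> sqrt (e\<^sup>2 + 4 * q)" using q0 by (intro real_sqrt_le_mono) simp
    then show ?thesis using e unfolding t_def by simp
  qed
  have tq: "t * (e + t) = q"
  proof -
    have "t * (e + t) = ((sqrt (e\<^sup>2 + 4 * q))\<^sup>2 - e\<^sup>2) / 4" unfolding t_def
      by (simp add: field_simps power2_eq_square)
    also have "(sqrt (e\<^sup>2 + 4 * q))\<^sup>2 = e\<^sup>2 + 4 * q" using q0 by (intro real_sqrt_pow2) (simp add: add_nonneg_nonneg)
    finally show ?thesis by simp
  qed
  \<comment> \<open>The product 1.001 * 2.001 = 2.003001 is below 401/200.\<close>
  have te: "1001/1000 * e \<le> t"
  proof (rule ccontr)
    assume "\<not> 1001/1000 * e \<le> t"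
    then have "t * (e + t) \<le> (1001/1000 * e) * (e + 1001/1000 * e)" using t0 e by (intro mult_mono) auto
    also have "\<dots> = (1001/1000 * (2001/1000)) * e\<^sup>2" by (simp add: power2_eq_square)
    also have "\<dots> < 401/200 * e\<^sup>2" using e by (intro mult_strict_right_mono) auto
    finally show False using tq q1 by simp
  qed
  then have et: "e \<le> t" using e by simp
  have "0 \<le> t * e" using t0 e by simp
  then have t2: "t\<^sup>2 \<le> q" using tq by (simp add: power2_eq_square algebra_simps)
  have tg: "t \<le> g / 2"
  proof (rule power2_le_imp_le)
    show "t\<^sup>2 \<le> (g / 2)\<^sup>2" using t2 q2 by (simp add: power_divide)
  qed (use g in simp)
  have cond: "t\<^sup>2 + 2 * t ^ 3 + e ^ 3 \<le> ((1 + g) * t)\<^sup>2" "e \<le> 2 * ((1 + g) * t)"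
  proof -
    have "2 * t * t\<^sup>2 \<le> g * t\<^sup>2" using tg by (intro mult_right_mono) auto
    moreover have "e * e\<^sup>2 \<le> g * t\<^sup>2" using e1 e et by (intro mult_mono power_mono) auto
    moreover have "0 \<le> g\<^sup>2 * t\<^sup>2" by simp
    moreover have "((1 + g) * t)\<^sup>2 = t\<^sup>2 + 2 * (g * t\<^sup>2) + g\<^sup>2 * t\<^sup>2" by (simp add: power2_eq_square algebra_simps)
    moreover have "2 * t ^ 3 = 2 * t * t\<^sup>2" "e ^ 3 = e * e\<^sup>2" by (simp_all add: power2_eq_square power3_eq_cube)
    ultimately show "t\<^sup>2 + 2 * t ^ 3 + e ^ 3 \<le> ((1 + g) * t)\<^sup>2" by linarith
    have "0 \<le> g * t" using g t0 by simp
    then show "e \<le> 2 * ((1 + g) * t)" using et t0 by (simp add: algebra_simps)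
  qed
  define z where "z = sqrt (2 * (real v + g * real (0 + v)))"
  have z0: "0 \<le> z" using g unfolding z_def by simp
  have z2: "z\<^sup>2 = 2 * (1 + g) * (real n * s\<^sup>2)" using g unfolding z_def s vq[symmetric] by (simp add: algebra_simps)
  have zle: "z \<le> sqrt 2 * (1 + g) * (s * sqrt (real n))"
  proof (rule power2_le_imp_le)
    have "2 * (1 + g) * (real n * s\<^sup>2) \<le> 2 * (1 + g)\<^sup>2 * (real n * s\<^sup>2)"
      using g by (intro mult_right_mono mult_left_mono self_le_power) auto
    then show "z\<^sup>2 \<le> (sqrt 2 * (1 + g) * (s * sqrt (real n)))\<^sup>2"
      unfolding z2 by (simp add: power_mult_distrib mult_ac)
  qed (use g s in auto)
  have zp: "z * sqrt p \<le> sqrt 2 * (1 + g)\<^sup>2 * s"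
  proof -
    have "z * sqrt p \<le> (sqrt 2 * (1 + g) * (s * sqrt (real n))) * ((1 + g) / sqrt (real n))"
      using zle z0 e e1 n p g s by (intro mult_mono sqrt_edge_prob_le[of e]) auto
    also have "\<dots> = sqrt 2 * (1 + g)\<^sup>2 * s" using n by (simp add: power2_eq_square)
    finally show ?thesis .
  qed
  have zp0: "0 \<le> z * sqrt p" using z0 p e by simp
  let ?S = "real n * s ^ 3"
  have X: "(1 + g) * ((real 0 + g * real (0 + v)) * z * sqrt p) \<le> sqrt 2 / 3 * (3 * g * (1 + g) ^ 3) * ?S"
  proof -
    have "(1 + g) * (g * (real n * s\<^sup>2)) * (z * sqrt p) \<le> (1 + g) * (g * (real n * s\<^sup>2)) * (sqrt 2 * (1 + g)\<^sup>2 * s)"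
      using zp g by (intro mult_left_mono) auto
    also have "\<dots> = sqrt 2 / 3 * (3 * g * (1 + g) ^ 3) * ?S" by (simp add: power2_eq_square power3_eq_cube)
    moreover have "real 0 + g * real (0 + v) = g * (real n * s\<^sup>2)" using vq s by simp
    ultimately show ?thesis by (simp only: mult.assoc)
  qed
  have Y: "(1 + g) ^ 3 * (z ^ 3 * sqrt p / 6) \<le> sqrt 2 / 3 * (1 + g) ^ 6 * ?S"
  proof -
    have "(1 + g) ^ 3 / 6 * z\<^sup>2 * (z * sqrt p) \<le> (1 + g) ^ 3 / 6 * z\<^sup>2 * (sqrt 2 * (1 + g)\<^sup>2 * s)"
      using zp g by (intro mult_left_mono) auto
    also have "\<dots> = sqrt 2 / 3 * (1 + g) ^ 6 * ?S" unfolding z2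
      by (simp add: power2_eq_square power3_eq_cube eval_nat_numeral)
    finally show ?thesis by (simp add: power2_eq_square power3_eq_cube mult_ac)
  qed
  have coef: "3 * g * (1 + g) ^ 3 + (1 + g) ^ 6 \<le> 1 + 10 * g"
  proof -
    have gg: "g\<^sup>2 \<le> g / 100" unfolding power2_eq_square using mult_left_mono[OF g1, of g] g by simp
    have ggg: "g ^ 3 \<le> g\<^sup>2" using g g1 by (intro power_decreasing) auto
    have "(1 + g) ^ 3 = 1 + 3 * g + 3 * g\<^sup>2 + g ^ 3" by (simp add: power2_eq_square power3_eq_cube algebra_simps)
    then have c3: "(1 + g) ^ 3 \<le> 1 + 31/10 * g" using gg ggg g by linarith
    have "(1 + g) ^ 6 = ((1 + g) ^ 3)\<^sup>2" by (simp add: power_mult[symmetric])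
    also have "\<dots> \<le> (1 + 31/10 * g)\<^sup>2" using c3 g by (intro power_mono) auto
    also have "\<dots> = 1 + 62/10 * g + 961/100 * g\<^sup>2" by (simp add: power2_eq_square algebra_simps)
    finally have c6: "(1 + g) ^ 6 \<le> 1 + 62/10 * g + 961/100 * g\<^sup>2" .
    have "3 * g * (1 + g) ^ 3 \<le> 3 * g * (1 + 31/10 * g)" using c3 g by (intro mult_left_mono) auto
    also have "\<dots> = 3 * g + 93/10 * g\<^sup>2" by (simp add: power2_eq_square algebra_simps)
    finally show ?thesis using c6 gg g by linarith
  qed
  have XY: "(1 + g) * ((real 0 + g * real (0 + v)) * z * sqrt p) + (1 + g) ^ 3 * (z ^ 3 * sqrt p / 6) \<le>
    sqrt 2 / 3 * (1 + 10 * g) * ?S"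
  proof -
    have "sqrt 2 / 3 * (3 * g * (1 + g) ^ 3) * ?S + sqrt 2 / 3 * (1 + g) ^ 6 * ?S =
      sqrt 2 / 3 * (3 * g * (1 + g) ^ 3 + (1 + g) ^ 6) * ?S" by (simp only: distrib_left distrib_right)
    also have "\<dots> \<le> sqrt 2 / 3 * (1 + 10 * g) * ?S"
      using coef s by (intro mult_right_mono mult_left_mono) auto
    finally show ?thesis using X Y by linarith
  qed
  have total: "comp_rate n e ((1 + g) * t) - real (0 + v) * t + (1 + g) * ((real 0 + g * real (0 + v)) * z * sqrt p) +
     (1 + g) ^ 3 * (z ^ 3 * sqrt p / 6) \<le> - (e / (2 * 10 ^ 7)) * real v"
  proof -
    have vt: "real (0 + v) * t = real n * (t\<^sup>2 * (e + t))" unfolding vq[unfolded tq[symmetric]] add_0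
      by (simp add: power2_eq_square)
    have "real n * ((e + (1 + g) * t)\<^sup>2 * (2 * ((1 + g) * t) - e) / 6 - t\<^sup>2 * (e + t) + sqrt 2 / 3 * (1 + 10 * g) * s ^ 3)
      \<le> real n * (- (1 / 10 ^ 7) * t ^ 3)"
      using g e te s tq by (intro mult_left_mono core_rate_negative) auto
    moreover have "real n * ((e + (1 + g) * t)\<^sup>2 * (2 * ((1 + g) * t) - e) / 6 - t\<^sup>2 * (e + t) + sqrt 2 / 3 * (1 + 10 * g) * s ^ 3)
      = comp_rate n e ((1 + g) * t) - real (0 + v) * t + sqrt 2 / 3 * (1 + 10 * g) * ?S"
      unfolding vt comp_rate_def by (simp add: algebra_simps)
    moreover have "real n * (- (1 / 10 ^ 7) * t ^ 3) \<le> - (e / (2 * 10 ^ 7)) * real v"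
    proof -
      have "q \<le> 2 * t\<^sup>2" using tq et t0 mult_left_mono[OF et t0] by (simp add: power2_eq_square algebra_simps)
      then have "real n * q * e \<le> real n * (2 * t\<^sup>2) * t" using et e n0 by (intro mult_mono mult_left_mono) auto
      then have "real v * e \<le> 2 * (real n * t ^ 3)" unfolding vq by (simp add: power2_eq_square power3_eq_cube)
      then show ?thesis by (simp add: field_simps)
    qed
    ultimately show ?thesis using XY by linarith
  qed
  have "rprob p (all_edges n) (ev_cert n g 0 v) \<le> exp 6 / (real (max 1 0) * (g\<^sup>2 * real (0 + v))) *
    exp (comp_rate n e ((1 + g) * t) - real (0 + v) * t +
      (1 + g) * ((real 0 + g * real (0 + v)) * sqrt (2 * (real v + g * real (0 + v))) * sqrt p) + (1 + g) ^ 3 * (sqrt (2 * (real v + g * real (0 + v))) ^ 3 * sqrt p / 6))"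
    using v v0 g e e1 g1 cond t0 tg by (intro rprob_ev_cert[OF n p]) auto
  also have "\<dots> \<le> exp 6 / (g\<^sup>2 * (401/200 * (e\<^sup>2 * real n))) * exp (- (e / (2 * 10 ^ 7)) * real v)"
  proof (intro mult_mono)
    have pos: "0 < g\<^sup>2 * (401/200 * (e\<^sup>2 * real n))" using g e n0 by simp
    have pos2: "0 < real (max 1 0) * (g\<^sup>2 * real (0 + v))" using g v0 by simp
    have "g\<^sup>2 * (401/200 * (e\<^sup>2 * real n)) \<le> real (max 1 0) * (g\<^sup>2 * real (0 + v))"
      using v(2) g by (simp add: mult_left_mono)
    then show "exp 6 / (real (max 1 0) * (g\<^sup>2 * real (0 + v))) \<le> exp 6 / (g\<^sup>2 * (401/200 * (e\<^sup>2 * real n)))"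
      by (rule divide_left_mono[OF _ _ mult_pos_pos[OF pos2 pos]]) simp
  qed (use total in \<open>simp_all add: z_def\<close>)
  finally show ?thesis .
qed

section \<open>Dense vertex sets and components of linear size\<close>

lemma power_le_exp_fact:
  fixes x :: real
  assumes "0 \<le> x"
  shows "x ^ i \<le> exp x * fact i"
proof -
  have "x ^ i / fact i \<le> (\<Sum>i\<le>i. x ^ i / fact i)"
    using assms by (intro member_le_sum[where f = "\<lambda>i. x ^ i / fact i"]) auto
  also have "\<dots> \<le> exp x" by (rule exp_partial_sum_le[OF assms])
  finally show ?thesis by (simp add: field_simps)
qed

lemma binomial_le_exp_power:
  assumes "1 \<le> k"
  shows "real (m choose k) \<le> (exp 1 * real m / real k) ^ k"
proof -
  have "real (m choose k) * fact k \<le> real m ^ k"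
    using binomial_fact_pow[of m k] by (metis of_nat_fact of_nat_le_iff of_nat_mult of_nat_power)
  then have "exp (real k) * (real (m choose k) * fact k) \<le> exp (real k) * real m ^ k"
    by (intro mult_left_mono) auto
  moreover have "real (m choose k) * real k ^ k \<le> real (m choose k) * (exp (real k) * fact k)"
    by (intro mult_left_mono power_le_exp_fact) auto
  moreover have "real (m choose k) * (exp (real k) * fact k) = exp (real k) * (real (m choose k) * fact k)"
    by (simp only: mult_ac)
  ultimately have "real (m choose k) * real k ^ k \<le> exp (real k) * real m ^ k" by linarith
  then have "real (m choose k) * real k ^ k \<le> real m ^ k * exp (real k)" by (simp only: mult.commute)
  then have "real (m choose k) \<le> real m ^ k * exp (real k) / real k ^ k"
    using assms by (simp add: pos_le_divide_eq)
  also have "exp (real k) = exp 1 ^ k" using exp_of_nat_mult[of k 1] by simp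
  finally show ?thesis by (simp add: power_mult_distrib power_divide mult.commute)
qed

text \<open>Choosing the set costs \<open>(exp 1 * n / v) ^ v\<close>, which \<open>q ^ v\<close>
  reduces to \<open>exp (2 * v)\<close>. The at least \<open>c * v\<close> surplus edges contribute
  at most \<open>exp (- 3 * v)\<close>.\<close>

lemma dense_sets_bound:
  fixes c p :: real
  assumes v: "1 \<le> v" "0 < n" and p: "0 \<le> p" "p \<le> 2 / real n" and c: "0 < c"
    and m: "(1 + c) * real v \<le> real m" and q: "exp 1 * real v / real n \<le> exp (- 3 / c)"
  shows "real (n choose v) * real ((v choose 2) choose m) * p ^ m \<le> exp (- real v)"
proof -
  define q where "q = exp 1 * real v / real n"
  have q0: "0 < q" using v unfolding q_def by simp
  have "0 \<le> c * real v" using c by simp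
  then have vm: "real v \<le> real m" using m by (simp add: distrib_right)
  then have m1: "1 \<le> m" "v \<le> m" using v by auto
  have "real ((v choose 2) choose m) \<le> (exp 1 * real (v choose 2) / real m) ^ m"
    by (rule binomial_le_exp_power[OF m1(1)])
  also have "\<dots> \<le> (exp 1 * real v / 2) ^ m"
  proof (rule power_mono)
    have "real (v choose 2) \<le> real v * real v / 2"
    proof -
      have "(v choose 2) * 2 \<le> v * (v - 1)" unfolding choose_two by (rule div_times_less_eq_dividend)
      also have "\<dots> \<le> v * v" by (intro mult_le_mono2) simp
      finally have "(v choose 2) * 2 \<le> v * v" .
      then have "real ((v choose 2) * 2) \<le> real (v * v)" by (simp only: of_nat_le_iff)
      then show ?thesis by simp
    qed
    also have "\<dots> \<le> real v * real m / 2" using vm by (intro divide_right_mono mult_left_mono) auto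
    finally show "exp 1 * real (v choose 2) / real m \<le> exp 1 * real v / 2"
      using m1 by (simp add: field_simps)
  qed simp
  finally have "real ((v choose 2) choose m) * p ^ m \<le> (exp 1 * real v / 2) ^ m * (2 / real n) ^ m"
    using p by (intro mult_mono power_mono) auto
  also have "\<dots> = q ^ m" unfolding q_def by (simp add: power_mult_distrib[symmetric])
  also have "q ^ m = q ^ v * q ^ (m - v)" using m1 by (simp add: power_add[symmetric])
  finally have 1: "real ((v choose 2) choose m) * p ^ m \<le> q ^ v * q ^ (m - v)" .
  have 2: "q ^ (m - v) \<le> exp (- 3 * real v)"
  proof -
    have "q ^ (m - v) \<le> exp (- 3 / c) ^ (m - v)" using q q0 unfolding q_def[symmetric] by (intro power_mono) auto
    also have "\<dots> = exp (real (m - v) * (- 3 / c))" by (rule exp_of_nat_mult[symmetric])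
    also have "\<dots> \<le> exp (- 3 * real v)"
    proof -
      have "c * real v \<le> real (m - v)" using m m1 by (simp add: of_nat_diff algebra_simps)
      moreover have "d * (- 3 / c) \<le> - 3 * x" if "c * x \<le> d" for d x :: real
        using that c by (simp add: field_simps)
      ultimately show ?thesis by (simp only: exp_le_cancel_iff)
    qed
    finally show ?thesis .
  qed
  have "real (n choose v) * (real ((v choose 2) choose m) * p ^ m) \<le>
    (exp 1 * real n / real v) ^ v * (q ^ v * exp (- 3 * real v))"
    using binomial_le_exp_power[OF v(1), of n] 1 2 q0 p
    by (intro mult_mono order_trans[OF 1] mult_left_mono) auto
  also have "\<dots> = (exp 1 * exp 1) ^ v * exp (- 3 * real v)"
    unfolding q_def using v by (simp add: power_mult_distrib[symmetric] mult.assoc[symmetric])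
  also have "(exp 1 * exp 1) ^ v = exp (2 * real v)"
    unfolding mult_exp_exp exp_of_nat_mult[symmetric] by (simp add: mult.commute)
  also have "exp (2 * real v) * exp (- 3 * real v) = exp (- real v)" unfolding mult_exp_exp by simp
  finally show ?thesis by (simp only: mult.assoc)
qed

text \<open>Over \<open>t\<close> steps the unseen vertices are depleted by a fraction averaging
  about \<open>t / (2 n)\<close>, which outweighs the supercritical drift \<open>e\<close> because
  \<open>e \<le> c / 16\<close>. The exponential parameter \<open>x = c / 16\<close> is small enough
  that its second-order terms do not spoil this.\<close>

lemma large_component_bound:
  fixes c e p :: real
  assumes n: "2 \<le> n" and p: "p = (1 + e) / real n" and c: "0 < c" "c \<le> 1" and e: "0 \<le> e" "e \<le> c / 16"
    and cn: "4 \<le> c * real n"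
  defines "x \<equiv> c / 16" and "t \<equiv> nat \<lfloor>c * real n\<rfloor>"
  shows "rprob p (all_edges n) (\<lambda>E. \<exists>u\<in>{1..n}. survives E {u} ({1..n} - {u}) t)
    \<le> real n * exp (x - 4 * x\<^sup>2 * (c * real n - 1))"
proof -
  have p01: "0 \<le> p" "p \<le> 1" using n e c unfolding p by (auto simp: field_simps)
  have x: "0 < x" "x \<le> 1/16" using c unfolding x_def by auto
  have tr: "real t \<le> c * real n" "c * real n - 1 \<le> real t" using cn unfolding t_def by linarith+
  \<comment> \<open>Since \<open>c * n \<ge> 4\<close>, subtracting 1 for the rounding leaves at
    least three quarters of \<open>c * n\<close>, which is \<open>12 * x * n\<close>.\<close>
  have t34: "12 * x * real n \<le> real t" using tr cn unfolding x_def by linarith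
  have ex: "exp x - 1 \<le> x * (1 + x)" using exp_bound[of x] x by (simp add: power2_eq_square algebra_simps)
  have pn: "p * real n = 1 + e" using n unfolding p by simp
  have "p * (real n * real t - real t * (real t + 1) / 2) \<le> (1 + x) * (real t * (1 - 6 * x))"
  proof -
    have "real n * real t - real t * (real t + 1) / 2 \<le> real n * real t - real t * (12 * x * real n) / 2"
      using mult_left_mono[OF t34, of "real t"] by (simp add: algebra_simps)
    also have "\<dots> = real n * (real t * (1 - 6 * x))" by (simp add: algebra_simps)
    finally have "p * (real n * real t - real t * (real t + 1) / 2) \<le> p * (real n * (real t * (1 - 6 * x)))"
      using p01 by (intro mult_left_mono) auto
    also have "\<dots> = (1 + e) * (real t * (1 - 6 * x))" using pn by (simp only: mult.assoc[symmetric])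
    also have "\<dots> \<le> (1 + x) * (real t * (1 - 6 * x))" using e x unfolding x_def by (intro mult_right_mono) auto
    finally show ?thesis .
  qed
  then have "(exp x - 1) * (p * (real n * real t - real t * (real t + 1) / 2)) \<le> (exp x - 1) * ((1 + x) * (real t * (1 - 6 * x)))"
    using x by (intro mult_left_mono) auto
  also have "\<dots> \<le> (x * (1 + x)) * ((1 + x) * (real t * (1 - 6 * x)))"
    using ex x by (intro mult_right_mono) auto
  also have "\<dots> = (x * real t) * ((1 + x)\<^sup>2 * (1 - 6 * x))" by (simp add: power2_eq_square)
  also have "\<dots> \<le> (x * real t) * (1 - 4 * x)"
  proof (rule mult_left_mono)
    have "(1 + x)\<^sup>2 * (1 - 6 * x) = 1 - 4 * x - 11 * x\<^sup>2 - 6 * x ^ 3"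
      by (simp add: power2_eq_square power3_eq_cube algebra_simps)
    moreover have "0 \<le> x\<^sup>2" "0 \<le> x ^ 3" using x by auto
    ultimately show "(1 + x)\<^sup>2 * (1 - 6 * x) \<le> 1 - 4 * x" by linarith
  qed (use x in simp)
  finally have main: "p * (exp x - 1) * (real n * real t - real t * (real t + 1) / 2) \<le> x * real t * (1 - 4 * x)"
    by (simp only: mult_ac)
  have "rprob p (all_edges n) (\<lambda>E. \<exists>u\<in>{1..n}. survives E {u} ({1..n} - {u}) t)
    \<le> real n * exp (x * (1 - real t) + p * (exp x - 1) * (real n * real t - real t * (real t + 1) / 2))"
    using x by (intro rprob_large_component p01) auto
  also have "\<dots> \<le> real n * exp (x - 4 * x\<^sup>2 * (c * real n - 1))"
  proof (intro mult_left_mono)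
    have "x * (1 - real t) + p * (exp x - 1) * (real n * real t - real t * (real t + 1) / 2) \<le> x - 4 * x\<^sup>2 * real t"
      using main by (simp add: algebra_simps power2_eq_square)
    also have "\<dots> \<le> x - 4 * x\<^sup>2 * (c * real n - 1)"
      using mult_left_mono[OF tr(2), of "4 * x\<^sup>2"] by simp
    finally show "exp (x * (1 - real t) + p * (exp x - 1) * (real n * real t - real t * (real t + 1) / 2)) \<le>
      exp (x - 4 * x\<^sup>2 * (c * real n - 1))" by simp
  qed simp
  finally show ?thesis .
qed

text \<open>A long cycle entails one of five events: a component of linear size, a dense core, a
  core that is a bare cycle, a core of at most \<open>V1\<close> vertices with the cycle marked, or
  a larger core with nothing marked. Beyond \<open>V1\<close> the cycle is forgotten because the
  exponent for marked cores soon changes sign there.\<close>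

lemma rprob_long_cycle:
  fixes c e g p :: real
  assumes n: "2 \<le> n" and p: "p = (1 + e) / real n" and e: "0 < e" "e \<le> g / 2" "e \<le> c / 16"
    and g: "0 < g" "g \<le> 1 / 10 ^ 10"
    and c: "0 < c" "c \<le> g\<^sup>2 / 4" "exp 1 * c \<le> exp (- 9 / g)" "4 \<le> c * real n" and N: "1 \<le> e\<^sup>2 * real n"
  shows "rprob p (all_edges n) (\<lambda>E. \<exists>vs. is_cycle E vs \<and> 1739/1000 * (e\<^sup>2 * real n) \<le> real (length vs)) \<le>
    real n * exp (c / 16 - 4 * (c / 16)\<^sup>2 * (c * real n - 1)) + (2 * exp (- (e\<^sup>2 * real n)) +
    (2 * exp 6 / (e ^ 3 * real n) + (6 * exp 6 / g\<^sup>2 * exp (- (e ^ 3 * real n) / 250) +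
     4 * 10 ^ 7 * exp 6 / (g\<^sup>2 * (e ^ 3 * real n)))))"
proof -
  define Nn where "Nn = e\<^sup>2 * real n"
  define L where "L = 1739/1000 * Nn"
  define V1 where "V1 = 401/200 * Nn"
  define \<mu> where "\<mu> = e ^ 3 * real n"
  define t where "t = nat \<lfloor>c * real n\<rfloor>"
  define P where "P = rexp p (all_edges n)"
  have n0: "0 < real n" using n by simp
  have g1: "g \<le> 1/100" using g by simp
  have gsq: "g\<^sup>2 \<le> 1" using g g1 by (intro power_le_one) auto
  have c1: "c \<le> 1" using c(2) gsq by linarith
  have N0: "1 \<le> Nn" using N unfolding Nn_def .
  have \<mu>0: "0 < \<mu>" using e n0 unfolding \<mu>_def by simp
  have Ne: "Nn * e = \<mu>" unfolding Nn_def \<mu>_def by (simp add: power2_eq_square power3_eq_cube)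
  have L1: "1 < L" "0 < V1" using N0 unfolding L_def V1_def by auto
  have p01: "0 \<le> p" "p \<le> 1" "p \<le> 2 / real n"
    using n e g1 unfolding p by (auto simp: field_simps)
  define m where "m v = nat \<lceil>(1 + g / 3) * real v\<rceil>" for v
  define Eb where "Eb E \<longleftrightarrow> (\<exists>u\<in>{1..n}. survives E {u} ({1..n} - {u}) t)" for E
  define Id where "Id = {v. v \<le> n \<and> L \<le> real v \<and> real v \<le> c * real n}"
  define Ed where "Ed v E \<longleftrightarrow> (\<exists>U\<subseteq>{1..n}. card U = v \<and> m v \<le> card {e\<in>E. e \<subseteq> U})" for v E
  define I3 where "I3 = {l. l \<le> n \<and> 3 \<le> l \<and> L \<le> real l}"
  define I2 where "I2 = {(l, w). 3 \<le> l \<and> L \<le> real l \<and> l + w \<le> n \<and> real (l + w) \<le> V1}"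
  define I1 where "I1 = {v. v \<le> n \<and> V1 \<le> real v \<and> real v \<le> c * real n}"
  have "P (\<lambda>E. of_bool (\<exists>vs. is_cycle E vs \<and> L \<le> real (length vs))) \<le>
    P (\<lambda>E. of_bool (Eb E)) + (P (\<lambda>E. of_bool (\<exists>v\<in>Id. Ed v E)) + (P (\<lambda>E. of_bool (\<exists>l\<in>I3. ev_pure_cycle n l E)) +
     (P (\<lambda>E. of_bool (\<exists>q\<in>I2. ev_cert n g (fst q) (snd q) E)) + P (\<lambda>E. of_bool (\<exists>v\<in>I1. ev_cert n g 0 v E)))))"
    (is "_ \<le> _ + ?R")
  proof -
    have "Eb E \<or> (\<exists>v\<in>Id. Ed v E) \<or> (\<exists>l\<in>I3. ev_pure_cycle n l E) \<or> (\<exists>q\<in>I2. ev_cert n g (fst q) (snd q) E)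
        \<or> (\<exists>v\<in>I1. ev_cert n g 0 v E)"
      if E: "E \<subseteq> all_edges n" and A: "\<exists>vs. is_cycle E vs \<and> L \<le> real (length vs)" for E
    proof -
      obtain vs where vs: "is_cycle E vs" "L \<le> real (length vs)" using A by blast
      have l3: "3 \<le> length vs" using vs(1) unfolding is_cycle_def by simp
      show ?thesis
      proof (rule cycle_certificate[OF E vs(1)])
      fix U j assume U: "U \<subseteq> {1..n}" "card U + j \<le> n" "length vs \<le> card U"
        "\<And>t. survives E {vs ! 0} ({1..n} - {vs ! 0}) t \<or> card U + j < t" "vs ! 0 \<in> {1..n}"
        and c1': "\<exists>b a m. 3 * b + a = 2 * m \<and> has_cert n (length vs) (card U - length vs) b a j E \<and>
          card {e \<in> E. e \<subseteq> U} = card U + (m - b)"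
        and c2': "(\<exists>b a m. 3 * b + a = 2 * m \<and> 1 \<le> m \<and> has_cert n 0 (card U) b a j E \<and>
          card {e \<in> E. e \<subseteq> U} = card U + (m - b)) \<or> card U = length vs \<and> has_cert n (length vs) 0 0 0 j E"
      show ?thesis
      proof (cases "survives E {vs ! 0} ({1..n} - {vs ! 0}) t")
        case True
        then have "Eb E" using U(5) unfolding Eb_def by blast
        then show ?thesis by blast
      next
        case False
        define v where "v = card U"
        have "v + j < t" using U(4)[of t] False unfolding v_def by simp
        then have "real v < real t" by simp
        also have "real t \<le> c * real n" unfolding t_def using c n0 by (simp add: of_nat_nat)
        finally have vc: "real v \<le> c * real n" by simp
        have Lv: "L \<le> real v" using vs(2) U(3) unfolding v_def by linarith
        have vn: "v \<le> n" using U(2) unfolding v_def by simp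
        show ?thesis
        proof (cases "m v \<le> card {e\<in>E. e \<subseteq> U}")
          case True
          then have "Ed v E" unfolding Ed_def using U(1) v_def by blast
          then show ?thesis using vc Lv vn unfolding Id_def by blast
        next
          case False
          then have "real (card {e\<in>E. e \<subseteq> U}) < (1 + g / 3) * real v" unfolding m_def by linarith
          then have small: "real k \<le> g * real v" if "3 * b + a = 2 * k" "card {e\<in>E. e \<subseteq> U} = card U + (k - b)" for a b k
          proof -
            have "real (card U + (k - b)) < (1 + g / 3) * real v"
              using \<open>real (card {e\<in>E. e \<subseteq> U}) < (1 + g / 3) * real v\<close> that(2) by simp
            then have "real (k - b) < g / 3 * real v" unfolding v_def by (simp add: algebra_simps)
            \<comment> \<open>Each branch vertex uses three of the \<open>2 * k\<close> half-edges,
              so \<open>k\<close> is at most three times the excess. Hence the density threshold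
              \<open>g / 3\<close>, and the \<open>9 / g\<close> in the condition on
              \<open>c\<close>.\<close>
            moreover have "k \<le> 3 * (k - b)" using that(1) by linarith
            then have "real k \<le> 3 * real (k - b)" by linarith
            ultimately show ?thesis by (simp add: field_simps)
          qed
          have pure: "\<exists>l\<in>I3. ev_pure_cycle n l E" if "card U = length vs" "has_cert n (length vs) 0 0 0 j E"
          proof
            show "length vs \<in> I3" using l3 vs(2) vn that(1) unfolding I3_def v_def by simp
            show "ev_pure_cycle n (length vs) E" unfolding ev_pure_cycle_def using that U(2) by auto
          qed
          show ?thesis
          proof (cases "real v \<le> V1")
            case True
            obtain b a k where k: "3 * b + a = 2 * k" "has_cert n (length vs) (card U - length vs) b a j E"
              "card {e \<in> E. e \<subseteq> U} = card U + (k - b)" using c1' by blast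
            show ?thesis
            proof (cases "k = 0")
              case True
              then have "b = 0" "a = 0" using k(1) by auto
              then have hc: "has_cert n (length vs) (card U - length vs) 0 0 j E" using k(2) by simp
              then have "card U - length vs = 0" by (rule has_cert_tree_like)
              then show ?thesis using pure hc U(3) by simp
            next
              case False
              have sumv: "length vs + (card U - length vs) = v" using U(3) unfolding v_def by simp
              have "ev_cert n g (length vs) (card U - length vs) E"
                unfolding ev_cert_def sumv using k False small[OF k(1,3)] U(2) unfolding v_def[symmetric]
                by (intro exI[of _ j] exI[of _ b] exI[of _ a] exI[of _ k]) (simp add: v_def)
              moreover have "(length vs, card U - length vs) \<in> I2"
                unfolding I2_def using l3 vs(2) vn True sumv by simp
              ultimately show ?thesis by force
            qed
          next
            case big: False
            from c2' show ?thesis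
            proof
              assume "\<exists>b a m. 3 * b + a = 2 * m \<and> 1 \<le> m \<and> has_cert n 0 (card U) b a j E \<and>
                card {e \<in> E. e \<subseteq> U} = card U + (m - b)"
              then obtain b a k where k: "3 * b + a = 2 * k" "1 \<le> k" "has_cert n 0 v b a j E"
                "card {e \<in> E. e \<subseteq> U} = card U + (k - b)" unfolding v_def by blast
              have "ev_cert n g 0 v E" unfolding ev_cert_def add_0
                using k small[OF k(1,4)] U(2) unfolding v_def[symmetric] by blast
              moreover have "v \<in> I1" using vn big vc unfolding I1_def by simp
              ultimately show ?thesis by blast
            next
              assume "card U = length vs \<and> has_cert n (length vs) 0 0 0 j E"
              then show ?thesis using pure by blast
            qed
          qed
        qed
      qed
      qed
    qed
    note dichotomy = this
    let ?X3 = "\<lambda>E. \<exists>l\<in>I3. ev_pure_cycle n l E" and ?X2 = "\<lambda>E. \<exists>q\<in>I2. ev_cert n g (fst q) (snd q) E"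
      and ?X1 = "\<lambda>E. \<exists>v\<in>I1. ev_cert n g 0 v E" and ?Xd = "\<lambda>E. \<exists>v\<in>Id. Ed v E"
    have "P (\<lambda>E. of_bool (\<exists>vs. is_cycle E vs \<and> L \<le> real (length vs))) \<le>
      P (\<lambda>E. of_bool (Eb E)) + P (\<lambda>E. of_bool (?Xd E \<or> ?X3 E \<or> ?X2 E \<or> ?X1 E))"
      unfolding P_def by (rule rprob_le_disj[OF p01(1,2)]) (rule dichotomy)
    moreover have "P (\<lambda>E. of_bool (?Xd E \<or> ?X3 E \<or> ?X2 E \<or> ?X1 E)) \<le>
      P (\<lambda>E. of_bool (?Xd E)) + P (\<lambda>E. of_bool (?X3 E \<or> ?X2 E \<or> ?X1 E))"
      unfolding P_def by (rule rprob_le_disj[OF p01(1,2)])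
    moreover have "P (\<lambda>E. of_bool (?X3 E \<or> ?X2 E \<or> ?X1 E)) \<le>
      P (\<lambda>E. of_bool (?X3 E)) + P (\<lambda>E. of_bool (?X2 E \<or> ?X1 E))"
      unfolding P_def by (rule rprob_le_disj[OF p01(1,2)])
    moreover have "P (\<lambda>E. of_bool (?X2 E \<or> ?X1 E)) \<le> P (\<lambda>E. of_bool (?X2 E)) + P (\<lambda>E. of_bool (?X1 E))"
      unfolding P_def by (rule rprob_le_disj[OF p01(1,2)])
    ultimately show ?thesis by linarith
  qed
  moreover have "P (\<lambda>E. of_bool (Eb E)) \<le> real n * exp (c / 16 - 4 * (c / 16)\<^sup>2 * (c * real n - 1))"
    unfolding P_def Eb_def t_def using c c1 e by (intro large_component_bound[OF n p]) auto
  moreover have "P (\<lambda>E. of_bool (\<exists>v\<in>Id. Ed v E)) \<le> 2 * exp (- Nn)"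
  proof -
    have finId: "finite Id" unfolding Id_def by (rule finite_subset[of _ "{..n}"]) auto
    have "P (\<lambda>E. of_bool (\<exists>v\<in>Id. Ed v E)) \<le> (\<Sum>v\<in>Id. P (\<lambda>E. of_bool (Ed v E)))"
      unfolding P_def by (rule rprob_le_sum[OF p01(1,2) finId]) auto
    also have "\<dots> \<le> (\<Sum>v\<in>Id. exp (- 1 * real v))"
    proof (rule sum_mono)
      fix v assume v: "v \<in> Id"
      then have v': "v \<le> n" "L \<le> real v" "real v \<le> c * real n" unfolding Id_def by auto
      have "P (\<lambda>E. of_bool (Ed v E)) \<le> real (n choose v) * real ((v choose 2) choose m v) * p ^ m v"
        unfolding P_def Ed_def by (rule rprob_dense[OF p01(1,2)])
      also have "\<dots> \<le> exp (- real v)"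
      proof (rule dense_sets_bound[where c = "g / 3"])
        show "1 \<le> v" using v'(2) L1 by linarith
        show "(1 + g / 3) * real v \<le> real (m v)" unfolding m_def by (rule real_nat_ceiling_ge)
        have "real v / real n \<le> c" using v'(3) n0 by (simp add: field_simps)
        then have "exp 1 * (real v / real n) \<le> exp 1 * c" by (intro mult_left_mono) auto
        then show "exp 1 * real v / real n \<le> exp (- 3 / (g / 3))" using c(3) by simp
      qed (use n p01 g in auto)
      finally show "P (\<lambda>E. of_bool (Ed v E)) \<le> exp (- 1 * real v)" by simp
    qed
    also have "\<dots> \<le> (\<Sum>v | v \<le> n \<and> L \<le> real v. exp (- 1 * real v))"
      unfolding Id_def by (intro sum_mono2) auto
    also have "\<dots> \<le> 2 / 1 * exp (- 1 * L)" by (rule geometric_tail_le) auto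
    also have "\<dots> \<le> 2 * exp (- Nn)" using N0 unfolding L_def by simp
    finally show ?thesis .
  qed
  moreover have "P (\<lambda>E. of_bool (\<exists>l\<in>I3. ev_pure_cycle n l E)) \<le> 2 * exp 6 / \<mu>"
  proof -
    have "finite I3" unfolding I3_def by (rule finite_subset[of _ "{..n}"]) auto
    then have "P (\<lambda>E. of_bool (\<exists>l\<in>I3. ev_pure_cycle n l E)) \<le> (\<Sum>l\<in>I3. P (\<lambda>E. of_bool (ev_pure_cycle n l E)))"
      unfolding P_def by (intro rprob_le_sum[OF p01(1,2)]) auto
    also have "\<dots> \<le> 2 * exp 6 / \<mu>"
      unfolding P_def I3_def L_def Nn_def \<mu>_def by (rule pure_cycles_bound[OF n p e(1,2) g])
    finally show ?thesis .
  qed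
  moreover have "P (\<lambda>E. of_bool (\<exists>q\<in>I2. ev_cert n g (fst q) (snd q) E)) \<le> 6 * exp 6 / g\<^sup>2 * exp (- \<mu> / 250)"
  proof -
    let ?k = "nat \<lfloor>V1\<rfloor>"
    have sub: "I2 \<subseteq> {..?k} \<times> {..?k}" unfolding I2_def using le_nat_floor by fastforce
    then have fin: "finite I2" by (rule finite_subset) simp
    have "real (card I2) \<le> real (card ({..?k} \<times> {..?k}))"
      unfolding of_nat_le_iff by (rule card_mono[OF _ sub]) simp
    also have "\<dots> = (real ?k + 1)\<^sup>2"
      by (simp add: card_cartesian_product power2_eq_square algebra_simps)
    also have "\<dots> \<le> (2 * V1)\<^sup>2"
    proof (rule power_mono)
      have "real ?k \<le> V1" using L1 by (simp add: of_nat_nat)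
      moreover have "1 \<le> V1" using N0 unfolding V1_def by simp
      ultimately show "real ?k + 1 \<le> 2 * V1" by linarith
    qed simp
    finally have cI: "real (card I2) \<le> (2 * V1)\<^sup>2" .
    have "P (\<lambda>E. of_bool (\<exists>q\<in>I2. ev_cert n g (fst q) (snd q) E)) \<le> (\<Sum>q\<in>I2. P (\<lambda>E. of_bool (ev_cert n g (fst q) (snd q) E)))"
      unfolding P_def by (intro rprob_le_sum[OF p01(1,2) fin]) auto
    also have "\<dots> \<le> (\<Sum>q\<in>I2. exp 6 / (g\<^sup>2 * L\<^sup>2) * exp (- \<mu> / 250))"
    proof (rule sum_mono)
      fix q assume "q \<in> I2"
      then have q: "3 \<le> fst q" "L \<le> real (fst q)" "fst q + snd q \<le> n" "real (fst q + snd q) \<le> V1"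
        unfolding I2_def by auto
      show "P (\<lambda>E. of_bool (ev_cert n g (fst q) (snd q) E)) \<le> exp 6 / (g\<^sup>2 * L\<^sup>2) * exp (- \<mu> / 250)"
        using q unfolding P_def L_def V1_def Nn_def \<mu>_def by (intro small_core_bound[OF n p e(1,2) g])
    qed
    also have "\<dots> = real (card I2) * (exp 6 / (g\<^sup>2 * L\<^sup>2) * exp (- \<mu> / 250))" by simp
    also have "\<dots> \<le> (2 * V1)\<^sup>2 * (exp 6 / (g\<^sup>2 * L\<^sup>2) * exp (- \<mu> / 250))"
      using cI by (intro mult_right_mono) auto
    also have "\<dots> = (2 * V1 / L)\<^sup>2 * (exp 6 / g\<^sup>2 * exp (- \<mu> / 250))" by (simp add: power_divide)
    \<comment> \<open>The number of pairs, at most \<open>(2 * V1)\<^sup>2\<close>, meets the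
      prefactor \<open>1 / L\<^sup>2\<close>, and the core scale cancels completely.\<close>
    also have "2 * V1 / L = 4010 / 1739" using N0 unfolding V1_def L_def by simp
    also have "(4010 / 1739)\<^sup>2 * (exp 6 / g\<^sup>2 * exp (- \<mu> / 250)) \<le> 6 * (exp 6 / g\<^sup>2 * exp (- \<mu> / 250))"
      by (intro mult_right_mono) (simp_all add: power2_eq_square)
    finally show ?thesis by simp
  qed
  moreover have "P (\<lambda>E. of_bool (\<exists>v\<in>I1. ev_cert n g 0 v E)) \<le> 4 * 10 ^ 7 * exp 6 / (g\<^sup>2 * \<mu>)"
  proof -
    let ?x = "e / (2 * 10 ^ 7)"
    have x: "0 < ?x" "?x \<le> 1" using e g1 by auto
    have fin: "finite I1" unfolding I1_def by (rule finite_subset[of _ "{..n}"]) auto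
    have "P (\<lambda>E. of_bool (\<exists>v\<in>I1. ev_cert n g 0 v E)) \<le> (\<Sum>v\<in>I1. P (\<lambda>E. of_bool (ev_cert n g 0 v E)))"
      unfolding P_def by (intro rprob_le_sum[OF p01(1,2) fin]) auto
    also have "\<dots> \<le> (\<Sum>v\<in>I1. exp 6 / (g\<^sup>2 * V1) * exp (- ?x * real v))"
    proof (rule sum_mono)
      fix v assume "v \<in> I1"
      then have v: "v \<le> n" "V1 \<le> real v" "real v \<le> c * real n" unfolding I1_def by auto
      have "c * real n \<le> g\<^sup>2 / 4 * real n" using c(2) by (intro mult_right_mono) auto
      then have "real v \<le> g\<^sup>2 / 4 * real n" using v(3) by linarith
      then show "P (\<lambda>E. of_bool (ev_cert n g 0 v E)) \<le> exp 6 / (g\<^sup>2 * V1) * exp (- ?x * real v)"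
        using v unfolding P_def V1_def Nn_def by (intro large_core_bound[OF n p e(1,2) g]) auto
    qed
    also have "\<dots> \<le> exp 6 / (g\<^sup>2 * V1) * (\<Sum>v | v \<le> n \<and> V1 \<le> real v. exp (- ?x * real v))"
      unfolding sum_distrib_left I1_def using L1 by (intro sum_mono2) (auto intro: mult_nonneg_nonneg)
    also have "\<dots> \<le> exp 6 / (g\<^sup>2 * V1) * (2 / ?x * exp (- ?x * V1))"
      using L1 x by (intro mult_left_mono geometric_tail_le) auto
    also have "\<dots> \<le> exp 6 / (g\<^sup>2 * V1) * (2 / ?x * 1)"
    proof -
      have "exp (- ?x * V1) \<le> 1" using x L1 by (simp add: mult_nonneg_nonneg)
      then show ?thesis using L1 x by (intro mult_left_mono) auto
    qed
    \<comment> \<open>The prefactor \<open>1 / V1\<close> and the factor of order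
      \<open>1 / e\<close> from the geometric sum combine to order \<open>1 / \<mu>\<close>.\<close>
    also have "\<dots> = 4 * 10 ^ 7 * exp 6 / (g\<^sup>2 * (V1 * e))" using e by (simp add: mult_ac)
    also have "\<dots> \<le> 4 * 10 ^ 7 * exp 6 / (g\<^sup>2 * \<mu>)"
    proof -
      have "\<mu> \<le> V1 * e" using \<mu>0 unfolding V1_def Ne[symmetric] by simp
      then show ?thesis using \<mu>0 g L1 e by (intro divide_left_mono mult_left_mono mult_pos_pos) auto
    qed
    finally show ?thesis .
  qed
  ultimately show ?thesis unfolding P_def L_def Nn_def \<mu>_def by linarith
qed

subsection \<open>Long cycles in the uniform model\<close>

text \<open>\<open>Sup\<close> on the naturals is a maximum only for bounded sets; a cycle lies
  inside its core and so has at most \<open>n\<close> vertices.\<close>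

lemma circumference_attained:
  assumes E: "E \<subseteq> all_edges n" and c: "0 < circumference E"
  obtains vs where "is_cycle E vs" "length vs = circumference E"
proof -
  let ?S = "{length vs | vs. is_cycle E vs} \<union> {0}"
  have "?S \<subseteq> {..n}"
  proof
    fix k assume "k \<in> ?S"
    then consider "k = 0" | vs where "is_cycle E vs" "k = length vs" by auto
    then show "k \<in> {..n}"
    proof cases
      case 2
      obtain U j where "U \<subseteq> {1..n}" "length vs \<le> card U"
        using cycle_certificate[OF E 2(1)] by metis
      then show ?thesis using card_mono[of "{1..n}" U] 2(2) by simp
    qed simp
  qed
  then have "finite ?S" by (rule finite_subset) simp
  then have "circumference E = Max ?S" unfolding circumference_def by (intro cSup_eq_Max) auto
  then have "circumference E \<in> ?S" using Max_in[OF \<open>finite ?S\<close>] by simp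
  then show ?thesis using c that by auto
qed

text \<open>The slack constants \<open>g\<close> and \<open>c\<close> are fixed before
  \<open>n\<close>. Every error term is then dominated by a function of \<open>\<mu>\<close>
  vanishing at infinity, except the exploration term, which is exponentially small in
  \<open>n\<close>.\<close>

lemma long_cycle_prob_tendsto_0:
  fixes e :: "nat \<Rightarrow> real"
  assumes e0: "e \<longlonglongrightarrow> 0" and pos: "eventually (\<lambda>n. 0 < e n) sequentially"
    and \<mu>: "filterlim (\<lambda>n. e n ^ 3 * real n) at_top sequentially"
  shows "(\<lambda>n. rprob ((1 + e n) / real n) (all_edges n)
    (\<lambda>E. \<exists>vs. is_cycle E vs \<and> 1739/1000 * ((e n)\<^sup>2 * real n) \<le> real (length vs))) \<longlonglongrightarrow> 0"
proof -
  define g :: real where "g = 1 / 10 ^ 10"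
  define c where "c = min (g\<^sup>2 / 4) (exp (- 9 / g - 1))"
  have g: "0 < g" "g \<le> 1 / 10 ^ 10" unfolding g_def by auto
  have c0: "0 < c" "c \<le> g\<^sup>2 / 4" using g unfolding c_def by auto
  have c1: "exp 1 * c \<le> exp (- 9 / g)"
  proof -
    have "exp 1 * c \<le> exp 1 * exp (- 9 / g - 1)" unfolding c_def by (intro mult_left_mono) auto
    then show ?thesis unfolding mult_exp_exp by simp
  qed
  let ?P = "\<lambda>n. rprob ((1 + e n) / real n) (all_edges n)
    (\<lambda>E. \<exists>vs. is_cycle E vs \<and> 1739/1000 * ((e n)\<^sup>2 * real n) \<le> real (length vs))"
  define h where "h n = real n * exp (c / 16 - 4 * (c / 16)\<^sup>2 * (c * real n - 1))" for n
  define f where "f u = 2 * exp (- u) + (2 * exp 6 / u + (6 * exp 6 / g\<^sup>2 * exp (- u / 250) + 4 * 10 ^ 7 * exp 6 / (g\<^sup>2 * u)))" for u :: real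
  have h0: "h \<longlonglongrightarrow> 0"
  proof -
    define k where "k = 4 * (c / 16)\<^sup>2 * c"
    define d where "d = c / 16 + 4 * (c / 16)\<^sup>2"
    have k: "0 < k" unfolding k_def using c0 by simp
    have "h = (\<lambda>n. real n * exp (d - k * real n))" unfolding h_def k_def d_def by (auto simp: algebra_simps)
    moreover have "(\<lambda>n. real n * exp (d - k * real n)) \<longlonglongrightarrow> 0" using k by real_asymp
    ultimately show ?thesis by simp
  qed
  have "(f \<longlongrightarrow> 0) at_top"
  proof -
    define A where "A = exp (6::real)"
    define B where "B = 6 * exp 6 / g\<^sup>2"
    define C where "C = 4 * 10 ^ 7 * exp 6 / g\<^sup>2"
    have "f = (\<lambda>u. 2 * exp (- u) + (2 * A / u + (B * exp (- u / 250) + C / u)))"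
      unfolding f_def A_def B_def C_def by auto
    moreover have "((\<lambda>u. 2 * exp (- u) + (2 * A / u + (B * exp (- u / 250) + C / u))) \<longlongrightarrow> 0) at_top"
      by real_asymp
    ultimately show ?thesis by simp
  qed
  then have f0: "(\<lambda>n. f (e n ^ 3 * real n)) \<longlonglongrightarrow> 0" by (rule filterlim_compose[OF _ \<mu>])
  have "(\<lambda>n. h n + f (e n ^ 3 * real n)) \<longlonglongrightarrow> 0" using tendsto_add[OF h0 f0] by simp
  moreover have "eventually (\<lambda>n. norm (?P n) \<le> h n + f (e n ^ 3 * real n)) sequentially"
  proof -
    have e1: "eventually (\<lambda>n. e n < min (g / 2) (c / 16)) sequentially"
      using order_tendstoD(2)[OF e0, of "min (g / 2) (c / 16)"] g c0 by simp
    have e2: "eventually (\<lambda>n. 1 \<le> e n ^ 3 * real n) sequentially"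
      using \<mu> unfolding filterlim_at_top by blast
    have e3: "eventually (\<lambda>n::nat. 4 / c \<le> real n) sequentially"
      using filterlim_real_sequentially unfolding filterlim_at_top by blast
    show ?thesis
      using pos e1 e2 e3 eventually_ge_at_top[of "2::nat"]
    proof eventually_elim
      case (elim n)
      have en: "0 < e n" "e n \<le> g / 2" "e n \<le> c / 16" using elim by auto
      have e1: "e n \<le> 1" using en(2) g by simp
      have \<mu>N: "e n ^ 3 * real n \<le> (e n)\<^sup>2 * real n"
        using en e1 by (intro mult_right_mono power_decreasing) auto
      have cn: "4 \<le> c * real n" using elim(4) c0 by (simp add: field_simps)
      have "?P n \<le> h n + (2 * exp (- ((e n)\<^sup>2 * real n)) + (2 * exp 6 / (e n ^ 3 * real n) +
        (6 * exp 6 / g\<^sup>2 * exp (- (e n ^ 3 * real n) / 250) + 4 * 10 ^ 7 * exp 6 / (g\<^sup>2 * (e n ^ 3 * real n)))))"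
        unfolding h_def using elim \<mu>N by (intro rprob_long_cycle[OF elim(5) refl en g c0 c1 cn]) linarith
      also have "\<dots> \<le> h n + f (e n ^ 3 * real n)"
        unfolding f_def using \<mu>N by simp
      finally have "?P n \<le> h n + f (e n ^ 3 * real n)" .
      moreover have "0 \<le> ?P n"
        using en e1 elim(5) by (intro rexp_nonneg) (auto simp: field_simps)
      ultimately show "norm (?P n) \<le> h n + f (e n ^ 3 * real n)" by simp
    qed
  qed
  ultimately show ?thesis by (rule Lim_null_comparison[rotated])
qed

theorem theorem1:
  fixes M :: "nat \<Rightarrow> nat" and s :: "nat \<Rightarrow> real"
  assumes s_def: "\<And>n. s n = real (M n) - real n / 2"
    and s_small: "s \<in> o(\<lambda>n. real n)"
    and s_large: "(\<lambda>n. real n powr (2/3)) \<in> o(s)"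
  shows "\<exists>\<epsilon> :: nat \<Rightarrow> real. \<epsilon> \<longlonglongrightarrow> 0 \<and>
           (\<lambda>n. prob_Gnm n (M n)
                  (\<lambda>E. real (circumference E) \<le> (6.958 + \<epsilon> n) * (s n)\<^sup>2 / real n))
           \<longlonglongrightarrow> 1"
proof -
  \<comment> \<open>The factor 10001/10000 raises the expected number of edges above
    \<open>M\<close> by a fixed multiple of \<open>\<bar>s\<bar>\<close>. For negative
    \<open>s\<close> the absolute value leaves even more room.\<close>
  define e where "e n = 2 * (10001/10000) * \<bar>s n\<bar> / real n" for n
  define A where "A n E \<longleftrightarrow> (\<exists>vs. is_cycle E vs \<and> 1739/1000 * ((e n)\<^sup>2 * real n) \<le> real (length vs))" for n E
  define P where "P n = rprob ((1 + e n) / real n) (all_edges n) (A n)" for n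
  have small: "eventually (\<lambda>n. \<bar>s n\<bar> \<le> d * real n) sequentially" if "0 < d" for d
    using landau_o.smallD[OF s_small that] by simp
  have large: "eventually (\<lambda>n. real n powr (2/3) \<le> d * \<bar>s n\<bar>) sequentially" if "0 < d" for d
    using landau_o.smallD[OF s_large that] by simp
  have e0: "e \<longlonglongrightarrow> 0"
  proof (rule tendstoI)
    fix d :: real assume d: "0 < d"
    then have d4: "0 < d / 4" by simp
    show "eventually (\<lambda>n. dist (e n) 0 < d) sequentially"
      using small[OF d4] eventually_gt_at_top[of "0::nat"]
    proof eventually_elim
      case (elim n)
      have "\<bar>s n\<bar> / real n \<le> d / 4" using elim by (simp add: field_simps)
      moreover have "e n = 10001/5000 * (\<bar>s n\<bar> / real n)" unfolding e_def by simp
      moreover have "0 \<le> \<bar>s n\<bar> / real n" by simp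
      ultimately have "\<bar>e n\<bar> < d" using d by linarith
      then show ?case by simp
    qed
  qed
  have pos: "eventually (\<lambda>n. 0 < e n) sequentially"
    using large[OF zero_less_one] eventually_gt_at_top[of "0::nat"]
  proof eventually_elim
    case (elim n)
    have "0 < real n powr (2/3)" using elim(2) by simp
    then have "0 < \<bar>s n\<bar>" using elim(1) by linarith
    then show ?case using elim(2) unfolding e_def by simp
  qed
  have \<mu>: "filterlim (\<lambda>n. e n ^ 3 * real n) at_top sequentially"
    unfolding filterlim_at_top
  proof
    fix Z :: real
    define y where "y = max 1 Z"
    have y: "1 \<le> y" "Z \<le> y" unfolding y_def by auto
    have y': "0 < 1 / y" using y by simp
    show "eventually (\<lambda>n. Z \<le> e n ^ 3 * real n) sequentially"
      using large[OF y'] eventually_gt_at_top[of "0::nat"]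
    proof eventually_elim
      case (elim n)
      let ?r = "real n powr (2/3)"
      have n0: "0 < real n" using elim(2) by simp
      have r3: "?r ^ 3 = (real n)\<^sup>2"
      proof -
        have "0 < ?r" using n0 by simp
        from powr_realpow[OF this, of 3] have "?r ^ 3 = ?r powr real 3" by (rule sym)
        also have "\<dots> = real n powr (2/3 * real 3)" by (rule powr_powr)
        also have "2/3 * real 3 = real 2" by simp
        also have "real n powr real 2 = (real n)\<^sup>2" by (rule powr_realpow[OF n0])
        finally show ?thesis .
      qed
      have "y * ?r \<le> \<bar>s n\<bar>" using elim(1) y by (simp add: field_simps)
      then have "(y * ?r) ^ 3 \<le> \<bar>s n\<bar> ^ 3" using y by (intro power_mono) auto
      then have "y ^ 3 * (real n)\<^sup>2 \<le> \<bar>s n\<bar> ^ 3" by (simp add: power_mult_distrib r3)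
      then have "y ^ 3 \<le> \<bar>s n\<bar> ^ 3 / (real n)\<^sup>2" using n0 by (simp add: field_simps)
      also have "\<dots> \<le> (2 * (10001/10000)) ^ 3 * (\<bar>s n\<bar> ^ 3 / (real n)\<^sup>2)"
      proof -
        have "1 \<le> (2 * (10001/10000) :: real) ^ 3" by (rule one_le_power) simp
        then have "1 * (\<bar>s n\<bar> ^ 3 / (real n)\<^sup>2) \<le> (2 * (10001/10000)) ^ 3 * (\<bar>s n\<bar> ^ 3 / (real n)\<^sup>2)"
          by (rule mult_right_mono) (intro divide_nonneg_nonneg zero_le_power abs_ge_zero zero_le_power2)
        then show ?thesis by (simp only: mult_1_left)
      qed
      also have "\<dots> = e n ^ 3 * real n" unfolding e_def using n0
        by (simp add: power_mult_distrib power_divide power2_eq_square power3_eq_cube)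
      finally have "y ^ 3 \<le> e n ^ 3 * real n" .
      moreover have "y \<le> y ^ 3" using y by (intro self_le_power) auto
      ultimately show ?case using y by linarith
    qed
  qed
  have P0: "P \<longlonglongrightarrow> 0" unfolding P_def A_def by (rule long_cycle_prob_tendsto_0[OF e0 pos \<mu>])
  \<comment> \<open>The number \<open>1739/1000 * 4 * (10001/10000)\<^sup>2\<close> is about 6.9574,
    so the zero sequence can serve as \<open>\<epsilon>\<close>.\<close>
  let ?Q = "\<lambda>n. prob_Gnm n (M n) (\<lambda>E. real (circumference E) \<le> (6.958 + 0) * (s n)\<^sup>2 / real n)"
  have d5: "0 < (1 / 10 ^ 5 :: real)" by simp
  have lower: "eventually (\<lambda>n. 1 - 2 * P n \<le> ?Q n) sequentially"
    using pos order_tendstoD(2)[OF e0 zero_less_one] large[OF d5] eventually_ge_at_top[of "2::nat"]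
  proof eventually_elim
    case (elim n)
    let ?V = "all_edges n" and ?p = "(1 + e n) / real n"
    have n: "2 \<le> n" "0 < real n" using elim(4) by auto
    have en: "0 < e n" "e n < 1" using elim by auto
    have p: "0 \<le> ?p" "?p \<le> 1" using en n by (auto simp: field_simps)
    have Np0: "real (card ?V) * ?p = (real n - 1) * (1 + e n) / 2"
      unfolding card_all_edges real_choose_two using n by simp
    also have "\<dots> = real n / 2 + (e n * real n) / 2 - (1 + e n) / 2" by (simp add: field_simps)
    also have "e n * real n = 2 * (10001/10000 * \<bar>s n\<bar>)" unfolding e_def using n by simp
    finally have Np: "real (card ?V) * ?p = real n / 2 + 10001/10000 * \<bar>s n\<bar> - (1 + e n) / 2" by simp
    have r1: "1 \<le> real n powr (2/3)" using n by (simp add: ge_one_powr_ge_zero)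
    have big: "100000 * real n powr (2/3) \<le> \<bar>s n\<bar>" using elim(3) by simp
    then have s5: "100000 \<le> \<bar>s n\<bar>" using r1 by linarith
    have diff: "\<bar>s n\<bar> / 20000 \<le> real (card ?V) * ?p - real (M n)"
    proof -
      have "real (M n) = s n + real n / 2" "(1 + e n) / 2 \<le> 1" using s_def[of n] en by auto
      moreover have "s n \<le> \<bar>s n\<bar>" by simp
      ultimately show ?thesis unfolding Np using s5 by linarith
    qed
    have MN: "real (M n) < real (card ?V) * ?p" using diff s5 by linarith
    have tail: "2 * (real (card ?V) * ?p) \<le> (real (card ?V) * ?p - real (M n))\<^sup>2"
    proof -
      have "real (card ?V) * ?p \<le> real n"
      proof -
        have "(real n - 1) * (1 + e n) / 2 \<le> (real n - 1) * 2 / 2"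
          using en n by (intro divide_right_mono mult_left_mono) auto
        then show ?thesis unfolding Np0 by simp
      qed
      \<comment> \<open>The shift of the mean must exceed the standard deviation, of order
        \<open>sqrt n\<close>; this follows from \<open>n powr (1/2) \<le> n powr (2/3)\<close> and
        the growth of \<open>s\<close>.\<close>
      moreover have "2 * real n \<le> (\<bar>s n\<bar> / 20000)\<^sup>2"
      proof -
        have "sqrt (real n) = real n powr (1/2)" using n by (simp add: powr_half_sqrt)
        also have "\<dots> \<le> real n powr (2/3)" using n by (intro powr_mono) auto
        finally have "100000 * sqrt (real n) \<le> \<bar>s n\<bar>" using big by simp
        then have "(5 * sqrt (real n))\<^sup>2 \<le> (\<bar>s n\<bar> / 20000)\<^sup>2" using n by (intro power_mono) auto
        then show ?thesis using n by (simp add: power_mult_distrib)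
      qed
      moreover have "(\<bar>s n\<bar> / 20000)\<^sup>2 \<le> (real (card ?V) * ?p - real (M n))\<^sup>2"
        using diff by (intro power_mono) auto
      ultimately show ?thesis by linarith
    qed
    have "real (card {E. E \<subseteq> ?V \<and> card E = M n \<and> A n E}) / real (card ?V choose M n) \<le> 2 * P n"
      unfolding P_def
    proof (rule uniform_le_twice_rprob[OF _ p _ MN tail])
      fix E E' assume "E \<subseteq> E'" "A n E"
      then show "A n E'" unfolding A_def is_cycle_def by blast
    qed simp
    moreover have card: "card (graphs_nm n (M n)) = card ?V choose M n"
      unfolding graphs_nm_def by (rule n_subsets) simp
    moreover have "1 - real (card {E. E \<subseteq> ?V \<and> card E = M n \<and> A n E}) / real (card ?V choose M n) \<le> ?Q n"
    proof -
      let ?G = "graphs_nm n (M n)"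
      let ?B = "{E \<in> ?G. real (circumference E) \<le> (6.958 + 0) * (s n)\<^sup>2 / real n}"
      let ?C = "{E. E \<subseteq> ?V \<and> card E = M n \<and> A n E}"
      have fin: "finite ?G" unfolding graphs_nm_def by (rule finite_subset[of _ "Pow ?V"]) auto
      have "?G \<subseteq> ?B \<union> ?C"
      proof
        fix E assume E: "E \<in> ?G"
        then have EV: "E \<subseteq> ?V" unfolding graphs_nm_def by simp
        show "E \<in> ?B \<union> ?C"
        proof (cases "A n E")
          case False
          have bound: "1739/1000 * ((e n)\<^sup>2 * real n) \<le> (6.958 + 0) * (s n)\<^sup>2 / real n"
          proof -
            have "1739/1000 * ((e n)\<^sup>2 * real n) = (1739/1000 * (2 * (10001/10000))\<^sup>2) * ((s n)\<^sup>2 / real n)"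
              unfolding e_def using n by (simp add: power_mult_distrib power_divide power2_eq_square)
            also have "\<dots> \<le> (6.958 + 0) * ((s n)\<^sup>2 / real n)"
              using n by (intro mult_right_mono) (auto simp: power2_eq_square)
            finally show ?thesis by simp
          qed
          have "real (circumference E) \<le> (6.958 + 0) * (s n)\<^sup>2 / real n"
          proof (cases "circumference E = 0")
            case False
            then obtain vs where "is_cycle E vs" "length vs = circumference E"
              using circumference_attained[OF EV] by blast
            then have "real (circumference E) < 1739/1000 * ((e n)\<^sup>2 * real n)"
              using \<open>\<not> A n E\<close> unfolding A_def by (metis not_le)
            then show ?thesis using bound by linarith
          qed simp
          then show ?thesis using E by simp
        qed (use E in \<open>auto simp: graphs_nm_def\<close>)
      qed
      moreover have finBC: "finite ?B" "finite ?C"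
        using fin by (auto intro: finite_subset[of _ "Pow ?V"])
      ultimately have "card ?G \<le> card (?B \<union> ?C)" by (intro card_mono) auto
      also have "\<dots> \<le> card ?B + card ?C" by (rule card_Un_le)
      finally have "real (card ?G) \<le> real (card ?B) + real (card ?C)" by simp
      moreover have "0 < card ?G"
      proof -
        have "real (M n) < real (card ?V) * 1" using MN mult_left_mono[OF p(2), of "real (card ?V)"] by simp
        then have "M n \<le> card ?V" by simp
        then show ?thesis unfolding card by (simp add: zero_less_binomial_iff)
      qed
      ultimately have "1 \<le> real (card ?B) / real (card ?G) + real (card ?C) / real (card ?G)"
        by (simp add: add_divide_distrib[symmetric] pos_le_divide_eq)
      then show ?thesis unfolding prob_Gnm_def card by simp
    qed
    ultimately show ?case by linarith
  qed
  have upper: "eventually (\<lambda>n. ?Q n \<le> 1) sequentially"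
  proof (rule always_eventually, rule allI)
    fix n
    have "finite (graphs_nm n (M n))" unfolding graphs_nm_def by (rule finite_subset[of _ "Pow (all_edges n)"]) auto
    then have "card {E \<in> graphs_nm n (M n). real (circumference E) \<le> (6.958 + 0) * (s n)\<^sup>2 / real n} \<le> card (graphs_nm n (M n))"
      by (intro card_mono) auto
    then show "?Q n \<le> 1" unfolding prob_Gnm_def by (cases "card (graphs_nm n (M n)) = 0") (simp_all add: divide_le_eq_1)
  qed
  have "(\<lambda>n. 1 - 2 * P n) \<longlonglongrightarrow> 1"
    using tendsto_diff[OF tendsto_const tendsto_mult[OF tendsto_const P0], of 1 2] by simp
  then have "?Q \<longlonglongrightarrow> 1" by (rule tendsto_sandwich[OF lower upper _ tendsto_const])
  then show ?thesis by (intro exI[of _ "\<lambda>_. 0"] conjI tendsto_const)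
qed

end
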